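(* Let $Z>0$ and $\tau>0$, let $f$ be a source function, and for each $\varepsilon>0$ let $\nu^\varepsilon=\{\nu^\varepsilon(z)\}_{z\in[0,Z]}$ be a centered real random process. Let $a^\varepsilon(Z,s)$, $s\in\mathbb{R}$, be the transmitted wave associated with $\nu^\varepsilon$, $\tau$ and $f$ (defined in the context). Assume that there exists $\lambda>0$ such that the following three conditions hold. (A1) As $\varepsilon\to0$, the finite-dimensional distributions of the process $\{\int_0^z\nu^\varepsilon(z')\,dz'\}_{z\in[0,Z]}$ converge to those of a process $V=\{V(z)\}_{z\in[0,Z]}$ with finite second-order moments. (A2($\lambda$)) There exist two symmetric continuous functions $\gamma:[0,Z]^2\to[\gamma_-,\gamma_+]\subset(0,1)$ and $R:[0,Z]^2\to(0,\infty)$ such that for every $\delta>0$ there exists $z_\delta>0$ such that for all $z_1,z_2\in[0,Z]$ and $\varepsilon>0$ with $|z_1-z_2|>\varepsilon^\lambda z_\delta$, $$\bigl|\mathbb{E}[\nu^\varepsilon(z_1)\nu^\varepsilon(z_2)]-R(z_1,z_2)|z_1-z_2|^{-\gamma(z_1,z_2)}\bigr|\le\delta\,R(z_1,z_2)|z_1-z_2|^{-\gamma(z_1,z_2)}.$$ (A3($\lambda$)) For every $\rho>0$ there exist $C_\rho>0$ and $\gamma_\rho\in(0,1)$ such that $|\mathbb{E}[\nu^\varepsilon(z_1)\nu^\varepsilon(z_2)]|\le C_\rho|z_1-z_2|^{-\gamma_\rho}$ for every $\varepsilon>0$ and all $z_1,z_2\in[0,Z]$ with $|z_1-z_2|<\varepsilon^\lambda\rho$.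 Then, as $\varepsilon\to0$, the process $\{a^\varepsilon(Z,s)\}_s$ converges in distribution, in the space of continuous functions endowed with the uniform topology, to the random process $\{\widetilde a(Z,s)\}_s$ given by $$\widetilde a(Z,s)=f\bigl(s-\tfrac12V(Z)\bigr).$$
   Context: Transmitted wave. The source $f:\mathbb{R}\to\mathbb{R}$ is a continuous integrable function whose Fourier transform $\hat f(\omega)=\int_{-\infty}^\infty e^{i\omega s}f(s)\,ds$ is integrable. The processes $\nu^\varepsilon$ have finite second moments and measurable, integrable trajectories on $[0,Z]$. For each $\omega\in\mathbb{R}$ the propagator $P^\varepsilon_\omega(z)$, $z\in[0,Z]$, is the $2\times2$ complex matrix solving $$\frac{dP^\varepsilon_\omega}{dz}(z)=\frac{i\omega}{2}\nu^\varepsilon(z)\begin{pmatrix}1&-e^{-2i\omega z/\varepsilon^\tau}\\ e^{2i\omega z/\varepsilon^\tau}&-1\end{pmatrix}P^\varepsilon_\omega(z),\qquad P^\varepsilon_\omega(0)=\begin{pmatrix}1&0\\0&1\end{pmatrix}.$$ It has the form $P^\varepsilon_\omega=\begin{pmatrix}\alpha^\varepsilon_\omega&\overline{\beta^\varepsilon_\omega}\\ \beta^\varepsilon_\omega&\overline{\alpha^\varepsilon_\omega}\end{pmatrix}$. The transmission coefficient is $T^\varepsilon_\omega(z)=1/\overline{\alpha^\varepsilon_\omega}(z)$, and the transmitted wave is $$a^\varepsilon(Z,s)=\frac1{2\pi}\int_{-\infty}^\infty e^{-is\omega}T^\varepsilon_\omega(Z)\hat f(\omega)\,d\omega.$$ (Origin: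 with $\mu^\varepsilon=\varepsilon^\tau\nu^\varepsilon$, consider $\partial_tu^\varepsilon+\partial_zp^\varepsilon=0$, $(1/K^\varepsilon)\partial_tp^\varepsilon+\partial_zu^\varepsilon=0$, with $1/K^\varepsilon=1+\mu^\varepsilon$ on $[0,Z]$ and $1/K^\varepsilon=1$ elsewhere; put $A^\varepsilon=p^\varepsilon+u^\varepsilon$, $B^\varepsilon=u^\varepsilon-p^\varepsilon$ with $A^\varepsilon(0,t)=f(t/\varepsilon^\tau)$, $B^\varepsilon(Z,t)=0$; then $a^\varepsilon(z,s)=A^\varepsilon(z,z+\varepsilon^\tau s)$.)
   Formalization: The processes ν^ε are assumed jointly measurable in (z, randomness), not merely to have measurable, integrable trajectories; without this the covariance conditions need not govern the trajectory integrals and the claim can fail. *)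

theory Defs
  imports "HOL-Probability.Probability"
begin

text \<open>
  Convergence in distribution as \<open>\<epsilon> \<rightarrow> 0\<close> of random elements \<open>X \<epsilon>\<close>, each defined on its own
  probability space \<open>M \<epsilon>\<close>, to a random element \<open>Y\<close> on \<open>N\<close>.
\<close>
definition converges_in_distribution ::
  "(real \<Rightarrow> 'a measure) \<Rightarrow> (real \<Rightarrow> 'a \<Rightarrow> 'c::topological_space) \<Rightarrow> 'b measure \<Rightarrow> ('b \<Rightarrow> 'c) \<Rightarrow> bool"
where
  "converges_in_distribution M X N Y \<longleftrightarrow>
     (\<forall>\<epsilon>>0. X \<epsilon> \<in> borel_measurable (M \<epsilon>)) \<and>
     Y \<in> borel_measurable N \<and>
     (\<forall>\<phi> :: 'c \<Rightarrow> real. continuous_on UNIV \<phi> \<and> bounded (range \<phi>) \<longrightarrow>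
        ((\<lambda>\<epsilon>. \<integral>x. \<phi> (X \<epsilon> x) \<partial>M \<epsilon>) \<longlongrightarrow> (\<integral>y. \<phi> (Y y) \<partial>N)) (at_right 0))"

text \<open>
  A random vector of dimension \<open>n\<close> is encoded as a sequence that vanishes from index \<open>n\<close> on. This
  embeds \<open>n\<close>-dimensional space as a closed subspace and retract of \<^typ>\<open>nat \<Rightarrow> real\<close> with
  the product topology, so convergence in distribution is the same in both spaces.
\<close>
definition fdd_converge ::
  "real set \<Rightarrow> (real \<Rightarrow> 'a measure) \<Rightarrow> (real \<Rightarrow> real \<Rightarrow> 'a \<Rightarrow> real) \<Rightarrow>
   'b measure \<Rightarrow> (real \<Rightarrow> 'b \<Rightarrow> real) \<Rightarrow> bool"
where
  "fdd_converge T M X N Y \<longleftrightarrow>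
     (\<forall>(n::nat) (z :: nat \<Rightarrow> real). (\<forall>i<n. z i \<in> T) \<longrightarrow>
        converges_in_distribution
          M (\<lambda>\<epsilon> x. (\<lambda>i. if i < n then X \<epsilon> (z i) x else 0))
          N (\<lambda>y. (\<lambda>i. if i < n then Y (z i) y else 0)))"

definition source_fourier :: "(real \<Rightarrow> real) \<Rightarrow> real \<Rightarrow> complex" where
  "source_fourier f \<omega> =
     (LINT s|lborel. exp (\<i> * complex_of_real (\<omega> * s)) * complex_of_real (f s))"

definition source_function :: "(real \<Rightarrow> real) \<Rightarrow> bool" where
  "source_function f \<longleftrightarrow>
     continuous_on UNIV f \<and> integrable lborel f \<and> integrable lborel (source_fourier f)"

definition propagator_coeff ::
  "real \<Rightarrow> real \<Rightarrow> (real \<Rightarrow> real) \<Rightarrow> real \<Rightarrow> real \<Rightarrow> complex^2^2"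
where
  "propagator_coeff \<tau> \<epsilon> n \<omega> z =
     (let c = \<i> * complex_of_real \<omega> / 2 * complex_of_real (n z);
          \<theta> = \<i> * complex_of_real (2 * \<omega> * z / \<epsilon> powr \<tau>)
      in vector [vector [c,         - c * exp (- \<theta>)],
                 vector [c * exp \<theta>, - c            ]])"

text \<open>
  The trajectory \<open>n\<close> is merely integrable, so the linear differential equation is understood in the
  sense of Caratheodory, that is, as the equivalent integral equation.
\<close>
definition solves_propagator_ode ::
  "real \<Rightarrow> real \<Rightarrow> real \<Rightarrow> (real \<Rightarrow> real) \<Rightarrow> real \<Rightarrow> (real \<Rightarrow> complex^2^2) \<Rightarrow> bool"
where
  "solves_propagator_ode Z \<tau> \<epsilon> n \<omega> P \<longleftrightarrow>
     continuous_on {0..Z} P \<and>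
     (\<forall>z\<in>{0..Z}. P z = mat 1 + (LINT z':{0..z}|lborel. propagator_coeff \<tau> \<epsilon> n \<omega> z' ** P z'))"

text \<open>
  For an integrable trajectory the solution exists and is unique on \<open>[0,Z]\<close>; the choice operator
  only leaves its irrelevant values outside \<open>[0,Z]\<close> open.
\<close>
definition propagator ::
  "real \<Rightarrow> real \<Rightarrow> real \<Rightarrow> (real \<Rightarrow> real) \<Rightarrow> real \<Rightarrow> real \<Rightarrow> complex^2^2"
where
  "propagator Z \<tau> \<epsilon> n \<omega> = (SOME P. solves_propagator_ode Z \<tau> \<epsilon> n \<omega> P)"

definition transmission_coeff ::
  "real \<Rightarrow> real \<Rightarrow> real \<Rightarrow> (real \<Rightarrow> real) \<Rightarrow> real \<Rightarrow> real \<Rightarrow> complex"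
where
  "transmission_coeff Z \<tau> \<epsilon> n \<omega> z = 1 / cnj (propagator Z \<tau> \<epsilon> n \<omega> z $ 1 $ 1)"

definition transmitted_wave ::
  "real \<Rightarrow> real \<Rightarrow> (real \<Rightarrow> real) \<Rightarrow> real \<Rightarrow> (real \<Rightarrow> real) \<Rightarrow> real \<Rightarrow> complex"
where
  "transmitted_wave Z \<tau> f \<epsilon> n s =
     1 / (2 * complex_of_real pi) *
     (LINT \<omega>|lborel. exp (- \<i> * complex_of_real (s * \<omega>)) *
        transmission_coeff Z \<tau> \<epsilon> n \<omega> Z * source_fourier f \<omega>)"

text \<open>
  Measurability of the trajectories is taken in the usual sense of a measurable process, i.e.\ joint
  measurability; it makes path integrals random variables and gives access to Fubini's theorem.
\<close>
definition centered_medium_process :: "real \<Rightarrow> 'a measure \<Rightarrow> (real \<Rightarrow> 'a \<Rightarrow> real) \<Rightarrow> bool" where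
  "centered_medium_process Z M \<nu> \<longleftrightarrow>
     (\<lambda>(z, x). \<nu> z x) \<in> borel_measurable (restrict_space borel {0..Z} \<Otimes>\<^sub>M M) \<and>
     (\<forall>x\<in>space M. set_integrable lborel {0..Z} (\<lambda>z. \<nu> z x)) \<and>
     (\<forall>z\<in>{0..Z}. \<nu> z \<in> borel_measurable M \<and> integrable M (\<lambda>x. (\<nu> z x)\<^sup>2) \<and>
        (\<integral>x. \<nu> z x \<partial>M) = 0)"

definition second_order_process :: "real \<Rightarrow> 'b measure \<Rightarrow> (real \<Rightarrow> 'b \<Rightarrow> real) \<Rightarrow> bool" where
  "second_order_process Z N V \<longleftrightarrow>
     (\<forall>z\<in>{0..Z}. V z \<in> borel_measurable N \<and> integrable N (\<lambda>y. (V z y)\<^sup>2))"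

definition cond_A1 ::
  "real \<Rightarrow> (real \<Rightarrow> 'a measure) \<Rightarrow> (real \<Rightarrow> real \<Rightarrow> 'a \<Rightarrow> real) \<Rightarrow>
   'b measure \<Rightarrow> (real \<Rightarrow> 'b \<Rightarrow> real) \<Rightarrow> bool"
where
  "cond_A1 Z M \<nu> N V \<longleftrightarrow>
     second_order_process Z N V \<and>
     fdd_converge {0..Z} M (\<lambda>\<epsilon> z x. LINT z':{0..z}|lborel. \<nu> \<epsilon> z' x) N V"

definition cond_A2 ::
  "real \<Rightarrow> (real \<Rightarrow> 'a measure) \<Rightarrow> (real \<Rightarrow> real \<Rightarrow> 'a \<Rightarrow> real) \<Rightarrow> real \<Rightarrow> bool"
where
  "cond_A2 Z M \<nu> lam \<longleftrightarrow>
     (\<exists>(\<gamma> :: real \<Rightarrow> real \<Rightarrow> real) (R :: real \<Rightarrow> real \<Rightarrow> real) \<gamma>min \<gamma>max.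
        0 < \<gamma>min \<and> \<gamma>max < 1 \<and>
        continuous_on ({0..Z} \<times> {0..Z}) (\<lambda>(z1, z2). \<gamma> z1 z2) \<and>
        continuous_on ({0..Z} \<times> {0..Z}) (\<lambda>(z1, z2). R z1 z2) \<and>
        (\<forall>z1\<in>{0..Z}. \<forall>z2\<in>{0..Z}.
           \<gamma> z1 z2 \<in> {\<gamma>min..\<gamma>max} \<and> R z1 z2 > 0 \<and>
           \<gamma> z1 z2 = \<gamma> z2 z1 \<and> R z1 z2 = R z2 z1) \<and>
        (\<forall>\<delta>>0. \<exists>z\<delta>>0. \<forall>z1\<in>{0..Z}. \<forall>z2\<in>{0..Z}. \<forall>\<epsilon>>0.
           \<bar>z1 - z2\<bar> > \<epsilon> powr lam * z\<delta> \<longrightarrow>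
           \<bar>(\<integral>x. \<nu> \<epsilon> z1 x * \<nu> \<epsilon> z2 x \<partial>M \<epsilon>) - R z1 z2 * \<bar>z1 - z2\<bar> powr (- \<gamma> z1 z2)\<bar>
             \<le> \<delta> * (R z1 z2 * \<bar>z1 - z2\<bar> powr (- \<gamma> z1 z2))))"

text \<open>
  The diagonal is excluded explicitly: there the bound is \<open>0\<^sup>-\<^sup>\<gamma> = \<infinity>\<close> and hence void, whereas in HOL
  \<open>0 powr a = 0\<close> would force the variances to vanish.
\<close>
definition cond_A3 ::
  "real \<Rightarrow> (real \<Rightarrow> 'a measure) \<Rightarrow> (real \<Rightarrow> real \<Rightarrow> 'a \<Rightarrow> real) \<Rightarrow> real \<Rightarrow> bool"
where
  "cond_A3 Z M \<nu> lam \<longleftrightarrow>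
     (\<forall>\<rho>>0. \<exists>C>0. \<exists>\<gamma>\<in>{0<..<1}. \<forall>\<epsilon>>0. \<forall>z1\<in>{0..Z}. \<forall>z2\<in>{0..Z}.
        z1 \<noteq> z2 \<and> \<bar>z1 - z2\<bar> < \<epsilon> powr lam * \<rho> \<longrightarrow>
        \<bar>\<integral>x. \<nu> \<epsilon> z1 x * \<nu> \<epsilon> z2 x \<partial>M \<epsilon>\<bar> \<le> C * \<bar>z1 - z2\<bar> powr (- \<gamma>))"

text \<open>
  Convergence in distribution of random functions in the space of continuous functions with the
  uniform topology, i.e.\ the topology of uniform convergence on the whole line, carried by the type
  of bounded continuous functions. Membership of the trajectories in that space is demanded
  explicitly because \<^const>\<open>Bcontfun\<close> is unspecified elsewhere.
\<close>
definition converges_in_distribution_uniform ::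
  "(real \<Rightarrow> 'a measure) \<Rightarrow> (real \<Rightarrow> real \<Rightarrow> 'a \<Rightarrow> complex) \<Rightarrow>
   'b measure \<Rightarrow> (real \<Rightarrow> 'b \<Rightarrow> complex) \<Rightarrow> bool"
where
  "converges_in_distribution_uniform M X N Y \<longleftrightarrow>
     (\<forall>\<epsilon>>0. \<forall>x\<in>space (M \<epsilon>). (\<lambda>s. X \<epsilon> s x) \<in> bcontfun) \<and>
     (\<forall>y\<in>space N. (\<lambda>s. Y s y) \<in> bcontfun) \<and>
     converges_in_distribution M (\<lambda>\<epsilon> x. Bcontfun (\<lambda>s. X \<epsilon> s x)) N (\<lambda>y. Bcontfun (\<lambda>s. Y s y))"

end

theory Submission
  imports Defs "HOL-Real_Asymp.Real_Asymp"
begin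

text \<open>
  Freed of the phase \<open>exp (\<i> \<omega> V\<^sup>\<epsilon> / 2)\<close>, where \<open>V\<^sup>\<epsilon>\<close> is the integral of \<open>\<nu>\<^sup>\<epsilon>\<close>, the transmission
  coefficient \<open>q\<close> and the reflection coefficient \<open>r\<close> are bounded by 1 and solve a Riccati system that
  is driven only by the oscillating path \<open>U(z) = \<integral>\<^sub>0\<^sup>z \<nu>\<^sup>\<epsilon>(t) exp (2 \<i> \<omega> t / \<epsilon>\<^sup>\<tau>) dt\<close>. The trajectories
  \<open>\<nu>\<^sup>\<epsilon>\<close> have no uniform \<open>L\<^sup>1\<close> bound, but (A2) and (A3) dominate the covariance off the diagonal by
  \<open>C |z\<^sub>1 - z\<^sub>2|\<^sup>-\<^sup>\<gamma>\<close> with \<open>\<gamma> < 1\<close>. Hence the dyadic square sums at level \<open>n\<close> of \<open>V\<^sup>\<epsilon>\<close> and \<open>U\<close> decay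
  geometrically in \<open>n\<close> outside an event of small probability: both paths are, uniformly in \<open>\<epsilon>\<close>, of
  regularity above 1/2, and the system is controlled by Young's integration theory. Since the
  increments of \<open>U\<close> tend to 0 in mean square by the Riemann-Lebesgue lemma, \<open>q\<close> tends to 1 in
  probability for each frequency. By dominated convergence and Fourier inversion the wave is then
  uniformly close to \<open>f (s - V\<^sup>\<epsilon>(Z) / 2)\<close>, a continuous image of the real random variable
  \<open>V\<^sup>\<epsilon>(Z)\<close>, to which (A1) applies.
\<close>

section \<open>Indefinite integrals of integrable functions\<close>

text \<open>Gronwall's inequality for the propagator costs the exponential of the integral of
  |\<nu>|, and nothing bounds that integral uniformly in \<epsilon>: (A2) and (A3) are silent on the
  diagonal, that is, on the variances. The absolute continuity of a path may therefore be used only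
  qualitatively (existence, uniqueness, finiteness, limits of Riemann sums), while every uniform
  bound has to pass through increments, whose second moments see the covariance off the diagonal
  only. This dictates the dyadic square sums: their expectations add up from second moments, and
  Cauchy-Schwarz pairs them level by level in Young's estimate. The bounds are closed on the
  quotients r = b / a and q = 1 / a and not on the linear system, because |a|^2 - |b|^2 = 1 keeps
  both quotients in the unit disc, where products of bounded factors cost no more than sums. Each
  frequency is treated separately; the uniform topology enters only through integration against the
  integrable Fourier transform of the source.\<close>

lemma set_integrable_continuous_mult:
  fixes w g :: "real \<Rightarrow> complex"
  assumes "continuous_on {a..b} w" "set_integrable lborel {a..b} g"
  shows "set_integrable lborel {a..b} (\<lambda>t. w t * g t)"
proof -
  obtain B where B: "\<And>t. t \<in> {a..b} \<Longrightarrow> norm (w t) \<le> B"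
    using compact_continuous_image[OF assms(1) compact_Icc] by (meson bounded_iff compact_imp_bounded imageI)
  have [measurable]: "(\<lambda>t. indicator {a..b} t *\<^sub>R w t) \<in> borel_measurable borel"
    using borel_measurable_continuous_on_indicator[OF _ assms(1)] by auto
  have [measurable]: "(\<lambda>t. indicator {a..b} t *\<^sub>R g t) \<in> borel_measurable borel"
    using assms(2) unfolding set_integrable_def by (auto dest: borel_measurable_integrable)
  have eq: "indicator {a..b} t *\<^sub>R (w t * g t) = (indicator {a..b} t *\<^sub>R w t) * (indicator {a..b} t *\<^sub>R g t)" for t
    by (auto simp: indicator_def)
  have i: "integrable lborel (\<lambda>t. B * norm (indicator {a..b} t *\<^sub>R g t))"
    using assms(2) unfolding set_integrable_def by (intro integrable_mult_right integrable_norm)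
  show ?thesis unfolding set_integrable_def
  proof (rule Bochner_Integration.integrable_bound[OF i])
    show "(\<lambda>t. indicator {a..b} t *\<^sub>R (w t * g t)) \<in> borel_measurable lborel"
      unfolding eq by measurable
    show "AE t in lborel. norm (indicator {a..b} t *\<^sub>R (w t * g t)) \<le> norm (B * norm (indicator {a..b} t *\<^sub>R g t))"
    proof (rule AE_I2)
      fix t
      have "norm (indicator {a..b} t *\<^sub>R (w t * g t)) \<le> B * norm (indicator {a..b} t *\<^sub>R g t)"
        using B[of t] by (auto simp: indicator_def norm_mult mult_right_mono)
      thus "norm (indicator {a..b} t *\<^sub>R (w t * g t)) \<le> norm (B * norm (indicator {a..b} t *\<^sub>R g t))"
        by simp
    qed
  qed
qed

section \<open>Step functions and Riemann sums\<close>

lemma set_integral_Icc_eq_Ico: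
  fixes g :: "real \<Rightarrow> complex"
  shows "(LINT t:{x..y}|lborel. g t) = (LINT t:{x..<y}|lborel. g t)"
  unfolding set_lebesgue_integral_def
proof (rule integral_discrete_difference[where X="{y}"])
qed (auto simp: indicator_def)

lemma grid_floor:
  fixes a b t :: real and p :: nat
  assumes "a < t" "t < b" "0 < p"
  defines "j \<equiv> nat \<lfloor>(t - a) / (b - a) * p\<rfloor>"
  shows "j < p" "a + (b - a) * j / p \<le> t" "t < a + (b - a) * Suc j / p"
proof -
  have P: "real p > 0" using assms by simp
  define X where "X = (t - a) / (b - a) * p"
  have X: "0 \<le> X" "X < p"
  proof -
    show "0 \<le> X" unfolding X_def using assms by simp
    have "X < 1 * real p" unfolding X_def by (rule mult_strict_right_mono) (use assms in auto)
    thus "X < p" by simp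
  qed
  have fl: "real j \<le> X" "X < real (Suc j)" using X(1) unfolding j_def X_def[symmetric] by linarith+
  have XP: "(b - a) * X / p = t - a" unfolding X_def using assms by simp
  show "j < p" using fl X by linarith
  have "(b - a) * real j / p \<le> (b - a) * X / p" using fl assms by (intro divide_right_mono mult_left_mono) auto
  thus "a + (b - a) * j / p \<le> t" using XP by simp
  have "(b - a) * X / p < (b - a) * real (Suc j) / p"
    using fl assms by (intro divide_strict_right_mono mult_strict_left_mono) auto
  thus "t < a + (b - a) * Suc j / p" using XP by simp
qed

text \<open>The sum is the integral of \<open>g\<close> against the step function with value
  \<open>s n j\<close> on the j-th cell, so dominated convergence applies with majorant
  \<open>B * norm (g t)\<close>. The value on a cell is left arbitrary in order to serve both the
  chain rule, where it depends on the two ends of the cell, and the Young sums, where it is the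
  value at the left end.\<close>

lemma step_integral_limit:
  fixes g S :: "real \<Rightarrow> complex" and s :: "nat \<Rightarrow> nat \<Rightarrow> complex" and p :: "nat \<Rightarrow> nat"
  assumes ab: "a < b" and g: "set_integrable lborel {a..b} g" and p: "\<And>n. p n > 0"
    and B: "\<And>n j. j < p n \<Longrightarrow> norm (s n j) \<le> B"
    and S: "\<And>t. a < t \<Longrightarrow> t < b \<Longrightarrow> (\<lambda>n. s n (nat \<lfloor>(t - a) / (b - a) * p n\<rfloor>)) \<longlonglongrightarrow> S t"
    and Sg: "set_integrable lborel {a..b} (\<lambda>t. S t * g t)"
  shows "(\<lambda>n. \<Sum>j<p n. s n j * (LINT t:{a + (b - a) * j / p n..a + (b - a) * Suc j / p n}|lborel. g t))
    \<longlonglongrightarrow> (LINT t:{a..b}|lborel. S t * g t)"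
proof -
  define I where "I n j = {a + (b - a) * real j / p n..<a + (b - a) * real (Suc j) / p n}" for n j
  \<comment> \<open>Half-open cells make the index of the cell containing \<open>t\<close>
    unique.\<close>
  have mem: "t \<in> I n j \<longleftrightarrow> j = nat \<lfloor>(t - a) / (b - a) * p n\<rfloor>" if "t \<ge> a" for t n j
  proof -
    have P: "real (p n) > 0" using p by simp
    have "a + (b - a) * real i / p n \<le> t \<longleftrightarrow> real i \<le> (t - a) / (b - a) * p n" for i
      using P ab by (simp add: field_simps)
    moreover have "t < a + (b - a) * real i / p n \<longleftrightarrow> (t - a) / (b - a) * p n < real i" for i
      using P ab by (simp add: field_simps)
    moreover have "(t - a) / (b - a) * p n \<ge> 0" using that ab by simp
    ultimately have "t \<in> I n j \<longleftrightarrow> real j \<le> (t - a) / (b - a) * p n \<and> (t - a) / (b - a) * p n < real j + 1"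
      and 0: "(t - a) / (b - a) * p n \<ge> 0" unfolding I_def atLeastLessThan_iff by (simp_all only: of_nat_Suc add.commute[of 1] flip: of_nat_Suc) (simp_all add: of_nat_Suc add.commute)
    moreover have "real j \<le> X \<and> X < real j + 1 \<longleftrightarrow> j = nat \<lfloor>X\<rfloor>" if "X \<ge> 0" for X
    proof -
      have "real j \<le> X \<and> X < real j + 1 \<longleftrightarrow> \<lfloor>X\<rfloor> = int j" by (simp add: floor_eq_iff)
      thus ?thesis using that by auto
    qed
    ultimately show ?thesis by blast
  qed
  have sub: "I n j \<subseteq> {a..b}" if "j < p n" for n j
  proof -
    have P: "real (p n) > 0" using p by simp
    have "(b - a) * real (Suc j) \<le> (b - a) * real (p n)" using that ab by (intro mult_left_mono) auto
    hence "(b - a) * real (Suc j) / p n \<le> b - a" using P by (subst pos_divide_le_eq) auto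
    moreover have "(b - a) * real j / p n \<ge> 0" using ab by auto
    ultimately show ?thesis unfolding I_def by auto
  qed
  have gI: "integrable lborel (\<lambda>t. indicator (I n j) t *\<^sub>R g t)" if "j < p n" for n j
    using set_integrable_subset[OF g _ sub[OF that]] unfolding set_integrable_def I_def by auto
  define G where "G n t = (\<Sum>j<p n. s n j * (indicator (I n j) t *\<^sub>R g t))" for n t
  have Gint: "integrable lborel (G n)" for n unfolding G_def using gI by (intro Bochner_Integration.integrable_sum integrable_mult_right) auto
  have sumG: "(\<Sum>j<p n. s n j * (LINT t:{a + (b - a) * j / p n..a + (b - a) * Suc j / p n}|lborel. g t))
     = integral\<^sup>L lborel (G n)" for n
  proof -
    have "integral\<^sup>L lborel (G n) = (\<Sum>j<p n. LINT t|lborel. s n j * (indicator (I n j) t *\<^sub>R g t))"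
      unfolding G_def using gI by (intro Bochner_Integration.integral_sum integrable_mult_right) auto
    also have "\<dots> = (\<Sum>j<p n. s n j * (LINT t|lborel. indicator (I n j) t *\<^sub>R g t))"
      by (intro sum.cong[OF refl] integral_mult_right_zero)
    finally show ?thesis unfolding I_def set_integral_Icc_eq_Ico unfolding set_lebesgue_integral_def by (rule sym)
  qed
  have Geq: "G n t = (if nat \<lfloor>(t - a) / (b - a) * p n\<rfloor> < p n then s n (nat \<lfloor>(t - a) / (b - a) * p n\<rfloor>) * g t else 0)"
    if "a \<le> t" for n t
  proof -
    define J where "J = nat \<lfloor>(t - a) / (b - a) * p n\<rfloor>"
    have "indicator (I n j) t *\<^sub>R g t = (if j = J then g t else 0)" for j
      using mem[OF that, of n j] unfolding J_def[symmetric] by (cases "j = J") auto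
    hence "G n t = (\<Sum>j<p n. if j = J then s n j * g t else 0)"
      unfolding G_def by (intro sum.cong) auto
    thus ?thesis unfolding J_def[symmetric] by (simp add: sum.delta')
  qed
  have lt: "nat \<lfloor>(t - a) / (b - a) * p n\<rfloor> < p n" if "a < t" "t < b" for t n
    by (rule grid_floor(1)[OF that p])
  have Gz: "G n t = 0" if "t \<notin> {a..b}" for n t
    unfolding G_def
  proof (intro sum.neutral ballI)
    fix j assume "j \<in> {..<p n}"
    hence "t \<notin> I n j" using sub[of j n] that by blast
    thus "s n j * (indicator (I n j) t *\<^sub>R g t) = 0" by simp
  qed
  have B0: "B \<ge> 0" using B[OF p] norm_ge_zero order_trans by blast
  have "(\<lambda>n. integral\<^sup>L lborel (G n)) \<longlonglongrightarrow> (LINT t|lborel. indicator {a..b} t *\<^sub>R (S t * g t))"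
  proof (rule integral_dominated_convergence[where w="\<lambda>t. B * norm (indicator {a..b} t *\<^sub>R g t)"])
    show "(\<lambda>t. indicator {a..b} t *\<^sub>R (S t * g t)) \<in> borel_measurable lborel"
      using Sg unfolding set_integrable_def by auto
    show "G n \<in> borel_measurable lborel" for n using Gint by auto
    show "integrable lborel (\<lambda>t. B * norm (indicator {a..b} t *\<^sub>R g t))"
      using g unfolding set_integrable_def by (intro integrable_mult_right integrable_norm)
    show "AE t in lborel. norm (G n t) \<le> B * norm (indicator {a..b} t *\<^sub>R g t)" for n
    proof (rule AE_I2)
      fix t
      show "norm (G n t) \<le> B * norm (indicator {a..b} t *\<^sub>R g t)"
      proof (cases "t \<in> {a..b}")
        case True
        thus ?thesis using Geq[of t n] B B0 by (auto simp: norm_mult intro!: mult_right_mono)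
      qed (use Gz in auto)
    qed
    \<comment> \<open>At \<open>t = b\<close> the floor is \<open>p n\<close>, one beyond the range
      of the sum, and \<open>S\<close> is prescribed only inside the interval; the two end points
      form a null set.\<close>
    have "AE t in lborel. t \<noteq> a \<and> t \<noteq> b"
      by (simp add: AE_lborel_singleton)
    thus "AE t in lborel. (\<lambda>n. G n t) \<longlonglongrightarrow> indicator {a..b} t *\<^sub>R (S t * g t)"
    proof eventually_elim
      fix t assume t: "t \<noteq> a \<and> t \<noteq> b"
      show "(\<lambda>n. G n t) \<longlonglongrightarrow> indicator {a..b} t *\<^sub>R (S t * g t)"
      proof (cases "t \<in> {a..b}")
        case True
        hence 1: "a < t" "t < b" using t by auto
        have "(\<lambda>n. s n (nat \<lfloor>(t - a) / (b - a) * p n\<rfloor>) * g t) \<longlonglongrightarrow> S t * g t"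
          by (intro tendsto_intros S 1)
        thus ?thesis using 1 Geq[of t] lt[of t] by simp
      qed (use Gz in auto)
    qed
  qed
  thus ?thesis unfolding sumG unfolding set_lebesgue_integral_def .
qed

definition primitive_on :: "real \<Rightarrow> (real \<Rightarrow> complex) \<Rightarrow> (real \<Rightarrow> complex) \<Rightarrow> bool" where
  "primitive_on Z u g \<longleftrightarrow> set_integrable lborel {0..Z} g \<and>
     (\<forall>z\<in>{0..Z}. u z = u 0 + (LINT t:{0..z}|lborel. g t))"

lemma primitive_on_integrable: "primitive_on Z u g \<Longrightarrow> set_integrable lborel {0..Z} g"
  by (simp add: primitive_on_def)

lemma primitive_on_eq: "primitive_on Z u g \<Longrightarrow> z \<in> {0..Z} \<Longrightarrow> u z = u 0 + (LINT t:{0..z}|lborel. g t)"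
  unfolding primitive_on_def by blast

lemma primitive_on_diff:
  assumes "primitive_on Z u g" "0 \<le> x" "x \<le> y" "y \<le> Z"
  shows "u y - u x = (LINT t:{x..y}|lborel. g t)"
proof -
  have i: "set_integrable lborel A g" if "A \<subseteq> {0..Z}" "A \<in> sets lborel" for A
    using set_integrable_subset[OF primitive_on_integrable[OF assms(1)]] that by auto
  have "(LINT t:{0..y}|lborel. g t) = (LINT t:{0..<x} \<union> {x..y}|lborel. g t)"
    using assms by (intro arg_cong[where f="\<lambda>A. LINT t:A|lborel. g t"]) auto
  also have "\<dots> = (LINT t:{0..<x}|lborel. g t) + (LINT t:{x..y}|lborel. g t)"
    by (rule set_integral_Un) (use assms in \<open>auto intro!: i\<close>)
  finally have "(LINT t:{0..y}|lborel. g t) = (LINT t:{0..x}|lborel. g t) + (LINT t:{x..y}|lborel. g t)"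
    unfolding set_integral_Icc_eq_Ico[of 0 x] .
  moreover have "u y = u 0 + (LINT t:{0..y}|lborel. g t)" "u x = u 0 + (LINT t:{0..x}|lborel. g t)"
    using assms by (auto intro!: primitive_on_eq[OF assms(1)])
  ultimately show ?thesis by (metis add_diff_cancel_left add_diff_cancel_left' )
qed

lemma primitive_on_continuous:
  assumes "primitive_on Z u g"
  shows "continuous_on {0..Z} u"
proof -
  have "continuous_on {0..Z} (\<lambda>z. u 0 + integral {0..z} g)"
    using set_borel_integral_eq_integral(1)[OF primitive_on_integrable[OF assms]]
    by (intro continuous_intros indefinite_integral_continuous_1)
  moreover have "u z = u 0 + integral {0..z} g" if "z \<in> {0..Z}" for z
  proof -
    have "set_integrable lborel {0..z} g"
      by (rule set_integrable_subset[OF primitive_on_integrable[OF assms]]) (use that in auto)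
    from set_borel_integral_eq_integral(2)[OF this] show ?thesis
      using primitive_on_eq[OF assms that] by metis
  qed
  ultimately show ?thesis by (metis (no_types, lifting) continuous_on_cong)
qed

lemma primitive_onI:
  assumes "set_integrable lborel {0..Z} g" "\<And>z. z \<in> {0..Z} \<Longrightarrow> u z = c + (LINT t:{0..z}|lborel. g t)"
  shows "primitive_on Z u g"
proof (cases "0 \<le> Z")
  case True
  have "(LINT t:{0..0}|lborel. g t) = 0"
    unfolding set_integral_Icc_eq_Ico by (simp add: set_lebesgue_integral_def)
  with assms(2)[of 0] True have "u 0 = c" by simp
  thus ?thesis using assms unfolding primitive_on_def by blast
qed (use assms in \<open>auto simp: primitive_on_def\<close>)

lemma primitive_on_integral:
  assumes "set_integrable lborel {0..Z} g"
  shows "primitive_on Z (\<lambda>z. LINT t:{0..z}|lborel. g t) g"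
  using assms by (intro primitive_onI[where c=0]) auto

lemma primitive_on_subset_integrable:
  assumes "primitive_on Z u g" "z \<in> {0..Z}"
  shows "set_integrable lborel {0..z} g"
  by (rule set_integrable_subset[OF primitive_on_integrable[OF assms(1)]]) (use assms in auto)

text \<open>
  The chain rule, with \<open>\<Phi>\<close> the divided difference of \<open>F\<close>. Telescoping over a grid turns the increment
  of \<open>F \<circ> u\<close> into a Riemann sum, so that no differentiability almost everywhere is needed.
\<close>
lemma primitive_on_compose:
  assumes u: "primitive_on Z u g"
    and F: "\<And>x y. x \<in> u ` {0..Z} \<Longrightarrow> y \<in> u ` {0..Z} \<Longrightarrow> F y - F x = \<Phi> x y * (y - x)"
    and \<Phi>: "continuous_on (u ` {0..Z} \<times> u ` {0..Z}) (\<lambda>(x, y). \<Phi> x y)"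
  shows "primitive_on Z (\<lambda>z. F (u z)) (\<lambda>t. \<Phi> (u t) (u t) * g t)"
proof -
  note cu = primitive_on_continuous[OF u]
  have cd: "continuous_on {0..Z} (\<lambda>t. \<Phi> (u t) (u t))"
    using continuous_on_compose2[OF \<Phi>, of "{0..Z}" "\<lambda>t. (u t, u t)"] cu
    by (auto intro!: continuous_intros)
  have int: "set_integrable lborel {0..Z} (\<lambda>t. \<Phi> (u t) (u t) * g t)"
    by (rule set_integrable_continuous_mult[OF cd primitive_on_integrable[OF u]])
  have "compact (u ` {0..Z} \<times> u ` {0..Z})"
    by (intro compact_Times compact_continuous_image cu) auto
  from compact_imp_bounded[OF compact_continuous_image[OF \<Phi> this]]
  obtain B where B': "\<And>w. w \<in> (\<lambda>(x, y). \<Phi> x y) ` (u ` {0..Z} \<times> u ` {0..Z}) \<Longrightarrow> norm w \<le> B"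
    unfolding bounded_iff by blast
  have B: "norm (\<Phi> (u x) (u y)) \<le> B" if "x \<in> {0..Z}" "y \<in> {0..Z}" for x y
    by (rule B', rule image_eqI[where x="(u x, u y)"]) (use that in auto)
  show ?thesis
  proof (rule primitive_onI[OF int, where c="F (u 0)"])
    fix z assume z: "z \<in> {0..Z}"
    show "F (u z) = F (u 0) + (LINT t:{0..z}|lborel. \<Phi> (u t) (u t) * g t)"
    proof (cases "z = 0")
      case True thus ?thesis unfolding True set_integral_Icc_eq_Ico by (simp add: set_lebesgue_integral_def)
    next
      case False
      hence z0: "0 < z" using z by auto
      \<comment> \<open>\<open>Suc n\<close> cells, so that the number of cells is never 0.\<close>
      define x where "x n j = z * real j / real (Suc n)" for n j
      have xin: "x n j \<in> {0..Z}" if "j \<le> Suc n" for n j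
      proof -
        have "z * real j \<le> z * real (Suc n)" using that z0 by (intro mult_left_mono) auto
        hence "x n j \<le> z" unfolding x_def by (subst pos_divide_le_eq) auto
        thus ?thesis using z z0 unfolding x_def by auto
      qed
      have mono: "x n j \<le> x n (Suc j)" for n j
        unfolding x_def using z0 by (intro divide_right_mono mult_left_mono) auto
      have lim: "(\<lambda>n. \<Sum>j<Suc n. \<Phi> (u (x n j)) (u (x n (Suc j))) *
          (LINT t:{0 + (z - 0) * real j / real (Suc n)..0 + (z - 0) * real (Suc j) / real (Suc n)}|lborel. g t))
        \<longlonglongrightarrow> (LINT t:{0..z}|lborel. \<Phi> (u t) (u t) * g t)"
      proof (rule step_integral_limit[OF z0 primitive_on_subset_integrable[OF u z], where p=Suc and B=B])
        show "set_integrable lborel {0..z} (\<lambda>t. \<Phi> (u t) (u t) * g t)"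
          by (rule set_integrable_subset[OF int]) (use z in auto)
        show "norm (\<Phi> (u (x n j)) (u (x n (Suc j)))) \<le> B" if "j < Suc n" for n j
          using that xin[of j n] xin[of "Suc j" n] by (intro B) auto
        fix t assume t: "0 < t" "t < z"
        define k where "k n = nat \<lfloor>(t - 0) / (z - 0) * real (Suc n)\<rfloor>" for n
        have klt: "k n < Suc n" and kl: "x n (k n) \<le> t" and kr: "t < x n (Suc (k n))" for n
          using grid_floor[OF t, of "Suc n"] unfolding k_def x_def by (simp_all del: of_nat_Suc)
        have d: "x n (Suc (k n)) = x n (k n) + z / real (Suc n)" for n
          unfolding x_def of_nat_Suc[of "k n"] by (simp add: distrib_left add_divide_distrib del: of_nat_Suc)
        have z_lim: "(\<lambda>n. z / real (Suc n)) \<longlonglongrightarrow> 0"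
          by (rule LIMSEQ_Suc[OF lim_const_over_n])
        have kl': "t - z / real (Suc n) \<le> x n (k n)" and kr': "x n (Suc (k n)) \<le> t + z / real (Suc n)" for n
          using kl[of n] kr[of n] unfolding d by simp_all
        have "(\<lambda>n. x n (k n) - t) \<longlonglongrightarrow> 0"
        proof (rule Lim_null_comparison[OF _ z_lim], rule always_eventually, rule allI)
          show "norm (x n (k n) - t) \<le> z / real (Suc n)" for n
            using kl[of n] kl'[of n] by (simp del: of_nat_Suc)
        qed
        hence "(\<lambda>n. x n (k n)) \<longlonglongrightarrow> t" by (rule LIM_zero_cancel)
        moreover have "(\<lambda>n. x n (Suc (k n)) - t) \<longlonglongrightarrow> 0"
        proof (rule Lim_null_comparison[OF _ z_lim], rule always_eventually, rule allI)
          show "norm (x n (Suc (k n)) - t) \<le> z / real (Suc n)" for n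
            using kr[of n] kr'[of n] by (simp del: of_nat_Suc)
        qed
        hence "(\<lambda>n. x n (Suc (k n))) \<longlonglongrightarrow> t" by (rule LIM_zero_cancel)
        moreover have tin: "t \<in> {0..Z}" using t z by auto
        moreover have xk: "x n (k n) \<in> {0..Z}" "x n (Suc (k n)) \<in> {0..Z}" for n
          using klt[of n] by (auto intro!: xin simp del: atLeastAtMost_iff)
        ultimately have "(\<lambda>n. u (x n (k n))) \<longlonglongrightarrow> u t" "(\<lambda>n. u (x n (Suc (k n)))) \<longlonglongrightarrow> u t"
          using continuous_on_tendsto_compose[OF cu, of "\<lambda>n. x n (k n)" t sequentially]
            continuous_on_tendsto_compose[OF cu, of "\<lambda>n. x n (Suc (k n))" t sequentially] by simp_all
        hence "(\<lambda>n. (u (x n (k n)), u (x n (Suc (k n))))) \<longlonglongrightarrow> (u t, u t)"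
          by (rule tendsto_Pair)
        from continuous_on_tendsto_compose[OF \<Phi> this]
        show "(\<lambda>n. \<Phi> (u (x n (nat \<lfloor>(t - 0) / (z - 0) * real (Suc n)\<rfloor>)))
             (u (x n (Suc (nat \<lfloor>(t - 0) / (z - 0) * real (Suc n)\<rfloor>))))) \<longlonglongrightarrow> \<Phi> (u t) (u t)"
          unfolding k_def[symmetric] using tin xk by simp
      qed auto
      have "(\<Sum>j<Suc n. \<Phi> (u (x n j)) (u (x n (Suc j))) *
          (LINT t:{0 + (z - 0) * real j / real (Suc n)..0 + (z - 0) * real (Suc j) / real (Suc n)}|lborel. g t))
        = F (u z) - F (u 0)" for n
      proof -
        have "(\<Sum>j<Suc n. \<Phi> (u (x n j)) (u (x n (Suc j))) *
          (LINT t:{0 + (z - 0) * real j / real (Suc n)..0 + (z - 0) * real (Suc j) / real (Suc n)}|lborel. g t))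
          = (\<Sum>j<Suc n. F (u (x n (Suc j))) - F (u (x n j)))"
        proof (rule sum.cong[OF refl])
          fix j assume j: "j \<in> {..<Suc n}"
          have 1: "x n j \<in> {0..Z}" "x n (Suc j) \<in> {0..Z}" using j by (auto intro!: xin simp del: atLeastAtMost_iff)
          have "(LINT t:{x n j..x n (Suc j)}|lborel. g t) = u (x n (Suc j)) - u (x n j)"
            using primitive_on_diff[OF u, of "x n j" "x n (Suc j)"] 1 mono by auto
          thus "\<Phi> (u (x n j)) (u (x n (Suc j))) *
          (LINT t:{0 + (z - 0) * real j / real (Suc n)..0 + (z - 0) * real (Suc j) / real (Suc n)}|lborel. g t)
            = F (u (x n (Suc j))) - F (u (x n j))"
            using F[of "u (x n j)" "u (x n (Suc j))"] 1 unfolding x_def by simp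
        qed
        also have "\<dots> = F (u (x n (Suc n))) - F (u (x n 0))" by (rule sum_lessThan_telescope)
        also have "\<dots> = F (u z) - F (u 0)" unfolding x_def by (simp del: of_nat_Suc)
        finally show ?thesis .
      qed
      with lim have "(\<lambda>n. F (u z) - F (u 0)) \<longlonglongrightarrow> (LINT t:{0..z}|lborel. \<Phi> (u t) (u t) * g t)" by simp
      hence "F (u z) - F (u 0) = (LINT t:{0..z}|lborel. \<Phi> (u t) (u t) * g t)"
        by (simp add: LIMSEQ_const_iff)
      from this[symmetric] show ?thesis by simp
    qed
  qed
qed

section \<open>Calculus of absolutely continuous functions\<close>

lemma primitive_on_add:
  assumes "primitive_on Z u f" "primitive_on Z v g"
  shows "primitive_on Z (\<lambda>z. u z + v z) (\<lambda>t. f t + g t)"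
proof (rule primitive_onI[where c="u 0 + v 0"])
  show "set_integrable lborel {0..Z} (\<lambda>t. f t + g t)"
    using assms by (intro set_integral_add(1) primitive_on_integrable)
  fix z assume z: "z \<in> {0..Z}"
  show "u z + v z = u 0 + v 0 + (LINT t:{0..z}|lborel. f t + g t)"
    using primitive_on_eq[OF assms(1) z] primitive_on_eq[OF assms(2) z]
      set_integral_add(2)[OF primitive_on_subset_integrable[OF assms(1) z] primitive_on_subset_integrable[OF assms(2) z]]
    by (metis add.assoc add.commute add.left_commute)
qed

lemma primitive_on_cmult:
  assumes "primitive_on Z u f"
  shows "primitive_on Z (\<lambda>z. c * u z) (\<lambda>t. c * f t)"
proof (rule primitive_onI[where c="c * u 0"])
  show "set_integrable lborel {0..Z} (\<lambda>t. c * f t)"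
    using primitive_on_integrable[OF assms] by simp
  fix z assume z: "z \<in> {0..Z}"
  show "c * u z = c * u 0 + (LINT t:{0..z}|lborel. c * f t)"
    using primitive_on_eq[OF assms z] by (metis distrib_left set_integral_mult_right)
qed

lemma primitive_on_cnj:
  assumes "primitive_on Z u f"
  shows "primitive_on Z (\<lambda>z. cnj (u z)) (\<lambda>t. cnj (f t))"
proof (rule primitive_onI[where c="cnj (u 0)"])
  have cnj_eq: "indicator A t *\<^sub>R cnj (f t) = cnj (indicator A t *\<^sub>R f t)" for A t
    by (simp add: indicator_def)
  show "set_integrable lborel {0..Z} (\<lambda>t. cnj (f t))"
    using primitive_on_integrable[OF assms] unfolding set_integrable_def cnj_eq complex_integrable_cnj .
  fix z assume z: "z \<in> {0..Z}"
  have "(LINT t:{0..z}|lborel. cnj (f t)) = cnj (LINT t:{0..z}|lborel. f t)"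
    unfolding set_lebesgue_integral_def cnj_eq by (rule Bochner_Integration.integral_cnj)
  thus "cnj (u z) = cnj (u 0) + (LINT t:{0..z}|lborel. cnj (f t))"
    using primitive_on_eq[OF assms z] by (metis complex_cnj_add)
qed

text \<open>The chain rule above composes with a function of one variable only. Polarisation, 4 u v
  = (u + v)^2 - (u - v)^2, reduces the product to squares.\<close>

lemma primitive_on_mult:
  assumes "primitive_on Z u f" "primitive_on Z v g"
  shows "primitive_on Z (\<lambda>z. u z * v z) (\<lambda>t. f t * v t + u t * g t)"
proof -
  have sq: "primitive_on Z (\<lambda>z. (w z)^2) (\<lambda>t. (w t + w t) * h t)" if "primitive_on Z w h" for w h
    by (rule primitive_on_compose[OF that]) (auto intro!: continuous_intros simp: algebra_simps power2_eq_square case_prod_unfold)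
  let ?p = "\<lambda>z. 1/4 * (u z + v z)^2 + -1/4 * (u z + -1 * v z)^2"
  have "primitive_on Z ?p
     (\<lambda>t. 1/4 * ((u t + v t + (u t + v t)) * (f t + g t)) +
       -1/4 * ((u t + -1 * v t + (u t + -1 * v t)) * (f t + -1 * g t)))"
    by (intro primitive_on_add primitive_on_cmult sq assms)
  moreover have "?p = (\<lambda>z. u z * v z)" by (auto simp: fun_eq_iff power2_eq_square field_simps)
  moreover have "(\<lambda>t. 1/4 * ((u t + v t + (u t + v t)) * (f t + g t)) +
       -1/4 * ((u t + -1 * v t + (u t + -1 * v t)) * (f t + -1 * g t))) = (\<lambda>t. f t * v t + u t * g t)"
    by (auto simp: fun_eq_iff field_simps)
  ultimately show ?thesis by simp
qed

lemma primitive_on_inverse: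
  assumes "primitive_on Z u f" "\<And>z. z \<in> {0..Z} \<Longrightarrow> u z \<noteq> 0"
  shows "primitive_on Z (\<lambda>z. 1 / u z) (\<lambda>t. - 1 / (u t * u t) * f t)"
proof (rule primitive_on_compose[OF assms(1), where F="\<lambda>x. 1 / x" and \<Phi>="\<lambda>x y. - 1 / (x * y)"])
  fix x y assume "x \<in> u ` {0..Z}" "y \<in> u ` {0..Z}"
  hence "x \<noteq> 0" "y \<noteq> 0" using assms(2) by auto
  thus "1 / y - 1 / x = - 1 / (x * y) * (y - x)" by (simp add: field_simps)
qed (use assms(2) in \<open>force intro!: continuous_intros simp: case_prod_unfold\<close>)

lemma primitive_on_exp:
  assumes "primitive_on Z u f"
  shows "primitive_on Z (\<lambda>z. exp (u z)) (\<lambda>t. exp (u t) * f t)"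
proof -
  \<comment> \<open>The divided difference of exp is exp x (exp (y - x) - 1) / (y - x).
    \<open>\<psi>\<close> is the last quotient with its removable singularity filled in; continuity
    at 0 is the derivative of exp there.\<close>
  define \<psi> :: "complex \<Rightarrow> complex" where "\<psi> d = (if d = 0 then 1 else (exp d - 1) / d)" for d
  have \<psi>: "continuous_on UNIV \<psi>"
  proof (rule continuous_at_imp_continuous_on, rule ballI)
    fix d :: complex
    show "isCont \<psi> d"
    proof (cases "d = 0")
      case True
      have "((\<lambda>h. (exp (0 + h) - exp 0) / h) \<longlongrightarrow> exp (0::complex)) (at 0)"
        using DERIV_exp[of "0::complex"] unfolding DERIV_def .
      moreover have "eventually (\<lambda>h. (exp (0 + h) - exp 0) / h = \<psi> h) (at 0)"
        unfolding \<psi>_def by (auto simp: eventually_at_filter)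
      ultimately have "(\<psi> \<longlongrightarrow> 1) (at 0)" by (simp add: tendsto_cong)
      thus ?thesis unfolding True isCont_def by (simp add: \<psi>_def)
    next
      case False
      have "isCont (\<lambda>d. (exp d - 1) / d) d" using False by (intro continuous_intros) auto
      moreover have "eventually (\<lambda>h. (exp h - 1) / h = \<psi> h) (nhds d)"
        using t1_space_nhds[OF False] unfolding \<psi>_def by eventually_elim auto
      ultimately show ?thesis by (metis isCont_cong)
    qed
  qed
  have "primitive_on Z (\<lambda>z. exp (u z)) (\<lambda>t. exp (u t) * \<psi> (u t - u t) * f t)"
  proof (rule primitive_on_compose[OF assms, where \<Phi>="\<lambda>x y. exp x * \<psi> (y - x)"])
    show "exp y - exp x = exp x * \<psi> (y - x) * (y - x)" for x y
      by (auto simp: \<psi>_def exp_diff field_simps)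
    have "continuous_on (u ` {0..Z} \<times> u ` {0..Z}) (\<lambda>p. exp (fst p) * \<psi> (snd p - fst p))"
      by (intro continuous_intros continuous_on_compose2[OF \<psi>]) auto
    thus "continuous_on (u ` {0..Z} \<times> u ` {0..Z}) (\<lambda>(x, y). exp x * \<psi> (y - x))"
      by (simp add: case_prod_unfold)
  qed
  thus ?thesis by (simp add: \<psi>_def)
qed

lemma primitive_on_cong:
  assumes "primitive_on Z u f" "\<And>z. z \<in> {0..Z} \<Longrightarrow> u z = v z" "\<And>t. t \<in> {0..Z} \<Longrightarrow> f t = g t"
  shows "primitive_on Z v g"
proof (cases "0 \<le> Z")
  case True
  have eq: "indicator A t *\<^sub>R f t = indicator A t *\<^sub>R g t" if "A \<subseteq> {0..Z}" for A t
    using assms(3)[of t] that by (cases "t \<in> A") auto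
  show ?thesis
  proof (rule primitive_onI[where c="u 0"])
    show "set_integrable lborel {0..Z} g"
      using primitive_on_integrable[OF assms(1)] unfolding set_integrable_def by (simp only: eq[OF order_refl])
    fix z assume z: "z \<in> {0..Z}"
    have "(LINT t:{0..z}|lborel. f t) = (LINT t:{0..z}|lborel. g t)"
      unfolding set_lebesgue_integral_def using z by (subst eq) auto
    thus "v z = u 0 + (LINT t:{0..z}|lborel. g t)"
      using primitive_on_eq[OF assms(1) z] assms(2)[OF z] by metis
  qed
qed (auto simp: primitive_on_def set_integrable_def)

section \<open>Dyadic energies and Young integrals\<close>

definition dyadic :: "real \<Rightarrow> nat \<Rightarrow> nat \<Rightarrow> real" where
  "dyadic Z n j = Z * real j / 2 ^ n"

definition increment :: "real \<Rightarrow> (real \<Rightarrow> complex) \<Rightarrow> nat \<Rightarrow> nat \<Rightarrow> complex" where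
  "increment Z u n j = u (dyadic Z n (Suc j)) - u (dyadic Z n j)"

text \<open>A Besov-type seminorm: 2^n increments of size 2^(-n h) have energy 2^(-n (h - 1/2)), so
  a geometric decay in \<open>n\<close> expresses regularity above 1/2. The square sum is chosen
  over a Hoelder norm because its second moment is a sum of second moments of increments.\<close>

definition energy :: "real \<Rightarrow> (real \<Rightarrow> complex) \<Rightarrow> nat \<Rightarrow> real" where
  "energy Z u n = L2_set (\<lambda>j. norm (increment Z u n j)) {..<2 ^ n}"

definition local_energy :: "real \<Rightarrow> (real \<Rightarrow> complex) \<Rightarrow> nat \<Rightarrow> nat \<Rightarrow> nat \<Rightarrow> real" where
  "local_energy Z u m i k = L2_set (\<lambda>j. norm (increment Z u (m + k) j)) {i * 2 ^ k..<Suc i * 2 ^ k}"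

definition riemann_sum :: "real \<Rightarrow> (real \<Rightarrow> complex) \<Rightarrow> (real \<Rightarrow> complex) \<Rightarrow> nat \<Rightarrow> nat \<Rightarrow> nat \<Rightarrow> complex" where
  "riemann_sum Z u w m i k = (\<Sum>j=i * 2 ^ k..<Suc i * 2 ^ k. u (dyadic Z (m + k) j) * increment Z w (m + k) j)"

lemma dyadic_Suc_double: "dyadic Z (Suc n) (2 * j) = dyadic Z n j"
  by (simp add: dyadic_def)

lemma dyadic_mono: "0 \<le> Z \<Longrightarrow> i \<le> j \<Longrightarrow> dyadic Z n i \<le> dyadic Z n j"
  unfolding dyadic_def by (intro divide_right_mono mult_left_mono) auto

lemma dyadic_in:
  assumes "0 \<le> Z" "j \<le> 2 ^ n"
  shows "dyadic Z n j \<in> {0..Z}"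
  using dyadic_mono[OF assms(1), of 0 j n] dyadic_mono[OF assms, of n] by (simp add: dyadic_def)

lemma increment_split: "increment Z w n j = increment Z w (Suc n) (2 * j) + increment Z w (Suc n) (Suc (2 * j))"
  unfolding increment_def using dyadic_Suc_double[of Z n j] dyadic_Suc_double[of Z n "Suc j"] by simp

lemma sum_pairs:
  fixes f :: "nat \<Rightarrow> 'a :: comm_monoid_add"
  assumes "a \<le> b"
  shows "(\<Sum>j=2 * a..<2 * b. f j) = (\<Sum>j=a..<b. f (2 * j) + f (Suc (2 * j)))"
  using assms by (induction b rule: dec_induct) (auto simp: add.assoc)

text \<open>Halving the cells changes a left-endpoint sum only on the right halves, where
  \<open>u\<close> at the left end gives way to \<open>u\<close> at the midpoint. The correction on
  a cell is the increment of \<open>u\<close> over the left half times the increment of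
  \<open>w\<close> over the right half, and Cauchy-Schwarz pairs the two families.\<close>

lemma riemann_sum_step:
  "norm (riemann_sum Z u w m i (Suc k) - riemann_sum Z u w m i k) \<le> local_energy Z u m i (Suc k) * local_energy Z w m i (Suc k)"
proof -
  define a b where "a = i * 2 ^ k" "b = Suc i * 2 ^ k"
  have ab: "a \<le> b" "i * 2 ^ Suc k = 2 * a" "Suc i * 2 ^ Suc k = 2 * b" unfolding a_b_def by auto
  define n where "n = m + k"
  have n: "m + Suc k = Suc n" by (simp add: n_def)
  have "riemann_sum Z u w m i (Suc k) - riemann_sum Z u w m i k
     = (\<Sum>j=a..<b. u (dyadic Z (Suc n) (2 * j)) * increment Z w (Suc n) (2 * j)
        + u (dyadic Z (Suc n) (Suc (2 * j))) * increment Z w (Suc n) (Suc (2 * j)) - u (dyadic Z n j) * increment Z w n j)"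
    unfolding riemann_sum_def n ab(2,3) sum_pairs[OF ab(1)] by (simp add: sum_subtractf a_b_def n_def)
  also have "\<dots> = (\<Sum>j=a..<b. increment Z u (Suc n) (2 * j) * increment Z w (Suc n) (Suc (2 * j)))"
    unfolding increment_split[of Z w n] dyadic_Suc_double increment_def[of Z u] by (intro sum.cong) (auto simp: algebra_simps)
  also have "norm \<dots> \<le> (\<Sum>j=a..<b. \<bar>norm (increment Z u (Suc n) (2 * j))\<bar> * \<bar>norm (increment Z w (Suc n) (Suc (2 * j)))\<bar>)"
    by (rule order_trans[OF norm_sum]) (auto simp: norm_mult)
  also have "\<dots> \<le> L2_set (\<lambda>j. norm (increment Z u (Suc n) (2 * j))) {a..<b} * L2_set (\<lambda>j. norm (increment Z w (Suc n) (Suc (2 * j)))) {a..<b}"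
    by (rule L2_set_mult_ineq)
  also have "\<dots> \<le> local_energy Z u m i (Suc k) * local_energy Z w m i (Suc k)"
    unfolding local_energy_def n ab(2,3) L2_set_def sum_pairs[OF ab(1)]
    by (intro mult_mono real_sqrt_le_mono sum_mono) (auto intro: sum_nonneg)
  finally show ?thesis .
qed

text \<open>For a single path with integrable density the dyadic sums converge by dominated
  convergence, without any decay of energies. The energies serve only for bounds free of the L1 norm
  of \<open>g\<close>.\<close>

lemma riemann_sum_limit:
  assumes Z: "0 < Z" and u: "continuous_on {0..Z} u" and w: "primitive_on Z w g" and i: "i < 2 ^ m"
  shows "(\<lambda>k. riemann_sum Z u w m i k) \<longlonglongrightarrow> (LINT t:{dyadic Z m i..dyadic Z m (Suc i)}|lborel. u t * g t)"
proof -
  define a b where "a = dyadic Z m i" "b = dyadic Z m (Suc i)"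
  have ab: "a < b" "0 \<le> a" "b \<le> Z"
    using Z i dyadic_in[of Z i m] dyadic_in[of Z "Suc i" m] unfolding a_b_def
    by (auto simp: dyadic_def intro!: divide_strict_right_mono)
  have pt: "a + (b - a) * real j / real (2 ^ k) = dyadic Z (m + k) (i * 2 ^ k + j)" for j k
    unfolding a_b_def dyadic_def by (simp add: field_simps power_add)
  obtain B where B: "\<And>t. t \<in> {0..Z} \<Longrightarrow> norm (u t) \<le> B"
    using compact_continuous_image[OF u compact_Icc] by (meson bounded_iff compact_imp_bounded imageI)
  have ptin: "dyadic Z (m + k) (i * 2 ^ k + j) \<in> {0..Z}" if "j \<le> 2 ^ k" for j k
  proof (rule dyadic_in)
    have "i * 2 ^ k + j \<le> Suc i * 2 ^ k" using that by simp
    also have "\<dots> \<le> 2 ^ m * 2 ^ k" using i by (intro mult_right_mono) auto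
    finally show "i * 2 ^ k + j \<le> 2 ^ (m + k)" by (simp add: power_add)
  qed (use Z in auto)
  have gab: "set_integrable lborel {a..b} g"
    by (rule set_integrable_subset[OF primitive_on_integrable[OF w]]) (use ab in auto)
  have "(\<lambda>k. \<Sum>j<2 ^ k. u (dyadic Z (m + k) (i * 2 ^ k + j)) *
      (LINT t:{a + (b - a) * real j / real (2 ^ k)..a + (b - a) * real (Suc j) / real (2 ^ k)}|lborel. g t))
    \<longlonglongrightarrow> (LINT t:{a..b}|lborel. u t * g t)"
  proof (rule step_integral_limit[OF ab(1) gab, where B=B])
    show "norm (u (dyadic Z (m + k) (i * 2 ^ k + j))) \<le> B" if "j < 2 ^ k" for k j
      using that by (intro B ptin) auto
    show "set_integrable lborel {a..b} (\<lambda>t. u t * g t)"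
      by (rule set_integrable_continuous_mult[OF continuous_on_subset[OF u] gab]) (use ab in auto)
    fix t assume t: "a < t" "t < b"
    define j where "j k = nat \<lfloor>(t - a) / (b - a) * real (2 ^ k)\<rfloor>" for k :: nat
    define x where "x k = dyadic Z (m + k) (i * 2 ^ k + j k)" for k
    note gf = grid_floor[OF t, of "2 ^ k" for k, folded j_def, unfolded pt, folded x_def, simplified]
    have xd: "norm (x k - t) \<le> (b - a) * (1 / 2) ^ k" for k
    proof -
      have "dyadic Z (m + k) (i * 2 ^ k + Suc (j k)) = x k + (b - a) * (1 / 2) ^ k"
        unfolding x_def pt[symmetric] by (simp add: field_simps)
      thus ?thesis using gf(2,3)[of k] by simp
    qed
    have "(\<lambda>k. (b - a) * (1 / 2) ^ k) \<longlonglongrightarrow> 0"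
      by (intro tendsto_mult_right_zero LIMSEQ_power_zero) auto
    hence "(\<lambda>k. x k - t) \<longlonglongrightarrow> 0"
      by (rule Lim_null_comparison[OF always_eventually[OF allI[OF xd]]])
    hence "x \<longlonglongrightarrow> t" by (rule LIM_zero_cancel)
    moreover have "x k \<in> {0..Z}" for k unfolding x_def by (rule ptin) (use gf(1)[of k] in simp)
    ultimately show "(\<lambda>k. u (dyadic Z (m + k) (i * 2 ^ k + nat \<lfloor>(t - a) / (b - a) * real (2 ^ k)\<rfloor>))) \<longlonglongrightarrow> u t"
      using continuous_on_tendsto_compose[OF u, of x t sequentially] t ab
      unfolding x_def j_def by simp
  qed auto
  also have "(\<lambda>k. \<Sum>j<2 ^ k. u (dyadic Z (m + k) (i * 2 ^ k + j)) *
      (LINT t:{a + (b - a) * real j / real (2 ^ k)..a + (b - a) * real (Suc j) / real (2 ^ k)}|lborel. g t))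
    = (\<lambda>k. riemann_sum Z u w m i k)"
  proof
    fix k
    have "riemann_sum Z u w m i k = (\<Sum>j<2 ^ k. u (dyadic Z (m + k) (i * 2 ^ k + j)) * increment Z w (m + k) (i * 2 ^ k + j))"
      unfolding riemann_sum_def by (rule sum.reindex_bij_witness[of _ "\<lambda>j. i * 2 ^ k + j" "\<lambda>j. j - i * 2 ^ k"]) auto
    also have "\<dots> = (\<Sum>j<2 ^ k. u (dyadic Z (m + k) (i * 2 ^ k + j)) *
      (LINT t:{a + (b - a) * real j / real (2 ^ k)..a + (b - a) * real (Suc j) / real (2 ^ k)}|lborel. g t))"
    proof (rule sum.cong[OF refl])
      fix j :: nat assume "j \<in> {..<2 ^ k}"
      hence "increment Z w (m + k) (i * 2 ^ k + j) =
        (LINT t:{dyadic Z (m + k) (i * 2 ^ k + j)..dyadic Z (m + k) (i * 2 ^ k + Suc j)}|lborel. g t)"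
        unfolding increment_def using ptin[of j k] ptin[of "Suc j" k] Z
        by (subst primitive_on_diff[OF w, symmetric]) (auto intro!: dyadic_mono)
      thus "u (dyadic Z (m + k) (i * 2 ^ k + j)) * increment Z w (m + k) (i * 2 ^ k + j) = u (dyadic Z (m + k) (i * 2 ^ k + j)) *
      (LINT t:{a + (b - a) * real j / real (2 ^ k)..a + (b - a) * real (Suc j) / real (2 ^ k)}|lborel. g t)"
        unfolding pt by simp
    qed
    finally show "(\<Sum>j<2 ^ k. u (dyadic Z (m + k) (i * 2 ^ k + j)) *
      (LINT t:{a + (b - a) * real j / real (2 ^ k)..a + (b - a) * real (Suc j) / real (2 ^ k)}|lborel. g t)) = riemann_sum Z u w m i k" ..
  qed
  finally show ?thesis unfolding a_b_def .
qed

section \<open>Young's estimate along the dyadic levels\<close>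

lemma energy_nonneg: "0 \<le> energy Z u n"
  unfolding energy_def by (rule L2_set_nonneg)

lemma local_energy_nonneg: "0 \<le> local_energy Z u m i k"
  unfolding local_energy_def by (rule L2_set_nonneg)

lemma L2_set_local_energy: "L2_set (\<lambda>i. local_energy Z u m i k) {..<2 ^ m} = energy Z u (m + k)"
proof -
  have "(\<Sum>i<2 ^ m. (local_energy Z u m i k)\<^sup>2) = (\<Sum>i<2 ^ m. \<Sum>j=i * 2 ^ k..<i * 2 ^ k + 2 ^ k. (norm (increment Z u (m + k) j))\<^sup>2)"
    unfolding local_energy_def L2_set_def by (intro sum.cong) (auto simp: sum_nonneg add.commute)
  also have "\<dots> = (\<Sum>j<2 ^ m * 2 ^ k. (norm (increment Z u (m + k) j))\<^sup>2)"
    by (rule sum.nat_group)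
  finally show ?thesis unfolding L2_set_def energy_def by (simp add: power_add)
qed

lemma local_energy_le_energy:
  assumes "i < 2 ^ m"
  shows "local_energy Z u m i k \<le> energy Z u (m + k)"
  unfolding L2_set_local_energy[symmetric] using assms by (intro member_le_L2_set) auto

lemma L2_set_sum_triangle:
  assumes "\<And>l i. l < k \<Longrightarrow> i \<in> I \<Longrightarrow> 0 \<le> f l i"
  shows "L2_set (\<lambda>i. \<Sum>l<k. f l i) I \<le> (\<Sum>l<(k::nat). L2_set (f l) I)"
  using assms
proof (induction k)
  case 0 show ?case by (simp add: L2_set_def)
next
  case (Suc k)
  have "L2_set (\<lambda>i. (\<Sum>l<k. f l i) + f k i) I \<le> L2_set (\<lambda>i. \<Sum>l<k. f l i) I + L2_set (f k) I"
    by (rule L2_set_triangle_ineq)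
  thus ?case using Suc.IH Suc.prems by simp
qed

lemma geometric_partial_sum_le:
  fixes \<theta> :: real
  assumes "0 \<le> \<theta>" "\<theta> < 1"
  shows "(\<Sum>l<k. \<theta> ^ (m + Suc l)) \<le> \<theta> ^ m / (1 - \<theta>)"
proof -
  have "(\<Sum>l<k. \<theta> ^ (m + Suc l)) \<le> (\<Sum>l<k. \<theta> ^ m * \<theta> ^ l)"
    using assms by (intro sum_mono) (auto simp: power_add intro!: mult_left_mono mult_left_le_one_le)
  also have "\<dots> = \<theta> ^ m * ((1 - \<theta> ^ k) / (1 - \<theta>))"
    unfolding sum_distrib_left[symmetric] using assms by (simp add: sum_gp_strict)
  also have "\<dots> \<le> \<theta> ^ m / (1 - \<theta>)"
    using assms by (simp add: mult_left_le_one_le mult_le_cancel_left2 divide_simps)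
  finally show ?thesis .
qed

text \<open>The starting level \<open>p\<close> is kept free: \<open>energy_integral\<close> starts
  from the cell itself, with \<open>p = 0\<close>, whereas \<open>norm_integral_le\<close> starts
  from a fine level, so that only the tail of the series is paid for.\<close>

lemma riemann_sum_telescope:
  "norm (riemann_sum Z u w m i (p + k) - riemann_sum Z u w m i p)
     \<le> (\<Sum>l<k. local_energy Z u m i (p + Suc l) * local_energy Z w m i (p + Suc l))"
proof (induction k)
  case (Suc k)
  have "norm (riemann_sum Z u w m i (p + Suc k) - riemann_sum Z u w m i p)
    \<le> norm (riemann_sum Z u w m i (Suc (p + k)) - riemann_sum Z u w m i (p + k)) + norm (riemann_sum Z u w m i (p + k) - riemann_sum Z u w m i p)"
    using norm_triangle_ineq[of "riemann_sum Z u w m i (Suc (p + k)) - riemann_sum Z u w m i (p + k)" "riemann_sum Z u w m i (p + k) - riemann_sum Z u w m i p"]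
    by simp
  thus ?case using riemann_sum_step[of Z u w m i "p + k"] Suc.IH by simp
qed simp

text \<open>A driver of regularity above 1/2. The density \<open>g\<close> is present only to give
  integrals a meaning; the bounds below depend on the driver through \<open>K\<close>, \<theta> and,
  in one case, its increments at a fixed level.\<close>

locale young =
  fixes Z :: real and w g :: "real \<Rightarrow> complex" and K \<theta> :: real
  assumes Z: "0 < Z" and w: "primitive_on Z w g"
    and \<theta>: "0 < \<theta>" "\<theta> < 1" and energy_w: "\<And>n. energy Z w n \<le> K * \<theta> ^ n"
begin

lemma K_nonneg: "0 \<le> K"
  using energy_w[of 0] energy_nonneg[of Z w 0] by simp

text \<open>On each cell of level \<open>m\<close> the integral differs from its one-term Riemann
  sum by products of local energies at finer levels, and Minkowski's inequality sums this over the
  cells. Only the levels beyond \<open>m\<close> of the integrand enter, and the gain \<theta>^m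
  survives; both are needed to absorb a nonlinear equation.\<close>

lemma energy_integral:
  assumes u: "continuous_on {0..Z} u" and u1: "\<And>t. t \<in> {0..Z} \<Longrightarrow> norm (u t) \<le> 1"
    and energy_u: "\<And>n. n > m \<Longrightarrow> energy Z u n \<le> S" and v: "primitive_on Z v (\<lambda>t. u t * g t)"
  shows "energy Z v m \<le> K * \<theta> ^ m * (1 + S / (1 - \<theta>))"
proof -
  have S: "0 \<le> S" using energy_u[of "Suc m"] energy_nonneg[of Z u "Suc m"] by simp
  let ?I = "{..<(2::nat) ^ m}"
  have increment_v: "increment Z v m i = (LINT t:{dyadic Z m i..dyadic Z m (Suc i)}|lborel. u t * g t)" if "i \<in> ?I" for i
    unfolding increment_def using that Z dyadic_in[of Z i m] dyadic_in[of Z "Suc i" m]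
    by (intro primitive_on_diff[OF v]) (auto intro!: dyadic_mono)
  have riemann_sum0: "riemann_sum Z u w m i 0 = u (dyadic Z m i) * increment Z w m i" for i
    by (simp add: riemann_sum_def)
  have bd: "L2_set (\<lambda>i. norm (riemann_sum Z u w m i k - u (dyadic Z m i) * increment Z w m i)) ?I
      \<le> K * \<theta> ^ m * (S / (1 - \<theta>))" for k
  proof -
    have "L2_set (\<lambda>i. norm (riemann_sum Z u w m i k - u (dyadic Z m i) * increment Z w m i)) ?I
      \<le> L2_set (\<lambda>i. \<Sum>l<k. K * \<theta> ^ (m + Suc l) * local_energy Z u m i (Suc l)) ?I"
    proof (rule L2_set_mono)
      fix i assume i: "i \<in> ?I"
      have "norm (riemann_sum Z u w m i k - u (dyadic Z m i) * increment Z w m i)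
        \<le> (\<Sum>l<k. local_energy Z u m i (Suc l) * local_energy Z w m i (Suc l))"
        using riemann_sum_telescope[of Z u w m i 0 k] by (simp add: riemann_sum0)
      \<comment> \<open>The local energy of \<open>w\<close> is estimated by the global one, but
        that of \<open>u\<close> is kept local: its square sum over the cells is then exactly the
        energy of \<open>u\<close>.\<close>
      also have "\<dots> \<le> (\<Sum>l<k. local_energy Z u m i (Suc l) * (K * \<theta> ^ (m + Suc l)))"
        using i by (intro sum_mono mult_left_mono order_trans[OF local_energy_le_energy energy_w] local_energy_nonneg) auto
      finally show "norm (riemann_sum Z u w m i k - u (dyadic Z m i) * increment Z w m i)
        \<le> (\<Sum>l<k. K * \<theta> ^ (m + Suc l) * local_energy Z u m i (Suc l))"
        by (simp add: mult.commute)
    qed auto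
    also have "\<dots> \<le> (\<Sum>l<k. L2_set (\<lambda>i. K * \<theta> ^ (m + Suc l) * local_energy Z u m i (Suc l)) ?I)"
      using K_nonneg \<theta> local_energy_nonneg by (intro L2_set_sum_triangle) auto
    also have "\<dots> = (\<Sum>l<k. K * \<theta> ^ (m + Suc l) * energy Z u (m + Suc l))"
      using K_nonneg \<theta> by (intro sum.cong refl) (simp add: L2_set_right_distrib[symmetric] L2_set_local_energy)
    also have "\<dots> \<le> (\<Sum>l<k. K * \<theta> ^ (m + Suc l) * S)"
      using K_nonneg \<theta> by (intro sum_mono mult_left_mono energy_u) auto
    also have "\<dots> = K * S * (\<Sum>l<k. \<theta> ^ (m + Suc l))"
      by (simp add: sum_distrib_left sum_distrib_right mult_ac)
    also have "\<dots> \<le> K * S * (\<theta> ^ m / (1 - \<theta>))"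
      using K_nonneg S \<theta> by (intro mult_left_mono geometric_partial_sum_le) auto
    finally show ?thesis by (simp add: mult_ac)
  qed
  have "(\<lambda>k. L2_set (\<lambda>i. norm (riemann_sum Z u w m i k - u (dyadic Z m i) * increment Z w m i)) ?I)
      \<longlonglongrightarrow> L2_set (\<lambda>i. norm (increment Z v m i - u (dyadic Z m i) * increment Z w m i)) ?I"
    unfolding L2_set_def using riemann_sum_limit[OF Z u w] increment_v
    by (intro tendsto_real_sqrt tendsto_sum tendsto_power tendsto_norm tendsto_diff tendsto_const) auto
  from LIMSEQ_le_const2[OF this] bd
  have 1: "L2_set (\<lambda>i. norm (increment Z v m i - u (dyadic Z m i) * increment Z w m i)) ?I \<le> K * \<theta> ^ m * (S / (1 - \<theta>))"
    by blast
  have "energy Z v m \<le> L2_set (\<lambda>i. norm (increment Z v m i - u (dyadic Z m i) * increment Z w m i) + norm (increment Z w m i)) ?I"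
    unfolding energy_def
  proof (rule L2_set_mono)
    fix i assume i: "i \<in> ?I"
    have "norm (u (dyadic Z m i) * increment Z w m i) \<le> 1 * norm (increment Z w m i)"
      unfolding norm_mult using i Z by (intro mult_right_mono u1 dyadic_in) auto
    thus "norm (increment Z v m i) \<le> norm (increment Z v m i - u (dyadic Z m i) * increment Z w m i) + norm (increment Z w m i)"
      using norm_triangle_sub[of "increment Z v m i" "u (dyadic Z m i) * increment Z w m i"] by simp
  qed auto
  also have "\<dots> \<le> L2_set (\<lambda>i. norm (increment Z v m i - u (dyadic Z m i) * increment Z w m i)) ?I + energy Z w m"
    unfolding energy_def by (rule L2_set_triangle_ineq)
  finally show ?thesis using 1 energy_w[of m] by (simp add: distrib_left)
qed

text \<open>The integral is split at level \<open>p\<close>. The coarse sum contains finitely many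
  increments of \<open>w\<close>, which become small for fixed \<open>p\<close> when
  \<open>w\<close> oscillates fast; the remainder is small with \<open>p\<close>, uniformly over all
  drivers with the same \<open>K\<close> and \<theta>.\<close>

lemma norm_integral_le:
  assumes u: "continuous_on {0..Z} u" and u1: "\<And>t. t \<in> {0..Z} \<Longrightarrow> norm (u t) \<le> 1"
    and energy_u: "\<And>n. energy Z u n \<le> S"
  shows "norm (LINT t:{0..Z}|lborel. u t * g t) \<le> (\<Sum>i<2 ^ p. norm (increment Z w p i)) + K * \<theta> ^ p * (S / (1 - \<theta>))"
proof -
  have S: "0 \<le> S" using energy_u[of 0] energy_nonneg[of Z u 0] by simp
  have d: "dyadic Z 0 0 = 0" "dyadic Z 0 (Suc 0) = Z" by (auto simp: dyadic_def)
  have lim: "(\<lambda>k. riemann_sum Z u w 0 0 (p + k)) \<longlonglongrightarrow> (LINT t:{0..Z}|lborel. u t * g t)"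
    using LIMSEQ_ignore_initial_segment[OF riemann_sum_limit[OF Z u w, of 0 0], of p] by (simp add: d add.commute)
  have "norm (riemann_sum Z u w 0 0 (p + k)) \<le> (\<Sum>i<2 ^ p. norm (increment Z w p i)) + K * \<theta> ^ p * (S / (1 - \<theta>))" for k
  proof -
    have "norm (riemann_sum Z u w 0 0 (p + k) - riemann_sum Z u w 0 0 p)
       \<le> (\<Sum>l<k. local_energy Z u 0 0 (p + Suc l) * local_energy Z w 0 0 (p + Suc l))"
      by (rule riemann_sum_telescope)
    also have "\<dots> \<le> (\<Sum>l<k. S * (K * \<theta> ^ (p + Suc l)))"
    proof (intro sum_mono mult_mono)
      show "local_energy Z u 0 0 (p + Suc l) \<le> S" "local_energy Z w 0 0 (p + Suc l) \<le> K * \<theta> ^ (p + Suc l)" for l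
        using order_trans[OF local_energy_le_energy energy_u, of 0 0] order_trans[OF local_energy_le_energy energy_w, of 0 0]
        by (metis add_0 less_numeral_extra(1) power_0)+
    qed (use S local_energy_nonneg in auto)
    also have "\<dots> = K * S * (\<Sum>l<k. \<theta> ^ (p + Suc l))"
      by (simp add: sum_distrib_left mult_ac)
    also have "\<dots> \<le> K * S * (\<theta> ^ p / (1 - \<theta>))"
      using K_nonneg S \<theta> by (intro mult_left_mono geometric_partial_sum_le) auto
    finally have 1: "norm (riemann_sum Z u w 0 0 (p + k) - riemann_sum Z u w 0 0 p) \<le> K * \<theta> ^ p * (S / (1 - \<theta>))"
      by (simp add: mult_ac)
    have "norm (riemann_sum Z u w 0 0 p) \<le> (\<Sum>i<2 ^ p. norm (u (dyadic Z p i)) * norm (increment Z w p i))"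
      unfolding riemann_sum_def by (simp add: atLeast0LessThan norm_mult[symmetric] norm_sum)
    also have "\<dots> \<le> (\<Sum>i<2 ^ p. 1 * norm (increment Z w p i))"
      using Z by (intro sum_mono mult_right_mono u1 dyadic_in) auto
    finally show ?thesis using 1 norm_triangle_sub[of "riemann_sum Z u w 0 0 (p + k)" "riemann_sum Z u w 0 0 p"] by simp
  qed
  from LIMSEQ_le_const2[OF tendsto_norm[OF lim]] this show ?thesis by blast
qed

end

section \<open>Algebra of energies\<close>

lemma energy_mult:
  assumes "0 \<le> Z" "\<And>t. t \<in> {0..Z} \<Longrightarrow> norm (u t) \<le> 1" "\<And>t. t \<in> {0..Z} \<Longrightarrow> norm (v t) \<le> 1"
  shows "energy Z (\<lambda>t. u t * v t) n \<le> energy Z u n + energy Z v n"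
proof -
  have "energy Z (\<lambda>t. u t * v t) n \<le> L2_set (\<lambda>j. norm (increment Z u n j) + norm (increment Z v n j)) {..<2 ^ n}"
    unfolding energy_def
  proof (rule L2_set_mono)
    fix j :: nat assume j: "j \<in> {..<2 ^ n}"
    have eq: "increment Z (\<lambda>t. u t * v t) n j = increment Z u n j * v (dyadic Z n (Suc j)) + u (dyadic Z n j) * increment Z v n j"
      by (simp add: increment_def algebra_simps)
    have "norm (increment Z u n j * v (dyadic Z n (Suc j))) \<le> norm (increment Z u n j) * 1"
      unfolding norm_mult using j assms by (intro mult_left_mono assms(3) dyadic_in) auto
    moreover have "norm (u (dyadic Z n j) * increment Z v n j) \<le> 1 * norm (increment Z v n j)"
      unfolding norm_mult using j assms by (intro mult_right_mono assms(2) dyadic_in) auto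
    ultimately show "norm (increment Z (\<lambda>t. u t * v t) n j) \<le> norm (increment Z u n j) + norm (increment Z v n j)"
      unfolding eq by (intro norm_triangle_le) simp
  qed auto
  also have "\<dots> \<le> energy Z u n + energy Z v n" unfolding energy_def by (rule L2_set_triangle_ineq)
  finally show ?thesis .
qed

lemma energy_add: "energy Z (\<lambda>t. u t + v t) n \<le> energy Z u n + energy Z v n"
proof -
  have "energy Z (\<lambda>t. u t + v t) n \<le> L2_set (\<lambda>j. norm (increment Z u n j) + norm (increment Z v n j)) {..<2 ^ n}"
    unfolding energy_def
  proof (rule L2_set_mono)
    fix j
    have "increment Z (\<lambda>t. u t + v t) n j = increment Z u n j + increment Z v n j" by (simp add: increment_def)
    thus "norm (increment Z (\<lambda>t. u t + v t) n j) \<le> norm (increment Z u n j) + norm (increment Z v n j)"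
      by (simp add: norm_triangle_ineq)
  qed auto
  also have "\<dots> \<le> energy Z u n + energy Z v n" unfolding energy_def by (rule L2_set_triangle_ineq)
  finally show ?thesis .
qed

lemma energy_cmult: "energy Z (\<lambda>t. c * u t) n = norm c * energy Z u n"
proof -
  have "norm (increment Z (\<lambda>t. c * u t) n j) = norm c * norm (increment Z u n j)" for j
    by (simp add: increment_def norm_mult[symmetric] right_diff_distrib)
  thus ?thesis unfolding energy_def by (simp add: L2_set_right_distrib)
qed

lemma norm_increment_cnj: "norm (increment Z (\<lambda>t. cnj (u t)) n j) = norm (increment Z u n j)"
  unfolding increment_def complex_cnj_diff[symmetric] by (rule complex_mod_cnj)

lemma energy_cnj: "energy Z (\<lambda>t. cnj (u t)) n = energy Z u n"
  unfolding energy_def norm_increment_cnj ..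

text \<open>The right-hand side is not controlled uniformly in \<epsilon>. It serves only to show
  that the energies of one solution are bounded in \<open>n\<close>, without which nothing could be
  absorbed.\<close>

lemma energy_le_variation:
  assumes u: "primitive_on Z u g" and Z: "0 \<le> Z"
  shows "energy Z u n \<le> (LINT t:{0..Z}|lborel. norm (g t))"
proof -
  have i: "set_integrable lborel {0..z} (\<lambda>t. norm (g t))" if "z \<in> {0..Z}" for z
    using primitive_on_subset_integrable[OF u that] by (rule set_integrable_norm)
  have ii: "set_integrable lborel {x..y} (\<lambda>t. norm (g t))" if "0 \<le> x" "y \<le> Z" for x y
    by (rule set_integrable_subset[OF i[of Z]]) (use that Z in auto)
  have step: "norm (u y - u x) \<le> (LINT t:{0..y}|lborel. norm (g t)) - (LINT t:{0..x}|lborel. norm (g t))"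
    if "0 \<le> x" "x \<le> y" "y \<le> Z" for x y
  proof -
    have "norm (u y - u x) \<le> (LINT t:{x..y}|lborel. norm (g t))"
      unfolding primitive_on_diff[OF u that] set_lebesgue_integral_def
      by (rule order_trans[OF integral_norm_bound]) simp
    moreover have "(LINT t:{0..y}|lborel. norm (g t)) = (LINT t:{0..x}|lborel. norm (g t)) + (LINT t:{x..y}|lborel. norm (g t))"
    proof -
      have "{0..y} = {0..x} \<union> {x..y}" using that by auto
      moreover have "(LINT t:{0..x} \<union> {x..y}|lborel. norm (g t)) = (LINT t:{0..x}|lborel. norm (g t)) + (LINT t:{x..y}|lborel. norm (g t))"
        by (rule set_integral_Un_AE) (use that AE_lborel_singleton[of x] in \<open>auto intro!: i ii\<close>)
      ultimately show ?thesis by simp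
    qed
    ultimately show ?thesis by simp
  qed
  have "energy Z u n \<le> (\<Sum>j<2 ^ n. norm (increment Z u n j))"
    unfolding energy_def by (rule L2_set_le_sum) auto
  also have "\<dots> \<le> (\<Sum>j<2 ^ n. (LINT t:{0..dyadic Z n (Suc j)}|lborel. norm (g t)) - (LINT t:{0..dyadic Z n j}|lborel. norm (g t)))"
  proof (rule sum_mono)
    fix j :: nat assume "j \<in> {..<2 ^ n}"
    thus "norm (increment Z u n j) \<le> (LINT t:{0..dyadic Z n (Suc j)}|lborel. norm (g t)) - (LINT t:{0..dyadic Z n j}|lborel. norm (g t))"
      unfolding increment_def using dyadic_in[OF Z, of j n] dyadic_in[OF Z, of "Suc j" n] by (intro step dyadic_mono Z) auto
  qed
  also have "\<dots> = (LINT t:{0..dyadic Z n (2 ^ n)}|lborel. norm (g t)) - (LINT t:{0..dyadic Z n 0}|lborel. norm (g t))"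
    by (rule sum_lessThan_telescope)
  also have "\<dots> \<le> (LINT t:{0..Z}|lborel. norm (g t))"
    by (simp add: dyadic_def set_lebesgue_integral_def)
  finally show ?thesis .
qed

text \<open>The map s -> a + s / 2 contracts to its fixed point 2 a. Iterated from the finite bound
  \<open>B\<close> it gives a bound in which \<open>B\<close> no longer appears. The improvement is
  required for all levels from \<open>m\<close> on at once, because Young's estimate at one level
  involves all finer ones.\<close>

lemma absorb_half:
  fixes e :: "nat \<Rightarrow> real"
  assumes B: "\<And>n. e n \<le> B" and a: "0 \<le> a"
    and step: "\<And>s. 0 \<le> s \<Longrightarrow> (\<And>n. n \<ge> m \<Longrightarrow> e n \<le> s) \<Longrightarrow> (\<And>n. n \<ge> m \<Longrightarrow> e n \<le> a + s / 2)"
    and n: "n \<ge> m"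
  shows "e n \<le> 2 * a"
proof -
  define b where "b = max B 0"
  have "\<forall>n\<ge>m. e n \<le> 2 * a + b * (1 / 2) ^ j" for j
  proof (induction j)
    case 0
    show ?case using B a by (auto simp: b_def le_max_iff_disj intro: order_trans[OF B])
  next
    case (Suc j)
    have "0 \<le> 2 * a + b * (1 / 2) ^ j" using a by (simp add: b_def)
    from step[OF this] Suc show ?case by (auto simp: add_divide_distrib)
  qed
  hence "e n \<le> 2 * a + b * (1 / 2) ^ j" for j using n by blast
  moreover have "(\<lambda>j. 2 * a + b * (1 / 2) ^ j) \<longlonglongrightarrow> 2 * a + b * 0"
    by (intro tendsto_intros LIMSEQ_power_zero) auto
  ultimately show ?thesis using LIMSEQ_le_const by force
qed

lemma energy_eq_density:
  assumes "primitive_on Z u f" "primitive_on Z v f" "0 \<le> Z"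
  shows "energy Z u n = energy Z v n"
proof -
  have "increment Z u n j = increment Z v n j" if "j < 2 ^ n" for j
  proof -
    have x: "0 \<le> dyadic Z n j" "dyadic Z n j \<le> dyadic Z n (Suc j)" "dyadic Z n (Suc j) \<le> Z"
      using dyadic_in[OF assms(3), of j n] dyadic_in[OF assms(3), of "Suc j" n] that dyadic_mono[OF assms(3), of j "Suc j" n] by auto
    show ?thesis unfolding increment_def primitive_on_diff[OF assms(1) x] primitive_on_diff[OF assms(2) x] ..
  qed
  thus ?thesis unfolding energy_def by (intro L2_set_cong) auto
qed

lemma energy_crude:
  assumes "0 \<le> Z" "\<And>t. t \<in> {0..Z} \<Longrightarrow> norm (u t) \<le> 1"
  shows "energy Z u n \<le> 2 * 2 ^ n"
proof -
  have "energy Z u n \<le> (\<Sum>j<2 ^ n. norm (increment Z u n j))"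
    unfolding energy_def by (rule L2_set_le_sum) auto
  also have "\<dots> \<le> (\<Sum>j<(2::nat) ^ n. 2)"
  proof (rule sum_mono)
    fix j :: nat assume "j \<in> {..<2 ^ n}"
    hence "norm (u (dyadic Z n (Suc j))) \<le> 1" "norm (u (dyadic Z n j)) \<le> 1"
      by (auto intro!: assms(2) dyadic_in assms(1) simp del: atLeastAtMost_iff)
    thus "norm (increment Z u n j) \<le> 2" unfolding increment_def
      using norm_triangle_ineq4[of "u (dyadic Z n (Suc j))" "u (dyadic Z n j)"] by linarith
  qed
  finally show ?thesis by simp
qed

text \<open>
  Here \<open>r\<close> is the reflection coefficient and \<open>q\<close> the transmission coefficient, both freed of the
  phase of the averaged equation; \<open>w'\<close> is the density of the oscillating driver.
\<close>
definition riccati_pair ::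
  "real \<Rightarrow> complex \<Rightarrow> (real \<Rightarrow> complex) \<Rightarrow> (real \<Rightarrow> complex) \<Rightarrow> (real \<Rightarrow> complex) \<Rightarrow> (real \<Rightarrow> complex) \<Rightarrow> bool"
where
  "riccati_pair Z c g w' r q \<longleftrightarrow>
     (\<forall>t\<in>{0..Z}. norm (r t) \<le> 1 \<and> norm (q t) \<le> 1) \<and>
     primitive_on Z r (\<lambda>t. c * (g t * w' t) + c * (cnj (g t) * (r t * r t) * cnj (w' t))) \<and>
     primitive_on Z q (\<lambda>t. c * (cnj (g t) * (r t * q t) * cnj (w' t)))"

text \<open>Young's estimate for the three integrals in the system. The integrands g, conj g r^2 and
  conj g r q are products of factors bounded by 1, so by \<open>energy_mult\<close> their energies
  are at most L, L + 2 s and L + s. The bound is thus affine in \<open>s\<close>, and both constants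
  3 are counts over these terms.\<close>

lemma riccati_step:
  assumes y: "young Z w w' K \<theta>"
    and g: "continuous_on {0..Z} g" "\<And>t. t \<in> {0..Z} \<Longrightarrow> norm (g t) \<le> 1" "\<And>n. energy Z g n \<le> L"
    and rq: "riccati_pair Z c g w' r q" and c: "norm c \<le> C"
    and s: "\<And>n. n \<ge> m0 \<Longrightarrow> energy Z r n + energy Z q n \<le> s" and m: "m \<ge> m0"
  shows "energy Z r m + energy Z q m \<le> 3 * C * K * \<theta> ^ m * (1 + L / (1 - \<theta>)) + 3 * C * K * \<theta> ^ m / (1 - \<theta>) * s"
proof -
  interpret young Z w w' K \<theta> by fact
  \<comment> \<open>The quadratic terms are driven by the conjugate path, whose energies are the
    same.\<close>
  interpret cy: young Z "\<lambda>t. cnj (w t)" "\<lambda>t. cnj (w' t)" K \<theta>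
    by unfold_locales (use Z w \<theta> energy_w in \<open>auto intro: primitive_on_cnj simp: energy_cnj\<close>)
  have Z0: "0 \<le> Z" using Z by simp
  have r1: "\<And>t. t \<in> {0..Z} \<Longrightarrow> norm (r t) \<le> 1" and q1: "\<And>t. t \<in> {0..Z} \<Longrightarrow> norm (q t) \<le> 1"
    and pr: "primitive_on Z r (\<lambda>t. c * (g t * w' t) + c * (cnj (g t) * (r t * r t) * cnj (w' t)))"
    and pq: "primitive_on Z q (\<lambda>t. c * (cnj (g t) * (r t * q t) * cnj (w' t)))"
    using rq unfolding riccati_pair_def by auto
  have cg: "continuous_on {0..Z} (\<lambda>t. cnj (g t))" by (intro continuous_intros g)
  note cr = primitive_on_continuous[OF pr] and cq = primitive_on_continuous[OF pq]
  have L: "0 \<le> L" using g(3)[of 0] energy_nonneg[of Z g 0] by simp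
  have b2: "norm (x * y) \<le> 1" if "norm x \<le> 1" "norm y \<le> 1" for x y :: complex
    using that by (simp add: norm_mult mult_le_one)
  have gcn: "norm (cnj (g t)) \<le> 1" if "t \<in> {0..Z}" for t using g(2)[OF that] by simp
  have e1: "energy Z (\<lambda>t. cnj (g t) * (r t * r t)) n \<le> L + 2 * s" if "n > m" for n
  proof -
    have "energy Z (\<lambda>t. cnj (g t) * (r t * r t)) n \<le> energy Z (\<lambda>t. cnj (g t)) n + energy Z (\<lambda>t. r t * r t) n"
      by (rule energy_mult[OF Z0 gcn b2]) (use r1 in auto)
    also have "energy Z (\<lambda>t. r t * r t) n \<le> energy Z r n + energy Z r n" by (rule energy_mult[OF Z0 r1 r1])
    finally show ?thesis using g(3)[of n] s[of n] that m energy_nonneg[of Z q n] by (simp add: energy_cnj)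
  qed
  have e2: "energy Z (\<lambda>t. cnj (g t) * (r t * q t)) n \<le> L + s" if "n > m" for n
  proof -
    have "energy Z (\<lambda>t. cnj (g t) * (r t * q t)) n \<le> energy Z (\<lambda>t. cnj (g t)) n + energy Z (\<lambda>t. r t * q t) n"
      by (rule energy_mult[OF Z0 gcn b2]) (use r1 q1 in auto)
    also have "energy Z (\<lambda>t. r t * q t) n \<le> energy Z r n + energy Z q n" by (rule energy_mult[OF Z0 r1 q1])
    finally show ?thesis using g(3)[of n] s[of n] that m by (simp add: energy_cnj)
  qed
  define v1 where "v1 z = (LINT t:{0..z}|lborel. g t * w' t)" for z
  define v2 where "v2 z = (LINT t:{0..z}|lborel. cnj (g t) * (r t * r t) * cnj (w' t))" for z
  define v3 where "v3 z = (LINT t:{0..z}|lborel. cnj (g t) * (r t * q t) * cnj (w' t))" for z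
  have p1: "primitive_on Z v1 (\<lambda>t. g t * w' t)" unfolding v1_def
    by (intro primitive_on_integral set_integrable_continuous_mult g primitive_on_integrable[OF w])
  have p2: "primitive_on Z v2 (\<lambda>t. cnj (g t) * (r t * r t) * cnj (w' t))" unfolding v2_def
    by (intro primitive_on_integral set_integrable_continuous_mult continuous_on_mult cg cr primitive_on_integrable[OF cy.w])
  have p3: "primitive_on Z v3 (\<lambda>t. cnj (g t) * (r t * q t) * cnj (w' t))" unfolding v3_def
    by (intro primitive_on_integral set_integrable_continuous_mult continuous_on_mult cg cr cq primitive_on_integrable[OF cy.w])
  have n1: "energy Z v1 m \<le> K * \<theta> ^ m * (1 + L / (1 - \<theta>))"
    by (rule energy_integral[OF g(1,2) g(3) p1])
  have n2: "energy Z v2 m \<le> K * \<theta> ^ m * (1 + (L + 2 * s) / (1 - \<theta>))"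
    by (rule cy.energy_integral[OF _ _ e1 p2]) (auto intro!: b2 gcn r1 continuous_on_mult cg cr)
  have n3: "energy Z v3 m \<le> K * \<theta> ^ m * (1 + (L + s) / (1 - \<theta>))"
    by (rule cy.energy_integral[OF _ _ e2 p3]) (auto intro!: b2 gcn r1 q1 continuous_on_mult cg cr cq)
  have "energy Z r m = energy Z (\<lambda>z. c * v1 z + c * v2 z) m"
    by (rule energy_eq_density[OF pr _ Z0]) (intro primitive_on_add primitive_on_cmult p1 p2)
  also have "\<dots> \<le> norm c * energy Z v1 m + norm c * energy Z v2 m"
    by (rule order_trans[OF energy_add]) (simp add: energy_cmult)
  finally have er: "energy Z r m \<le> norm c * energy Z v1 m + norm c * energy Z v2 m" .
  have "energy Z q m = energy Z (\<lambda>z. c * v3 z) m"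
    by (rule energy_eq_density[OF pq _ Z0]) (intro primitive_on_cmult p3)
  hence eq: "energy Z q m = norm c * energy Z v3 m" by (simp add: energy_cmult)
  have "energy Z r m + energy Z q m \<le> norm c * (energy Z v1 m + energy Z v2 m + energy Z v3 m)"
    using er eq by (simp add: distrib_left)
  also have "\<dots> \<le> C * (K * \<theta> ^ m * (1 + L / (1 - \<theta>)) + K * \<theta> ^ m * (1 + (L + 2 * s) / (1 - \<theta>))
      + K * \<theta> ^ m * (1 + (L + s) / (1 - \<theta>)))"
    using order_trans[OF norm_ge_zero c] by (intro mult_mono add_mono n1 n2 n3 c add_nonneg_nonneg energy_nonneg)
  also have "\<dots> = 3 * C * K * \<theta> ^ m * (1 + L / (1 - \<theta>)) + 3 * C * K * \<theta> ^ m / (1 - \<theta>) * s"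
  proof -
    define D where "D = 1 / (1 - \<theta>)"
    have "x / (1 - \<theta>) = x * D" for x by (simp add: D_def)
    thus ?thesis by (simp add: algebra_simps)
  qed
  finally show ?thesis .
qed

text \<open>
  From a sufficiently fine level on, the energies of \<open>r\<close> and \<open>q\<close> are bounded by a constant plus half
  of themselves; being finite, they can be absorbed. The coarser levels are bounded trivially.
\<close>
lemma riccati_bound:
  fixes Z K \<theta> L C :: real
  assumes K: "0 \<le> K" and \<theta>: "0 < \<theta>" "\<theta> < 1" and L: "0 \<le> L" and C: "0 \<le> C"
  shows "\<exists>S\<ge>0. \<forall>w w' g r q c. young Z w w' K \<theta> \<longrightarrow> continuous_on {0..Z} g \<longrightarrow>
     (\<forall>t\<in>{0..Z}. norm (g t) \<le> 1) \<longrightarrow> (\<forall>n. energy Z g n \<le> L) \<longrightarrow> riccati_pair Z c g w' r q \<longrightarrow> norm c \<le> C \<longrightarrow>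
     (\<forall>n. energy Z r n \<le> S \<and> energy Z q n \<le> S)"
proof -
  \<comment> \<open>The factor of \<open>s\<close> in \<open>riccati_step\<close> decays with the
    level. The level \<open>m0\<close> beyond which it is below 1/2 depends on \<open>C\<close>,
    \<open>K\<close> and \<theta> only, hence the final constant \<open>S\<close> is the same for
    all drivers.\<close>
  have "(\<lambda>m. 3 * C * K * \<theta> ^ m / (1 - \<theta>)) \<longlonglongrightarrow> 3 * C * K * 0 / (1 - \<theta>)"
    using \<theta> by (intro tendsto_intros LIMSEQ_power_zero) auto
  hence "eventually (\<lambda>m. 3 * C * K * \<theta> ^ m / (1 - \<theta>) < 1 / 2) sequentially"
    by (rule order_tendstoD) auto
  then obtain m0 where m0: "\<And>m. m \<ge> m0 \<Longrightarrow> 3 * C * K * \<theta> ^ m / (1 - \<theta>) < 1 / 2"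
    unfolding eventually_sequentially by blast
  define a where "a = 3 * C * K * (1 + L / (1 - \<theta>))"
  have a: "0 \<le> a" unfolding a_def using K L C \<theta> by simp
  define S where "S = 2 * a + 2 * 2 ^ m0"
  show ?thesis
  proof (intro exI conjI allI impI)
    show "0 \<le> S" unfolding S_def using a by simp
  next
    fix w w' g r q c n
    assume y: "young Z w w' K \<theta>" and g: "continuous_on {0..Z} g" "\<forall>t\<in>{0..Z}. norm (g t) \<le> 1" "\<forall>n. energy Z g n \<le> L"
      and rq: "riccati_pair Z c g w' r q" and c: "norm c \<le> C"
    interpret young Z w w' K \<theta> by fact
    have Z0: "0 \<le> Z" using Z by simp
    have r1: "\<And>t. t \<in> {0..Z} \<Longrightarrow> norm (r t) \<le> 1" and q1: "\<And>t. t \<in> {0..Z} \<Longrightarrow> norm (q t) \<le> 1"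
      using rq unfolding riccati_pair_def by auto
    obtain fr fq where pr: "primitive_on Z r fr" and pq: "primitive_on Z q fq"
      using rq unfolding riccati_pair_def by blast
    have big: "energy Z r n + energy Z q n \<le> 2 * a" if "n \<ge> m0" for n
    proof (rule absorb_half[OF _ a _ that])
      show "energy Z r n + energy Z q n \<le> (LINT t:{0..Z}|lborel. norm (fr t)) + (LINT t:{0..Z}|lborel. norm (fq t))" for n
        by (intro add_mono energy_le_variation pr pq Z0)
      fix s n assume s: "0 \<le> s" "\<And>n. n \<ge> m0 \<Longrightarrow> energy Z r n + energy Z q n \<le> s" and n: "n \<ge> m0"
      have "energy Z r n + energy Z q n \<le> 3 * C * K * \<theta> ^ n * (1 + L / (1 - \<theta>)) + 3 * C * K * \<theta> ^ n / (1 - \<theta>) * s"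
        using g by (intro riccati_step[OF y g(1) _ _ rq c s(2) n]) auto
      also have "\<dots> \<le> a + 1 / 2 * s"
      proof (intro add_mono mult_right_mono s(1))
        have "3 * C * K * (1 + L / (1 - \<theta>)) * \<theta> ^ n \<le> 3 * C * K * (1 + L / (1 - \<theta>)) * 1"
          using K C L \<theta> by (intro mult_left_mono power_le_one) auto
        moreover have "3 * C * K * \<theta> ^ n * (1 + L / (1 - \<theta>)) = 3 * C * K * (1 + L / (1 - \<theta>)) * \<theta> ^ n"
          by (simp only: mult_ac)
        ultimately show "3 * C * K * \<theta> ^ n * (1 + L / (1 - \<theta>)) \<le> a" unfolding a_def by linarith
        show "3 * C * K * \<theta> ^ n / (1 - \<theta>) \<le> 1 / 2" using m0[OF n] by simp
      qed
      finally show "energy Z r n + energy Z q n \<le> a + s / 2" by simp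
    qed
    have small: "energy Z u n \<le> 2 * 2 ^ m0" if "n < m0" "\<forall>t\<in>{0..Z}. norm (u t) \<le> 1" for u
    proof -
      have "(2::real) ^ n \<le> 2 ^ m0" using that by (intro power_increasing) auto
      moreover have "energy Z u n \<le> 2 * 2 ^ n" using that(2) by (intro energy_crude[OF Z0]) blast
      ultimately show ?thesis by linarith
    qed
    have "energy Z r n \<le> 2 * 2 ^ m0" "energy Z q n \<le> 2 * 2 ^ m0" if "n < m0"
      using r1 q1 by (auto intro!: small that)
    moreover have "energy Z r n \<le> 2 * a" "energy Z q n \<le> 2 * a" if "n \<ge> m0"
      using big[OF that] energy_nonneg[of Z r n] energy_nonneg[of Z q n] by linarith+
    moreover have "2 * 2 ^ m0 \<le> S" "2 * a \<le> S" unfolding S_def using a by simp_all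
    ultimately show "energy Z r n \<le> S" "energy Z q n \<le> S"
      by (meson le_cases less_le_not_le linorder_not_less order_trans)+
  qed
qed

text \<open>The previous bound on the energies turns the integral for \<open>q\<close> into one with
  an integrand of controlled energy. The constant \<open>D\<close> precedes the driver, the phase
  factor and the level in the quantifiers; the increments at level \<open>p\<close> stay explicit
  because they are what vanishes in the limit.\<close>

lemma riccati_transmission_bound:
  fixes Z K \<theta> L C :: real
  assumes K: "0 \<le> K" and \<theta>: "0 < \<theta>" "\<theta> < 1" and L: "0 \<le> L" and C: "0 \<le> C"
  shows "\<exists>D\<ge>0. \<forall>w w' g r q c p. young Z w w' K \<theta> \<longrightarrow> continuous_on {0..Z} g \<longrightarrow>
     (\<forall>t\<in>{0..Z}. norm (g t) \<le> 1) \<longrightarrow> (\<forall>n. energy Z g n \<le> L) \<longrightarrow> riccati_pair Z c g w' r q \<longrightarrow> norm c \<le> C \<longrightarrow>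
     norm (q Z - q 0) \<le> C * ((\<Sum>i<2 ^ p. norm (increment Z w p i)) + D * \<theta> ^ p)"
proof -
  obtain S where S: "0 \<le> S" and bd: "\<And>w w' g r q c n. young Z w w' K \<theta> \<Longrightarrow> continuous_on {0..Z} g \<Longrightarrow>
     (\<forall>t\<in>{0..Z}. norm (g t) \<le> 1) \<Longrightarrow> (\<forall>n. energy Z g n \<le> L) \<Longrightarrow> riccati_pair Z c g w' r q \<Longrightarrow> norm c \<le> C \<Longrightarrow>
     energy Z r n \<le> S \<and> energy Z q n \<le> S"
    using riccati_bound[OF assms, of Z] by meson
  define D where "D = K * ((L + 2 * S) / (1 - \<theta>))"
  show ?thesis
  proof (intro exI conjI allI impI)
    show "0 \<le> D" unfolding D_def using K L S \<theta> by simp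
  next
    fix w w' g r q c p
    assume y: "young Z w w' K \<theta>" and g: "continuous_on {0..Z} g" "\<forall>t\<in>{0..Z}. norm (g t) \<le> 1" "\<forall>n. energy Z g n \<le> L"
      and rq: "riccati_pair Z c g w' r q" and c: "norm c \<le> C"
    note bd = bd[OF y g rq c]
    interpret young Z w w' K \<theta> by fact
    interpret cy: young Z "\<lambda>t. cnj (w t)" "\<lambda>t. cnj (w' t)" K \<theta>
      by unfold_locales (use Z w \<theta> energy_w in \<open>auto intro: primitive_on_cnj simp: energy_cnj\<close>)
    have Z0: "0 \<le> Z" using Z by simp
    have r1: "\<And>t. t \<in> {0..Z} \<Longrightarrow> norm (r t) \<le> 1" and q1: "\<And>t. t \<in> {0..Z} \<Longrightarrow> norm (q t) \<le> 1"
      and pr: "primitive_on Z r (\<lambda>t. c * (g t * w' t) + c * (cnj (g t) * (r t * r t) * cnj (w' t)))"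
      and pq: "primitive_on Z q (\<lambda>t. c * (cnj (g t) * (r t * q t) * cnj (w' t)))"
      using rq unfolding riccati_pair_def by auto
    have b2: "norm (x * y) \<le> 1" if "norm x \<le> 1" "norm y \<le> 1" for x y :: complex
      using that by (simp add: norm_mult mult_le_one)
    have gcn: "norm (cnj (g t)) \<le> 1" if "t \<in> {0..Z}" for t using g(2) that by simp
    have e: "energy Z (\<lambda>t. cnj (g t) * (r t * q t)) n \<le> L + 2 * S" for n
    proof -
      have "energy Z (\<lambda>t. cnj (g t) * (r t * q t)) n \<le> energy Z (\<lambda>t. cnj (g t)) n + energy Z (\<lambda>t. r t * q t) n"
        by (rule energy_mult[OF Z0 gcn b2]) (use r1 q1 in auto)
      also have "energy Z (\<lambda>t. r t * q t) n \<le> energy Z r n + energy Z q n" by (rule energy_mult[OF Z0 r1 q1])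
      finally show ?thesis using g(3)[rule_format, of n] bd[of n] by (simp add: energy_cnj)
    qed
    have "q Z - q 0 = c * (LINT t:{0..Z}|lborel. cnj (g t) * (r t * q t) * cnj (w' t))"
      using primitive_on_diff[OF pq _ Z0 order_refl] by simp
    also have "norm \<dots> \<le> C * norm (LINT t:{0..Z}|lborel. cnj (g t) * (r t * q t) * cnj (w' t))"
      unfolding norm_mult using c by (intro mult_right_mono) auto
    also have "\<dots> \<le> C * ((\<Sum>i<2 ^ p. norm (increment Z (\<lambda>t. cnj (w t)) p i)) + K * \<theta> ^ p * ((L + 2 * S) / (1 - \<theta>)))"
      by (intro mult_left_mono C cy.norm_integral_le continuous_on_mult continuous_on_cnj g(1) e b2 gcn r1 q1
         primitive_on_continuous[OF pr] primitive_on_continuous[OF pq])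
    finally show "norm (q Z - q 0) \<le> C * ((\<Sum>i<2 ^ p. norm (increment Z w p i)) + D * \<theta> ^ p)"
      by (simp add: norm_increment_cnj D_def mult_ac)
  qed
qed

section \<open>Scattering by an integrable coupling\<close>

lemma set_integrable_of_real_iff:
  "set_integrable M A (\<lambda>t. complex_of_real (f t)) \<longleftrightarrow> set_integrable M A f"
proof -
  have "indicator A t *\<^sub>R complex_of_real (f t) = complex_of_real (indicator A t *\<^sub>R f t)" for t
    by (simp add: scaleR_conv_of_real)
  thus ?thesis unfolding set_integrable_def by (simp only: complex_of_real_integrable_eq)
qed

lemma primitive_on_power:
  assumes "primitive_on Z u f"
  shows "primitive_on Z (\<lambda>z. u z ^ n) (\<lambda>t. of_nat n * u t ^ (n - 1) * f t)"
proof (induction n)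
  case 0
  show ?case by (rule primitive_onI[where c=1]) (simp_all add: set_integrable_def)
next
  case (Suc n)
  have "(\<lambda>t. f t * u t ^ n + u t * (of_nat n * u t ^ (n - 1) * f t)) = (\<lambda>t. of_nat (Suc n) * u t ^ (Suc n - 1) * f t)"
    by (cases n) (auto simp: fun_eq_iff algebra_simps)
  with primitive_on_mult[OF assms Suc] show ?case by simp
qed

text \<open>Dominated convergence within the integral equation; it allows the series of iterated
  integrals to be integrated term by term.\<close>

lemma primitive_on_limit:
  assumes p: "\<And>N. primitive_on Z (u N) (f N)"
    and F: "set_integrable lborel {0..Z} F"
    and bd: "\<And>N t. t \<in> {0..Z} \<Longrightarrow> norm (f N t) \<le> F t"
    and u: "\<And>z. z \<in> {0..Z} \<Longrightarrow> (\<lambda>N. u N z) \<longlonglongrightarrow> v z"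
    and f: "\<And>z. z \<in> {0..Z} \<Longrightarrow> (\<lambda>N. f N z) \<longlonglongrightarrow> g z"
  shows "primitive_on Z v g"
proof (cases "0 \<le> Z")
  case True
  have m: "(\<lambda>t. indicator {0..Z} t *\<^sub>R f N t) \<in> borel_measurable lborel" for N
    using primitive_on_integrable[OF p[of N]] unfolding set_integrable_def by (rule borel_measurable_integrable)
  have lim: "(\<lambda>N. indicator A t *\<^sub>R f N t) \<longlonglongrightarrow> indicator A t *\<^sub>R g t" if "A \<subseteq> {0..Z}" for A t
    using that f[of t] by (cases "t \<in> A") (auto intro: tendsto_scaleR)
  have mg: "(\<lambda>t. indicator {0..Z} t *\<^sub>R g t) \<in> borel_measurable lborel"
    by (rule borel_measurable_LIMSEQ_metric[OF m lim]) simp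
  have sub: "(\<lambda>t. indicator {0..z} t *\<^sub>R x t) \<in> borel_measurable lborel"
    if "(\<lambda>t. indicator {0..Z} t *\<^sub>R x t) \<in> borel_measurable lborel" "z \<in> {0..Z}" for x :: "real \<Rightarrow> complex" and z
  proof -
    have "(\<lambda>t. indicator {0..z} t *\<^sub>R (indicator {0..Z} t *\<^sub>R x t)) \<in> borel_measurable lborel"
      using that(1) by measurable
    also have "(\<lambda>t. indicator {0..z} t *\<^sub>R (indicator {0..Z} t *\<^sub>R x t)) = (\<lambda>t. indicator {0..z} t *\<^sub>R x t)"
      using that(2) by (auto simp: fun_eq_iff indicator_def)
    finally show ?thesis .
  qed
  have Fi: "integrable lborel (\<lambda>t. indicator {0..z} t *\<^sub>R F t)" if "z \<in> {0..Z}" for z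
    using set_integrable_subset[OF F, of "{0..z}"] that unfolding set_integrable_def by auto
  have dom: "norm (indicator {0..z} t *\<^sub>R f N t) \<le> indicator {0..z} t *\<^sub>R F t" if "z \<in> {0..Z}" for z N t
    using bd[of t N] that by (auto simp: indicator_def)
  have conv: "(\<lambda>N. LINT t:{0..z}|lborel. f N t) \<longlonglongrightarrow> (LINT t:{0..z}|lborel. g t)"
    and ig: "set_integrable lborel {0..z} g" if z: "z \<in> {0..Z}" for z
  proof -
    have l: "AE t in lborel. (\<lambda>N. indicator {0..z} t *\<^sub>R f N t) \<longlonglongrightarrow> indicator {0..z} t *\<^sub>R g t"
      using lim[of "{0..z}"] z by (intro AE_I2) auto
    have d: "\<And>N. AE t in lborel. norm (indicator {0..z} t *\<^sub>R f N t) \<le> indicator {0..z} t *\<^sub>R F t"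
      using dom[OF z] by (intro AE_I2) auto
    show "(\<lambda>N. LINT t:{0..z}|lborel. f N t) \<longlonglongrightarrow> (LINT t:{0..z}|lborel. g t)"
      unfolding set_lebesgue_integral_def
      by (rule integral_dominated_convergence[OF sub[OF mg z] sub[OF m z] Fi[OF z] l d])
    show "set_integrable lborel {0..z} g" unfolding set_integrable_def
      by (rule integrable_dominated_convergence[OF sub[OF mg z] sub[OF m z] Fi[OF z] l d])
  qed
  show ?thesis
  proof (rule primitive_onI[where c="v 0"])
    show "set_integrable lborel {0..Z} g" using ig[of Z] True by simp
    fix z assume z: "z \<in> {0..Z}"
    have "(\<lambda>N. u N 0 + (LINT t:{0..z}|lborel. f N t)) \<longlonglongrightarrow> v 0 + (LINT t:{0..z}|lborel. g t)"
      using True by (intro tendsto_add u conv z) auto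
    moreover have "(\<lambda>N. u N 0 + (LINT t:{0..z}|lborel. f N t)) = (\<lambda>N. u N z)"
      using primitive_on_eq[OF p z] by metis
    ultimately show "v z = v 0 + (LINT t:{0..z}|lborel. g t)" using LIMSEQ_unique[OF u[OF z]] by simp
  qed
qed (auto simp: primitive_on_def set_integrable_def)

lemma primitive_on_zero_density:
  assumes "primitive_on Z u f" "\<And>t. t \<in> {0..Z} \<Longrightarrow> f t = 0" "z \<in> {0..Z}"
  shows "u z = u 0"
proof -
  have "(LINT t:{0..z}|lborel. f t) = (LINT t:{0..z}|lborel. 0)"
    unfolding set_lebesgue_integral_def
    by (intro Bochner_Integration.integral_cong) (use assms in \<open>auto simp: indicator_def\<close>)
  thus ?thesis using primitive_on_eq[OF assms(1,3)] by simp
qed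

text \<open>
  Iterated integrals of the Zakharov-Shabat system \<open>a' = cnj h * b\<close>, \<open>b' = h * a\<close>: the even ones sum
  to \<open>a\<close>, the odd ones to \<open>b\<close>.
\<close>
primrec iterint :: "(real \<Rightarrow> complex) \<Rightarrow> nat \<Rightarrow> real \<Rightarrow> complex" where
  "iterint h 0 z = 1"
| "iterint h (Suc n) z = (LINT t:{0..z}|lborel. (if even n then h t else cnj (h t)) * iterint h n t)"

definition zs_a :: "(real \<Rightarrow> complex) \<Rightarrow> real \<Rightarrow> complex" where
  "zs_a h z = (\<Sum>n. iterint h (2 * n) z)"

definition zs_b :: "(real \<Rightarrow> complex) \<Rightarrow> real \<Rightarrow> complex" where
  "zs_b h z = (\<Sum>n. iterint h (Suc (2 * n)) z)"

lemma primitive_on_iterint: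
  assumes h: "set_integrable lborel {0..Z} h"
  shows "primitive_on Z (iterint h 0) (\<lambda>_. 0)"
    "primitive_on Z (iterint h (Suc n)) (\<lambda>t. (if even n then h t else cnj (h t)) * iterint h n t)"
proof -
  show base: "primitive_on Z (iterint h 0) (\<lambda>_. 0)"
    by (rule primitive_onI[where c=1]) (simp_all add: set_integrable_def)
  have hc: "set_integrable lborel {0..Z} (\<lambda>t. if even n then h t else cnj (h t))" for n
    using h primitive_on_integrable[OF primitive_on_cnj[OF primitive_on_integral[OF h]]] by (cases "even n") auto
  have "continuous_on {0..Z} (iterint h n)" for n
  proof (induction n)
    case 0 show ?case by (rule primitive_on_continuous[OF base])
  next
    case (Suc n)
    have "set_integrable lborel {0..Z} (\<lambda>t. (if even n then h t else cnj (h t)) * iterint h n t)"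
      using set_integrable_continuous_mult[OF Suc hc] by (simp add: mult.commute)
    from primitive_on_continuous[OF primitive_on_integral[OF this]]
    show ?case unfolding iterint.simps(2)[abs_def] .
  qed
  from set_integrable_continuous_mult[OF this hc]
  have "set_integrable lborel {0..Z} (\<lambda>t. (if even n then h t else cnj (h t)) * iterint h n t)"
    by (simp add: mult.commute)
  thus "primitive_on Z (iterint h (Suc n)) (\<lambda>t. (if even n then h t else cnj (h t)) * iterint h n t)"
    unfolding iterint.simps(2)[abs_def] by (rule primitive_on_integral)
qed

text \<open>The factorial is the volume of the ordered simplex. With H the primitive of |h|, the
  function H^(n+1) / (n+1)! has density H^n / n! times |h|, which dominates the integrand of the
  next iterated integral by induction.\<close>

lemma norm_iterint_le:
  assumes h: "set_integrable lborel {0..Z} h" and z: "z \<in> {0..Z}"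
  shows "norm (iterint h n z) \<le> (LINT t:{0..z}|lborel. norm (h t)) ^ n / fact n"
proof -
  define H where "H z = (LINT t:{0..z}|lborel. norm (h t))" for z
  have ih: "set_integrable lborel {0..z} (\<lambda>t. norm (h t))" if "z \<in> {0..Z}" for z
    using primitive_on_subset_integrable[OF primitive_on_integral[OF h] that] by (rule set_integrable_norm)
  \<comment> \<open>\<open>primitive_on\<close> is stated for complex functions, so the real
    function \<open>H\<close> is embedded in order to use the power rule.\<close>
  have "set_integrable lborel {0..Z} (\<lambda>t. complex_of_real (norm (h t)))"
    using set_integrable_norm[OF h] unfolding set_integrable_of_real_iff .
  from primitive_on_integral[OF this]
  have pH: "primitive_on Z (\<lambda>z. complex_of_real (H z)) (\<lambda>t. complex_of_real (norm (h t)))"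
    unfolding H_def set_integral_complex_of_real .
  have "norm (iterint h n z) \<le> H z ^ n / fact n" using z
  proof (induction n arbitrary: z)
    case (Suc n)
    note p = primitive_on_power[OF pH, of "Suc n"]
    have H0: "H 0 = 0" unfolding H_def set_lebesgue_integral_def
      by (rule integral_eq_zero_AE, use AE_lborel_singleton[of 0] in eventually_elim) (auto simp: indicator_def)
    have iR: "set_integrable lborel {0..z} (\<lambda>t. real (Suc n) * H t ^ n * norm (h t))"
    proof -
      have "set_integrable lborel {0..z} (\<lambda>t. complex_of_real (real (Suc n) * H t ^ n * norm (h t)))"
        using primitive_on_subset_integrable[OF p Suc.prems] by simp
      thus ?thesis unfolding set_integrable_of_real_iff .
    qed
    have "complex_of_real (H z ^ Suc n) = (LINT t:{0..z}|lborel. complex_of_real (real (Suc n) * H t ^ n * norm (h t)))"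
      using primitive_on_eq[OF p Suc.prems] by (simp add: H0)
    hence eq: "H z ^ Suc n = (LINT t:{0..z}|lborel. real (Suc n) * H t ^ n * norm (h t))"
      unfolding set_integral_complex_of_real of_real_eq_iff .
    have "norm (iterint h (Suc n) z) \<le> (LINT t:{0..z}|lborel. norm ((if even n then h t else cnj (h t)) * iterint h n t))"
      unfolding iterint.simps set_lebesgue_integral_def by (rule order_trans[OF integral_norm_bound]) simp
    also have "\<dots> \<le> (LINT t:{0..z}|lborel. 1 / fact (Suc n) * (real (Suc n) * H t ^ n * norm (h t)))"
    proof (rule set_integral_mono)
      show "set_integrable lborel {0..z} (\<lambda>t. norm ((if even n then h t else cnj (h t)) * iterint h n t))"
        by (rule set_integrable_norm[OF primitive_on_subset_integrable[OF primitive_on_iterint(2)[OF h] Suc.prems]])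
      show "set_integrable lborel {0..z} (\<lambda>t. 1 / fact (Suc n) * (real (Suc n) * H t ^ n * norm (h t)))"
        by (intro set_integrable_mult_right iR)
      fix t assume "t \<in> {0..z}"
      hence "norm (iterint h n t) \<le> H t ^ n / fact n" using Suc.prems by (intro Suc.IH) auto
      hence "norm (h t) * norm (iterint h n t) \<le> norm (h t) * (H t ^ n / fact n)" by (intro mult_left_mono) auto
      also have "\<dots> = 1 / fact (Suc n) * (real (Suc n) * H t ^ n * norm (h t))"
        by (simp add: divide_simps)
      finally show "norm ((if even n then h t else cnj (h t)) * iterint h n t) \<le> 1 / fact (Suc n) * (real (Suc n) * H t ^ n * norm (h t))"
        by (simp add: norm_mult)
    qed
    also have "\<dots> = H z ^ Suc n / fact (Suc n)" unfolding eq set_integral_mult_right by simp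
    finally show ?case .
  qed simp
  thus ?thesis unfolding H_def .
qed

lemma primitive_on_sum:
  assumes "\<And>n. n < N \<Longrightarrow> primitive_on Z (u n) (f n)"
  shows "primitive_on Z (\<lambda>z. \<Sum>n<(N::nat). u n z) (\<lambda>t. \<Sum>n<N. f n t)"
  using assms
proof (induction N)
  case 0
  show ?case by (rule primitive_onI[where c=0]) (simp_all add: set_integrable_def)
next
  case (Suc N)
  thus ?case using primitive_on_add[of Z "\<lambda>z. \<Sum>n<N. u n z" "\<lambda>t. \<Sum>n<N. f n t" "u N" "f N"] by simp
qed

text \<open>Majorises the even and the odd terms of the series by the same exponential series in the
  square of \<open>x\<close>.\<close>

lemma power_div_fact_le:
  fixes x :: real
  assumes "0 \<le> x"
  shows "x ^ (2 * n) / fact (2 * n) \<le> (x\<^sup>2) ^ n / fact n"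
    "x ^ Suc (2 * n) / fact (Suc (2 * n)) \<le> x * ((x\<^sup>2) ^ n / fact n)"
proof -
  have f: "fact n \<le> (fact (2 * n) :: real)" "fact n \<le> (fact (Suc (2 * n)) :: real)"
    by (intro fact_mono; simp)+
  show "x ^ (2 * n) / fact (2 * n) \<le> (x\<^sup>2) ^ n / fact n"
    unfolding power_mult[symmetric] using f assms by (intro divide_left_mono) auto
  have "x ^ Suc (2 * n) / fact (Suc (2 * n)) \<le> x ^ Suc (2 * n) / fact n"
    using f assms by (intro divide_left_mono) auto
  also have "\<dots> = x * ((x\<^sup>2) ^ n / fact n)" by (simp add: power_mult)
  finally show "x ^ Suc (2 * n) / fact (Suc (2 * n)) \<le> x * ((x\<^sup>2) ^ n / fact n)" .
qed

lemma summable_power_div_fact: "summable (\<lambda>n. (x :: real) ^ n / fact n)"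
  using summable_exp[of x] by (simp add: divide_inverse mult.commute)

lemma norm_iterint_even_odd_le:
  assumes h: "set_integrable lborel {0..Z} h" and z: "z \<in> {0..Z}" and X: "(LINT t:{0..Z}|lborel. norm (h t)) \<le> X"
  shows "norm (iterint h (2 * n) z) \<le> (X\<^sup>2) ^ n / fact n"
    "norm (iterint h (Suc (2 * n)) z) \<le> X * ((X\<^sup>2) ^ n / fact n)"
proof -
  have H0: "0 \<le> (LINT t:{0..z}|lborel. norm (h t))"
    unfolding set_lebesgue_integral_def by (intro Bochner_Integration.integral_nonneg) simp
  have "(LINT t:{0..z}|lborel. norm (h t)) \<le> (LINT t:{0..Z}|lborel. norm (h t))"
  proof -
    have i: "set_integrable lborel {0..Z} (\<lambda>t. norm (h t))" "set_integrable lborel {0..z} (\<lambda>t. norm (h t))"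
      using set_integrable_norm[OF h] set_integrable_norm[OF primitive_on_subset_integrable[OF primitive_on_integral[OF h] z]]
      by auto
    show ?thesis using i z unfolding set_lebesgue_integral_def set_integrable_def
      by (intro integral_mono) (auto simp: indicator_def)
  qed
  hence "(LINT t:{0..z}|lborel. norm (h t)) \<le> X" using X by linarith
  hence b: "norm (iterint h k z) \<le> X ^ k / fact k" for k
    by (intro order_trans[OF norm_iterint_le[OF h z]] divide_right_mono power_mono H0) auto
  have X0: "0 \<le> X" using H0 \<open>(LINT t:{0..z}|lborel. norm (h t)) \<le> X\<close> by linarith
  show "norm (iterint h (2 * n) z) \<le> (X\<^sup>2) ^ n / fact n"
    "norm (iterint h (Suc (2 * n)) z) \<le> X * ((X\<^sup>2) ^ n / fact n)"
    using b[of "2 * n"] b[of "Suc (2 * n)"] power_div_fact_le[OF X0, of n] by linarith+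
qed

section \<open>The Zakharov-Shabat solution and its invariants\<close>

lemma zs_initial: "zs_a h 0 = 1" "zs_b h 0 = 0"
proof -
  have z: "(LINT t:{0..0}|lborel. f t) = (0::complex)" for f :: "real \<Rightarrow> complex"
    unfolding set_integral_Icc_eq_Ico by (simp add: set_lebesgue_integral_def)
  have "iterint h (Suc n) 0 = 0" for n unfolding iterint.simps by (rule z)
  hence "iterint h n 0 = (if n = 0 then 1 else 0)" for n by (cases n) auto
  hence "(\<lambda>n. iterint h (2 * n) 0) = (\<lambda>n. if n = 0 then 1 else 0)" "(\<lambda>n. iterint h (Suc (2 * n)) 0) = (\<lambda>n. 0)"
    by (auto simp: fun_eq_iff simp del: iterint.simps)
  thus "zs_a h 0 = 1" "zs_b h 0 = 0" unfolding zs_a_def zs_b_def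
    using suminf_finite[of "{0}" "\<lambda>n::nat. if n = 0 then 1 else (0::complex)"] by auto
qed

lemma primitive_on_zs:
  assumes h: "set_integrable lborel {0..Z} h"
  shows "primitive_on Z (zs_a h) (\<lambda>t. cnj (h t) * zs_b h t)" "primitive_on Z (zs_b h) (\<lambda>t. h t * zs_a h t)"
proof -
  define X where "X = (LINT t:{0..Z}|lborel. norm (h t))"
  note bd = norm_iterint_even_odd_le[OF h _ order_refl, folded X_def]
  have sX: "summable (\<lambda>n. (X\<^sup>2) ^ n / fact n)" by (rule summable_power_div_fact)
  hence sX': "summable (\<lambda>n. X * ((X\<^sup>2) ^ n / fact n))" by (rule summable_mult)
  have s1: "summable (\<lambda>n. iterint h (2 * n) z)" and s2: "summable (\<lambda>n. iterint h (Suc (2 * n)) z)"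
    if z: "z \<in> {0..Z}" for z
    by (rule summable_comparison_test'[OF sX, of 0], rule bd(1)[OF z],
      rule summable_comparison_test'[OF sX', of 0], rule bd(2)[OF z])
  have lim_a: "(\<lambda>N. \<Sum>n<N. iterint h (2 * n) z) \<longlonglongrightarrow> zs_a h z" if "z \<in> {0..Z}" for z
    using summable_LIMSEQ[OF s1[OF that]] unfolding zs_a_def .
  have lim_b: "(\<lambda>N. \<Sum>n<N. iterint h (Suc (2 * n)) z) \<longlonglongrightarrow> zs_b h z" if "z \<in> {0..Z}" for z
    using summable_LIMSEQ[OF s2[OF that]] unfolding zs_b_def .
  have hn: "set_integrable lborel {0..Z} (\<lambda>t. norm (h t) * c)" for c
    using set_integrable_norm[OF h] by simp
  show "primitive_on Z (zs_b h) (\<lambda>t. h t * zs_a h t)"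
  proof (rule primitive_on_limit)
    show "primitive_on Z (\<lambda>z. \<Sum>n<N. iterint h (Suc (2 * n)) z) (\<lambda>t. \<Sum>n<N. h t * iterint h (2 * n) t)" for N
      using primitive_on_iterint(2)[OF h, of "2 * n" for n] by (intro primitive_on_sum) (simp del: iterint.simps)
    show "set_integrable lborel {0..Z} (\<lambda>t. norm (h t) * (\<Sum>n. (X\<^sup>2) ^ n / fact n))" by (rule hn)
    show "norm (\<Sum>n<N. h t * iterint h (2 * n) t) \<le> norm (h t) * (\<Sum>n. (X\<^sup>2) ^ n / fact n)" if "t \<in> {0..Z}" for N t
    proof -
      have "norm (\<Sum>n<N. iterint h (2 * n) t) \<le> (\<Sum>n<N. (X\<^sup>2) ^ n / fact n)"
        by (intro order_trans[OF norm_sum] sum_mono bd that)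
      also have "\<dots> \<le> (\<Sum>n. (X\<^sup>2) ^ n / fact n)" by (intro sum_le_suminf sX) auto
      finally show ?thesis unfolding sum_distrib_left[symmetric] norm_mult by (intro mult_left_mono) auto
    qed
    show "(\<lambda>N. \<Sum>n<N. h z * iterint h (2 * n) z) \<longlonglongrightarrow> h z * zs_a h z" if "z \<in> {0..Z}" for z
      unfolding sum_distrib_left[symmetric] by (intro tendsto_intros lim_a that)
  qed (rule lim_b)
  show "primitive_on Z (zs_a h) (\<lambda>t. cnj (h t) * zs_b h t)"
  proof (rule primitive_on_limit)
    \<comment> \<open>The even term of index 0 is the constant 1 with density 0, so
      \<open>Suc N\<close> even terms correspond to \<open>N\<close> odd terms in the
      density.\<close>
    show "primitive_on Z (\<lambda>z. \<Sum>n<Suc N. iterint h (2 * n) z) (\<lambda>t. \<Sum>n<N. cnj (h t) * iterint h (Suc (2 * n)) t)" for N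
    proof -
      have "primitive_on Z (\<lambda>z. \<Sum>n<N. iterint h (Suc (Suc (2 * n))) z) (\<lambda>t. \<Sum>n<N. cnj (h t) * iterint h (Suc (2 * n)) t)"
        using primitive_on_iterint(2)[OF h, of "Suc (2 * n)" for n] by (intro primitive_on_sum) (simp del: iterint.simps)
      from primitive_on_add[OF primitive_on_iterint(1)[OF h] this]
      show ?thesis unfolding sum.lessThan_Suc_shift by (simp del: iterint.simps)
    qed
    show "set_integrable lborel {0..Z} (\<lambda>t. norm (h t) * (\<Sum>n. X * ((X\<^sup>2) ^ n / fact n)))" by (rule hn)
    show "norm (\<Sum>n<N. cnj (h t) * iterint h (Suc (2 * n)) t) \<le> norm (h t) * (\<Sum>n. X * ((X\<^sup>2) ^ n / fact n))"
      if "t \<in> {0..Z}" for N t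
    proof -
      have "0 \<le> X" unfolding X_def set_lebesgue_integral_def by (intro Bochner_Integration.integral_nonneg) simp
      have "norm (\<Sum>n<N. iterint h (Suc (2 * n)) t) \<le> (\<Sum>n<N. X * ((X\<^sup>2) ^ n / fact n))"
        by (intro order_trans[OF norm_sum] sum_mono bd that)
      also have "\<dots> \<le> (\<Sum>n. X * ((X\<^sup>2) ^ n / fact n))" using \<open>0 \<le> X\<close> by (intro sum_le_suminf sX') auto
      finally show ?thesis unfolding sum_distrib_left[symmetric] norm_mult complex_mod_cnj by (intro mult_left_mono) auto
    qed
    show "(\<lambda>N. \<Sum>n<Suc N. iterint h (2 * n) z) \<longlonglongrightarrow> zs_a h z" if "z \<in> {0..Z}" for z
      by (rule LIMSEQ_Suc[OF lim_a[OF that]])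
    show "(\<lambda>N. \<Sum>n<N. cnj (h z) * iterint h (Suc (2 * n)) z) \<longlonglongrightarrow> cnj (h z) * zs_b h z" if "z \<in> {0..Z}" for z
      unfolding sum_distrib_left[symmetric] by (intro tendsto_intros lim_b that)
  qed
qed

text \<open>Two forms are constant along a pair of solutions since their densities cancel
  identically: the indefinite Hermitian form of signature (1,1), preserved because the coefficient
  matrix lies in su(1,1), and the determinant of the two solutions, preserved because its trace is
  0.\<close>

lemma zs_det:
  assumes h: "set_integrable lborel {0..Z} h" and z: "z \<in> {0..Z}"
    and a: "primitive_on Z a (\<lambda>t. cnj (h t) * b t)" and b: "primitive_on Z b (\<lambda>t. h t * a t)"
    and a0: "a 0 = 1" and b0: "b 0 = 0"
  shows "a z * cnj (zs_a h z) - b z * cnj (zs_b h z) = 1" "a z * zs_b h z = b z * zs_a h z"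
proof -
  note pa = primitive_on_zs(1)[OF h] and pb = primitive_on_zs(2)[OF h]
  have "primitive_on Z (\<lambda>z. a z * cnj (zs_a h z) + - 1 * (b z * cnj (zs_b h z)))
     (\<lambda>t. (cnj (h t) * b t * cnj (zs_a h t) + a t * cnj (cnj (h t) * zs_b h t)) +
        -1 * (h t * a t * cnj (zs_b h t) + b t * cnj (h t * zs_a h t)))"
    by (intro primitive_on_add primitive_on_cmult primitive_on_mult primitive_on_cnj a b pa pb)
  from primitive_on_zero_density[OF this _ z]
  show "a z * cnj (zs_a h z) - b z * cnj (zs_b h z) = 1"
    by (simp add: zs_initial a0 b0 algebra_simps)
  have "primitive_on Z (\<lambda>z. a z * zs_b h z + - 1 * (b z * zs_a h z))
     (\<lambda>t. (cnj (h t) * b t * zs_b h t + a t * (h t * zs_a h t)) +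
        -1 * (h t * a t * zs_a h t + b t * (cnj (h t) * zs_b h t)))"
    by (intro primitive_on_add primitive_on_cmult primitive_on_mult primitive_on_cnj a b pa pb)
  from primitive_on_zero_density[OF this _ z]
  show "a z * zs_b h z = b z * zs_a h z"
    by (simp add: zs_initial a0 b0 algebra_simps)
qed

lemma zs_conserved:
  assumes h: "set_integrable lborel {0..Z} h" and z: "z \<in> {0..Z}"
  shows "zs_a h z * cnj (zs_a h z) - zs_b h z * cnj (zs_b h z) = 1"
  by (rule zs_det(1)[OF h z primitive_on_zs[OF h] zs_initial])

text \<open>The two invariants are linear equations for \<open>a z\<close> and \<open>b z\<close>
  with a determinant of modulus 1 by \<open>zs_conserved\<close>; solving them replaces a Gronwall
  argument.\<close>

lemma zs_unique:
  assumes h: "set_integrable lborel {0..Z} h" and z: "z \<in> {0..Z}"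
    and a: "primitive_on Z a (\<lambda>t. cnj (h t) * b t)" and b: "primitive_on Z b (\<lambda>t. h t * a t)"
    and a0: "a 0 = 1" and b0: "b 0 = 0"
  shows "a z = zs_a h z"
proof -
  note d = zs_det[OF h z a b a0 b0] and c = zs_conserved[OF h z]
  have "zs_a h z = zs_a h z * (a z * cnj (zs_a h z) - b z * cnj (zs_b h z))" by (simp add: d(1))
  also have "\<dots> = a z * (zs_a h z * cnj (zs_a h z)) - b z * zs_a h z * cnj (zs_b h z)" by (simp add: algebra_simps)
  also have "\<dots> = a z * (zs_a h z * cnj (zs_a h z) - zs_b h z * cnj (zs_b h z))"
    unfolding d(2)[symmetric] by (simp add: algebra_simps)
  finally show ?thesis by (simp add: c)
qed

text \<open>Conservation of energy, |a|^2 = 1 + |b|^2. It confines r = b / a and q = 1 / a to the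
  closed unit disc however large \<open>h\<close> is.\<close>

lemma zs_norms:
  assumes h: "set_integrable lborel {0..Z} h" and z: "z \<in> {0..Z}"
  shows "1 \<le> norm (zs_a h z)" "norm (zs_b h z) \<le> norm (zs_a h z)" "zs_a h z \<noteq> 0"
proof -
  have "complex_of_real ((norm (zs_a h z))\<^sup>2 - (norm (zs_b h z))\<^sup>2) = complex_of_real 1"
    using zs_conserved[OF h z] by (simp only: complex_norm_square of_real_diff of_real_1)
  hence e: "(norm (zs_a h z))\<^sup>2 = 1 + (norm (zs_b h z))\<^sup>2" unfolding of_real_eq_iff by linarith
  show "norm (zs_b h z) \<le> norm (zs_a h z)" by (rule power2_le_imp_le) (auto simp: e)
  show "1 \<le> norm (zs_a h z)" by (rule power2_le_imp_le) (auto simp: e)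
  thus "zs_a h z \<noteq> 0" by auto
qed

lemma primitive_on_reflection_transmission:
  assumes h: "set_integrable lborel {0..Z} h"
  defines "r \<equiv> \<lambda>z. zs_b h z / zs_a h z" and "q \<equiv> \<lambda>z. 1 / zs_a h z"
  shows "primitive_on Z r (\<lambda>t. h t - cnj (h t) * (r t * r t))"
    "primitive_on Z q (\<lambda>t. - cnj (h t) * (r t * q t))"
proof -
  have nz: "zs_a h t \<noteq> 0" if "t \<in> {0..Z}" for t using zs_norms(3)[OF h that] .
  note pa = primitive_on_zs(1)[OF h] and pb = primitive_on_zs(2)[OF h]
  show pq: "primitive_on Z q (\<lambda>t. - cnj (h t) * (r t * q t))"
    by (rule primitive_on_cong[OF primitive_on_inverse[OF pa nz]]) (auto simp: q_def r_def)
  show "primitive_on Z r (\<lambda>t. h t - cnj (h t) * (r t * r t))"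
    by (rule primitive_on_cong[OF primitive_on_mult[OF pb pq]]) (use nz in \<open>auto simp: q_def r_def\<close>)
qed

section \<open>The propagator and the transmission coefficient\<close>

lemma bounded_linear_axis_axis: "bounded_linear (\<lambda>z :: complex. axis i (axis j z) :: complex^2^2)"
  unfolding linear_conv_bounded_linear[symmetric]
  by (rule linearI) (auto simp: vec_eq_iff axis_def)

lemma matrix_axis_expansion: "(\<Sum>i\<in>UNIV. \<Sum>j\<in>UNIV. axis i (axis j (A $ i $ j))) = (A :: complex^2^2)"
  by (auto simp: vec_eq_iff axis_def sum_2 forall_2)

lemma integrable_matrix:
  fixes F :: "'a \<Rightarrow> complex^2^2"
  assumes "\<And>i j. integrable M (\<lambda>t. F t $ i $ j)"
  shows "integrable M F"
proof -
  have "integrable M (\<lambda>t. \<Sum>i\<in>UNIV. \<Sum>j\<in>UNIV. axis i (axis j (F t $ i $ j)) :: complex^2^2)"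
    by (intro Bochner_Integration.integrable_sum integrable_bounded_linear[OF bounded_linear_axis_axis] assms)
  thus ?thesis by (simp only: matrix_axis_expansion)
qed

lemma bounded_linear_entry: "bounded_linear (\<lambda>A :: complex^2^2. A $ i $ j)"
  using bounded_linear_compose[OF bounded_linear_vec_nth[of j] bounded_linear_vec_nth[of i]] by (simp add: o_def)

lemma set_integral_matrix:
  fixes F :: "real \<Rightarrow> complex^2^2"
  assumes "\<And>i j. set_integrable M A (\<lambda>t. F t $ i $ j)"
  shows "(LINT t:A|M. F t) $ i $ j = (LINT t:A|M. F t $ i $ j)"
proof -
  have "integrable M (\<lambda>t. indicator A t *\<^sub>R F t)"
    using assms by (intro integrable_matrix) (simp add: set_integrable_def)
  from integral_bounded_linear[OF bounded_linear_entry this]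
  show ?thesis unfolding set_lebesgue_integral_def by simp
qed

lemma propagator_coeff_entries:
  fixes n :: "real \<Rightarrow> real"
  defines "c \<equiv> \<lambda>\<omega>. \<i> * complex_of_real \<omega> / 2" and "\<theta> \<equiv> \<lambda>\<tau> \<epsilon> \<omega> t. \<i> * complex_of_real (2 * \<omega> / \<epsilon> powr \<tau> * t)"
  shows "propagator_coeff \<tau> \<epsilon> n \<omega> t $ 1 $ 1 = c \<omega> * n t"
    "propagator_coeff \<tau> \<epsilon> n \<omega> t $ 1 $ 2 = - c \<omega> * exp (- \<theta> \<tau> \<epsilon> \<omega> t) * n t"
    "propagator_coeff \<tau> \<epsilon> n \<omega> t $ 2 $ 1 = c \<omega> * exp (\<theta> \<tau> \<epsilon> \<omega> t) * n t"
    "propagator_coeff \<tau> \<epsilon> n \<omega> t $ 2 $ 2 = - c \<omega> * n t"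
  unfolding propagator_coeff_def Let_def c_def \<theta>_def by (simp_all add: mult_ac)

lemma set_integrable_coeff_entry:
  assumes "set_integrable lborel {0..Z} n" and "continuous_on {0..Z} u"
  shows "set_integrable lborel {0..Z} (\<lambda>t. propagator_coeff \<tau> \<epsilon> n \<omega> t $ i $ k * u t)"
proof -
  have n: "set_integrable lborel {0..Z} (\<lambda>t. complex_of_real (n t))"
    using assms(1) by (simp only: set_integrable_of_real_iff)
  define c where "c = \<i> * complex_of_real \<omega> / 2"
  define \<kappa> where "\<kappa> = 2 * \<omega> / \<epsilon> powr \<tau>"
  define \<theta> where "\<theta> t = \<i> * complex_of_real (\<kappa> * t)" for t
  define m where "m t = (if i = 1 then if k = 1 then c else - c * exp (- \<theta> t)
    else if k = 1 then c * exp (\<theta> t) else - c)" for t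
  have m: "continuous_on {0..Z} m"
    unfolding m_def[abs_def] \<theta>_def by (cases "i = 1"; cases "k = 1") (auto intro!: continuous_intros)
  have meq: "propagator_coeff \<tau> \<epsilon> n \<omega> t $ i $ k = m t * complex_of_real (n t)" for t
    using exhaust_2[of i] exhaust_2[of k] unfolding m_def c_def \<theta>_def \<kappa>_def
    by (auto simp: propagator_coeff_entries)
  have "set_integrable lborel {0..Z} (\<lambda>t. (m t * u t) * complex_of_real (n t))"
    by (intro set_integrable_continuous_mult continuous_on_mult m assms n)
  thus ?thesis unfolding meq by (simp add: mult_ac)
qed

text \<open>Brings the matrix equation into the scalar calculus of \<open>primitive_on\<close>.
  Entrywise, each column of the propagator solves a closed system of two equations.\<close>

lemma solves_propagator_ode_iff:
  assumes Z: "0 < Z" and n: "set_integrable lborel {0..Z} n"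
  shows "solves_propagator_ode Z \<tau> \<epsilon> n \<omega> P \<longleftrightarrow>
    (\<forall>i j. P 0 $ i $ j = mat 1 $ i $ j \<and>
       primitive_on Z (\<lambda>z. P z $ i $ j) (\<lambda>t. (propagator_coeff \<tau> \<epsilon> n \<omega> t ** P t) $ i $ j))"
proof -
  let ?F = "\<lambda>t. propagator_coeff \<tau> \<epsilon> n \<omega> t ** P t"
  have mm: "?F t $ i $ j = propagator_coeff \<tau> \<epsilon> n \<omega> t $ i $ 1 * P t $ 1 $ j + propagator_coeff \<tau> \<epsilon> n \<omega> t $ i $ 2 * P t $ 2 $ j" for t i j
    by (simp add: matrix_matrix_mult_def sum_2)
  have int: "set_integrable lborel {0..z} (\<lambda>t. ?F t $ i $ j)"
    if "\<And>i j. continuous_on {0..Z} (\<lambda>z. P z $ i $ j)" "z \<in> {0..Z}" for i j z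
  proof -
    have "set_integrable lborel {0..Z} (\<lambda>t. ?F t $ i $ j)"
      unfolding mm by (intro set_integral_add set_integrable_coeff_entry n that)
    thus ?thesis by (rule set_integrable_subset) (use that in auto)
  qed
  show ?thesis
  proof
    assume s: "solves_propagator_ode Z \<tau> \<epsilon> n \<omega> P"
    hence P: "continuous_on {0..Z} P" and eq: "\<And>z. z \<in> {0..Z} \<Longrightarrow> P z = mat 1 + (LINT t:{0..z}|lborel. ?F t)"
      unfolding solves_propagator_ode_def by auto
    have c: "continuous_on {0..Z} (\<lambda>z. P z $ i $ j)" for i j by (intro continuous_intros P)
    have eq': "P z $ i $ j = mat 1 $ i $ j + (LINT t:{0..z}|lborel. ?F t $ i $ j)" if "z \<in> {0..Z}" for z i j
      using eq[OF that] set_integral_matrix[OF int[OF c that]] by simp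
    show "\<forall>i j. P 0 $ i $ j = mat 1 $ i $ j \<and> primitive_on Z (\<lambda>z. P z $ i $ j) (\<lambda>t. ?F t $ i $ j)"
    proof (intro allI conjI)
      fix i j
      show "primitive_on Z (\<lambda>z. P z $ i $ j) (\<lambda>t. ?F t $ i $ j)"
        by (rule primitive_onI[OF int[OF c] eq']) (use Z in auto)
      have "(LINT t:{0..0}|lborel. ?F t $ i $ j) = 0"
        unfolding set_integral_Icc_eq_Ico by (simp add: set_lebesgue_integral_def)
      thus "P 0 $ i $ j = mat 1 $ i $ j" using eq'[of 0 i j] Z by simp
    qed
  next
    assume a: "\<forall>i j. P 0 $ i $ j = mat 1 $ i $ j \<and> primitive_on Z (\<lambda>z. P z $ i $ j) (\<lambda>t. ?F t $ i $ j)"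
    hence c: "continuous_on {0..Z} (\<lambda>z. P z $ i $ j)" for i j
      by (intro primitive_on_continuous) blast
    have "continuous_on {0..Z} (\<lambda>z. \<chi> i j. P z $ i $ j)"
      by (intro continuous_on_vec_lambda c)
    hence "continuous_on {0..Z} P" by simp
    moreover have "P z = mat 1 + (LINT t:{0..z}|lborel. ?F t)" if z: "z \<in> {0..Z}" for z
    proof -
      have "P z $ i $ j = mat 1 $ i $ j + (LINT t:{0..z}|lborel. ?F t $ i $ j)" for i j
        using primitive_on_eq[of Z "\<lambda>z. P z $ i $ j" "\<lambda>t. ?F t $ i $ j" z] a z by metis
      thus ?thesis by (simp only: vec_eq_iff vector_add_component set_integral_matrix[OF int[OF c z]]) simp
    qed
    ultimately show "solves_propagator_ode Z \<tau> \<epsilon> n \<omega> P" unfolding solves_propagator_ode_def by blast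
  qed
qed

section \<open>Removal of the averaged phase\<close>

definition drift :: "(real \<Rightarrow> real) \<Rightarrow> real \<Rightarrow> real" where
  "drift n z = (LINT t:{0..z}|lborel. n t)"

text \<open>The off-diagonal coefficient of the propagator equation after its diagonal part has been
  removed by the phases exp (i \<omega> V / 2) and exp (- i \<omega> V / 2). The two components
  carry opposite phases, so the coupling contains their quotient, the full phase exp (i \<omega>
  V).\<close>

definition coupling :: "real \<Rightarrow> real \<Rightarrow> (real \<Rightarrow> real) \<Rightarrow> real \<Rightarrow> complex" where
  "coupling k \<omega> n t = \<i> * complex_of_real \<omega> / 2 *
     (iexp (\<omega> * drift n t) * (iexp (k * t) * complex_of_real (n t)))"

lemma primitive_on_drift:
  assumes "set_integrable lborel {0..Z} n"
  shows "primitive_on Z (\<lambda>z. complex_of_real (drift n z)) (\<lambda>t. complex_of_real (n t))"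
  using primitive_on_integral[of Z "\<lambda>t. complex_of_real (n t)"] assms
  unfolding drift_def set_integral_complex_of_real set_integrable_of_real_iff .

lemma primitive_on_exp_drift:
  assumes "set_integrable lborel {0..Z} n"
  shows "primitive_on Z (\<lambda>z. exp (c * complex_of_real (drift n z)))
    (\<lambda>t. exp (c * complex_of_real (drift n t)) * (c * complex_of_real (n t)))"
  by (intro primitive_on_exp primitive_on_cmult primitive_on_drift assms)

lemma drift_0: "drift n 0 = 0"
proof -
  have "complex_of_real (drift n 0) = 0"
    unfolding drift_def set_integral_complex_of_real[symmetric] set_integral_Icc_eq_Ico
    by (simp add: set_lebesgue_integral_def)
  thus ?thesis by simp
qed

lemma exp_drift_eq: "iexp (\<omega> * x) = exp (\<i> * complex_of_real \<omega> * complex_of_real x)"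
  by (simp add: mult_ac)

lemma set_integrable_osc:
  assumes n: "set_integrable lborel {0..Z} n"
  shows "set_integrable lborel {0..Z} (\<lambda>t. iexp (k * t) * complex_of_real (n t))"
  by (intro set_integrable_continuous_mult continuous_intros) (use n in \<open>simp only: set_integrable_of_real_iff\<close>)

lemma set_integrable_coupling:
  assumes n: "set_integrable lborel {0..Z} n"
  shows "set_integrable lborel {0..Z} (coupling k \<omega> n)"
proof -
  have "set_integrable lborel {0..Z} (\<lambda>t. exp (\<i> * complex_of_real \<omega> * complex_of_real (drift n t)) * (iexp (k * t) * complex_of_real (n t)))"
    by (intro set_integrable_continuous_mult[OF primitive_on_continuous[OF primitive_on_exp_drift[OF n]]] set_integrable_osc n)
  thus ?thesis unfolding coupling_def[abs_def] exp_drift_eq by (intro set_integrable_mult_right)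
qed

lemma cnj_exp_i_real: "cnj (iexp x) = exp (- (\<i> * complex_of_real x))"
  by (simp add: exp_cnj)

text \<open>The propagator is a choice among solutions, so two things have to be shown. The explicit
  gauge transform of \<open>zs_a\<close> and \<open>zs_b\<close> is a solution, hence the choice is
  one; the inverse gauge transform of any solution falls under \<open>zs_unique\<close>, hence its
  entry at \<open>Z\<close> is determined.\<close>

lemma transmission_coeff_eq:
  fixes Z \<tau> \<epsilon> \<omega> :: real and n :: "real \<Rightarrow> real"
  assumes Z: "0 < Z" and n: "set_integrable lborel {0..Z} n"
  defines "h \<equiv> coupling (2 * \<omega> / \<epsilon> powr \<tau>) \<omega> n"
  shows "transmission_coeff Z \<tau> \<epsilon> n \<omega> Z =
    iexp (\<omega> / 2 * drift n Z) * cnj (1 / zs_a h Z)"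
proof -
  define c where "c = \<i> * complex_of_real \<omega> / 2"
  \<comment> \<open>Gauge factors: multiplication by \<open>E 1\<close> in the first and
    \<open>E (-1)\<close> in the second component produces the diagonal terms \<open>c * n\<close>
    and \<open>- c * n\<close> of the coefficient matrix.\<close>
  define E where "E s z = exp (s * c * complex_of_real (drift n z))" for s z
  define \<theta> where "\<theta> t = \<i> * complex_of_real (2 * \<omega> / \<epsilon> powr \<tau> * t)" for t
  have pE: "primitive_on Z (E s) (\<lambda>t. E s t * (s * c * n t))" for s
    unfolding E_def by (rule primitive_on_exp_drift[OF n])
  have h: "set_integrable lborel {0..Z} h" unfolding h_def by (rule set_integrable_coupling[OF n])
  have E0: "E s 0 = 1" for s by (simp add: E_def drift_0)
  have EE: "E 1 z * E (-1) z = 1" for z unfolding E_def exp_add[symmetric] by simp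
  have hE: "h t = c * (E 1 t * E 1 t * (exp (\<theta> t) * n t))" for t
    unfolding h_def coupling_def c_def E_def \<theta>_def exp_add[symmetric] by (simp add: mult_ac)
  have cE: "cnj (E s t) = E (- s) t" if "s = 1 \<or> s = -1" for s t
    using that unfolding E_def c_def by (auto simp: exp_cnj)
  have c\<theta>: "cnj (exp (\<theta> t)) = exp (- \<theta> t)" for t unfolding \<theta>_def by (rule cnj_exp_i_real)
  have cc: "cnj c = - c" unfolding c_def by simp
  have hcE: "cnj (h t) = - c * (E (-1) t * E (-1) t * (exp (- \<theta> t) * n t))" for t
    unfolding hE by (simp add: cc cE c\<theta>)
  define al where "al z = E 1 z * zs_a h z" for z
  define be where "be z = E (-1) z * zs_b h z" for z
  note ent = propagator_coeff_entries[of \<tau> \<epsilon> n \<omega>, folded c_def \<theta>_def]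
  have pal: "primitive_on Z al (\<lambda>t. c * n t * al t + - c * exp (- \<theta> t) * n t * be t)"
  proof -
    have "E 1 t * (1 * c * n t) * zs_a h t + E 1 t * (cnj (h t) * zs_b h t) = c * n t * al t + - c * exp (- \<theta> t) * n t * be t" for t
    proof -
      have "E 1 t * (cnj (h t) * zs_b h t) = (E 1 t * E (-1) t) * (- c * exp (- \<theta> t) * n t * be t)"
        unfolding hcE be_def by (simp only: mult_ac)
      thus ?thesis unfolding EE al_def by (simp add: mult_ac)
    qed
    note e = this
    show ?thesis using primitive_on_mult[OF pE[of 1] primitive_on_zs(1)[OF h]] unfolding e unfolding al_def[symmetric] .
  qed
  have pbe: "primitive_on Z be (\<lambda>t. c * exp (\<theta> t) * n t * al t + - c * n t * be t)"
  proof -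
    have "E (-1) t * (-1 * c * n t) * zs_b h t + E (-1) t * (h t * zs_a h t) = c * exp (\<theta> t) * n t * al t + - c * n t * be t" for t
    proof -
      have "E (-1) t * (h t * zs_a h t) = (E 1 t * E (-1) t) * (c * exp (\<theta> t) * n t * al t)"
        unfolding hE al_def by (simp only: mult_ac)
      thus ?thesis unfolding EE be_def by (simp add: mult_ac)
    qed
    note e = this
    show ?thesis using primitive_on_mult[OF pE[of "-1"] primitive_on_zs(2)[OF h]] unfolding e unfolding be_def[symmetric] .
  qed
  define P where "P z = (vector [vector [al z, cnj (be z)], vector [be z, cnj (al z)]] :: complex^2^2)" for z
  have "solves_propagator_ode Z \<tau> \<epsilon> n \<omega> P"
    unfolding solves_propagator_ode_iff[OF Z n] forall_2
  proof (intro conjI)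
    have cn: "cnj c = - c" "cnj (exp (- \<theta> t)) = exp (\<theta> t)" for t using cc c\<theta>[of t] by (auto simp flip: c\<theta>)
    show "primitive_on Z (\<lambda>z. P z $ 1 $ 1) (\<lambda>t. (propagator_coeff \<tau> \<epsilon> n \<omega> t ** P t) $ 1 $ 1)"
      "primitive_on Z (\<lambda>z. P z $ 2 $ 1) (\<lambda>t. (propagator_coeff \<tau> \<epsilon> n \<omega> t ** P t) $ 2 $ 1)"
      using pal pbe by (simp_all add: P_def matrix_matrix_mult_def sum_2 ent)
    show "primitive_on Z (\<lambda>z. P z $ 1 $ 2) (\<lambda>t. (propagator_coeff \<tau> \<epsilon> n \<omega> t ** P t) $ 1 $ 2)"
      using primitive_on_cnj[OF pbe] by (simp add: P_def matrix_matrix_mult_def sum_2 ent cn c\<theta> algebra_simps)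
    show "primitive_on Z (\<lambda>z. P z $ 2 $ 2) (\<lambda>t. (propagator_coeff \<tau> \<epsilon> n \<omega> t ** P t) $ 2 $ 2)"
      using primitive_on_cnj[OF pal] by (simp add: P_def matrix_matrix_mult_def sum_2 ent cn c\<theta> algebra_simps)
  qed (simp_all add: P_def al_def be_def mat_def zs_initial E0)
  hence ex: "\<exists>P. solves_propagator_ode Z \<tau> \<epsilon> n \<omega> P" by blast
  define Q where "Q = propagator Z \<tau> \<epsilon> n \<omega>"
  have "solves_propagator_ode Z \<tau> \<epsilon> n \<omega> Q"
    unfolding Q_def propagator_def using someI_ex[OF ex] .
  hence Q: "Q 0 $ 1 $ 1 = 1" "Q 0 $ 2 $ 1 = 0"
    "primitive_on Z (\<lambda>z. Q z $ 1 $ 1) (\<lambda>t. c * n t * Q t $ 1 $ 1 + - c * exp (- \<theta> t) * n t * Q t $ 2 $ 1)"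
    "primitive_on Z (\<lambda>z. Q z $ 2 $ 1) (\<lambda>t. c * exp (\<theta> t) * n t * Q t $ 1 $ 1 + - c * n t * Q t $ 2 $ 1)"
    unfolding solves_propagator_ode_iff[OF Z n] forall_2 by (simp_all add: mat_def matrix_matrix_mult_def sum_2 ent)
  \<comment> \<open>The gauge transformation in the opposite direction, applied to the chosen
    solution, of which nothing but the equation is known.\<close>
  define a where "a z = E (-1) z * Q z $ 1 $ 1" for z
  define b where "b z = E 1 z * Q z $ 2 $ 1" for z
  have pa: "primitive_on Z a (\<lambda>t. cnj (h t) * b t)"
  proof -
    have "E (-1) t * (-1 * c * n t) * Q t $ 1 $ 1 + E (-1) t * (c * n t * Q t $ 1 $ 1 + - c * exp (- \<theta> t) * n t * Q t $ 2 $ 1) = cnj (h t) * b t" for t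
    proof -
      have "cnj (h t) * b t = (E 1 t * E (-1) t) * (E (-1) t * (- c * exp (- \<theta> t) * n t * Q t $ 2 $ 1))"
        unfolding hcE b_def by (simp only: mult_ac)
      thus ?thesis unfolding EE by (simp add: algebra_simps)
    qed
    note e = this
    show ?thesis using primitive_on_mult[OF pE[of "-1"] Q(3)] unfolding e unfolding a_def[symmetric] .
  qed
  have pb: "primitive_on Z b (\<lambda>t. h t * a t)"
  proof -
    have "E 1 t * (1 * c * n t) * Q t $ 2 $ 1 + E 1 t * (c * exp (\<theta> t) * n t * Q t $ 1 $ 1 + - c * n t * Q t $ 2 $ 1) = h t * a t" for t
    proof -
      have "h t * a t = (E 1 t * E (-1) t) * (E 1 t * (c * exp (\<theta> t) * n t * Q t $ 1 $ 1))"
        unfolding hE a_def by (simp only: mult_ac)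
      thus ?thesis unfolding EE by (simp add: algebra_simps)
    qed
    note e = this
    show ?thesis using primitive_on_mult[OF pE[of 1] Q(4)] unfolding e unfolding b_def[symmetric] .
  qed
  have "a Z = zs_a h Z"
    by (rule zs_unique[OF h _ pa pb]) (use Z Q in \<open>auto simp: a_def b_def E0\<close>)
  hence "zs_a h Z * E 1 Z = (E 1 Z * E (-1) Z) * Q Z $ 1 $ 1" unfolding a_def by (simp only: mult_ac)
  hence "Q Z $ 1 $ 1 = E 1 Z * zs_a h Z" unfolding EE by (simp add: mult_ac)
  hence "transmission_coeff Z \<tau> \<epsilon> n \<omega> Z = 1 / (E (-1) Z * cnj (zs_a h Z))"
    unfolding transmission_coeff_def Q_def[symmetric] by (simp add: cE)
  also have "\<dots> = (E 1 Z * E (-1) Z) / (E (-1) Z * cnj (zs_a h Z))" unfolding EE ..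
  also have "\<dots> = E 1 Z * cnj (1 / zs_a h Z)"
  proof -
    have "E (-1) Z \<noteq> 0" by (simp add: E_def)
    thus ?thesis by (simp add: divide_simps)
  qed
  also have "E 1 Z = iexp (\<omega> / 2 * drift n Z)" unfolding E_def c_def by (simp add: mult_ac)
  finally show ?thesis .
qed

text \<open>One family covers both paths: frequency 0 gives the averaged path V, other frequencies
  the oscillating path U. Every moment estimate is thereby proved once.\<close>

definition osc :: "real \<Rightarrow> (real \<Rightarrow> real) \<Rightarrow> real \<Rightarrow> complex" where
  "osc k n z = (LINT t:{0..z}|lborel. iexp (k * t) * complex_of_real (n t))"

lemma osc_0: "osc 0 n z = complex_of_real (drift n z)"
  unfolding osc_def drift_def by (simp add: set_integral_complex_of_real)

lemma norm_iexp_diff_le: "norm (iexp x - iexp y) \<le> \<bar>x - y\<bar>"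
proof -
  have "iexp x - iexp y = iexp y * (iexp (x - y) - 1)"
    by (simp add: right_diff_distrib exp_diff)
  hence "norm (iexp x - iexp y) = norm (iexp (x - y) - 1)"
    by (simp only: norm_mult norm_exp_i_times mult_1)
  also have "\<dots> \<le> \<bar>x - y\<bar>" using iexp_approx1[of "x - y" 0] by simp
  finally show ?thesis .
qed

lemma energy_exp_drift_le:
  "energy Z (\<lambda>t. iexp (\<omega> * drift n t)) m \<le> \<bar>\<omega>\<bar> * energy Z (osc 0 n) m"
proof -
  have "norm (increment Z (\<lambda>t. iexp (\<omega> * drift n t)) m j) \<le> \<bar>\<omega>\<bar> * norm (increment Z (osc 0 n) m j)" for j
    unfolding increment_def osc_0 of_real_diff[symmetric] norm_of_real
    by (rule order_trans[OF norm_iexp_diff_le]) (simp add: abs_mult[symmetric] right_diff_distrib)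
  hence "energy Z (\<lambda>t. iexp (\<omega> * drift n t)) m \<le> L2_set (\<lambda>j. \<bar>\<omega>\<bar> * norm (increment Z (osc 0 n) m j)) {..<2 ^ m}"
    unfolding energy_def by (intro L2_set_mono) auto
  thus ?thesis unfolding energy_def by (simp add: L2_set_right_distrib)
qed

lemma riccati_pair_coupling:
  fixes n :: "real \<Rightarrow> real" and k \<omega> :: real
  assumes n: "set_integrable lborel {0..Z} n"
  defines "h \<equiv> coupling k \<omega> n"
  shows "riccati_pair Z (\<i> * complex_of_real \<omega> / 2) (\<lambda>t. iexp (\<omega> * drift n t))
    (\<lambda>t. iexp (k * t) * complex_of_real (n t))
    (\<lambda>z. zs_b h z / zs_a h z) (\<lambda>z. 1 / zs_a h z)"
  unfolding riccati_pair_def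
proof (intro conjI ballI)
  have h: "set_integrable lborel {0..Z} h" unfolding h_def by (rule set_integrable_coupling[OF n])
  note pr = primitive_on_reflection_transmission[OF h]
  show "norm (zs_b h t / zs_a h t) \<le> 1" "norm (1 / zs_a h t) \<le> 1" if "t \<in> {0..Z}" for t
    using zs_norms[OF h that] by (auto simp: norm_divide divide_le_eq_1)
  define c where "c = \<i> * complex_of_real \<omega> / 2"
  \<comment> \<open>\<open>c\<close> is purely imaginary. Conjugating the coupling therefore flips a
    sign, which turns the minus signs of \<open>primitive_on_reflection_transmission\<close> into
    the plus signs of \<open>riccati_pair\<close>.\<close>
  have cc: "cnj c = - c" by (simp add: c_def)
  define g where "g t = iexp (\<omega> * drift n t)" for t
  define w where "w t = iexp (k * t) * complex_of_real (n t)" for t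
  have hh: "h t = c * (g t * w t)" for t unfolding h_def coupling_def c_def g_def w_def ..
  show "primitive_on Z (\<lambda>z. zs_b h z / zs_a h z)
     (\<lambda>t. c * (g t * w t) + c * (cnj (g t) * (zs_b h t / zs_a h t * (zs_b h t / zs_a h t)) * cnj (w t)))"
    by (rule primitive_on_cong[OF pr(1) refl]) (simp add: hh cc algebra_simps)
  show "primitive_on Z (\<lambda>z. 1 / zs_a h z) (\<lambda>t. c * (cnj (g t) * (zs_b h t / zs_a h t * (1 / zs_a h t)) * cnj (w t)))"
    by (rule primitive_on_cong[OF pr(2) refl]) (simp add: hh cc algebra_simps)
qed

text \<open>The phase factor exp (i \<omega> V) has energies at most |\<omega>| K, so it meets the
  requirements on \<open>g\<close> uniformly. The constant \<open>D\<close> is fixed before the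
  trajectory \<open>n\<close> and the oscillation frequency \<open>k\<close>, hence independently of
  the sample and of \<epsilon>.\<close>

lemma transmission_near_one:
  fixes Z K \<theta> \<omega> :: real
  assumes Z: "0 < Z" and K: "0 \<le> K" and \<theta>: "0 < \<theta>" "\<theta> < 1"
  shows "\<exists>D\<ge>0. \<forall>n k p. set_integrable lborel {0..Z} n \<longrightarrow> (\<forall>m. energy Z (osc 0 n) m \<le> K * \<theta> ^ m) \<longrightarrow>
    (\<forall>m. energy Z (osc k n) m \<le> K * \<theta> ^ m) \<longrightarrow>
    norm (1 / zs_a (coupling k \<omega> n) Z - 1) \<le> \<bar>\<omega>\<bar> * ((\<Sum>i<2 ^ p. norm (increment Z (osc k n) p i)) + D * \<theta> ^ p)"
proof -
  have L: "0 \<le> \<bar>\<omega>\<bar> * K" using K by simp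
  obtain D where D: "0 \<le> D" and bd: "\<And>w w' g r q c p. young Z w w' K \<theta> \<Longrightarrow> continuous_on {0..Z} g \<Longrightarrow>
     (\<forall>t\<in>{0..Z}. norm (g t) \<le> 1) \<Longrightarrow> (\<forall>n. energy Z g n \<le> \<bar>\<omega>\<bar> * K) \<Longrightarrow> riccati_pair Z c g w' r q \<Longrightarrow> norm c \<le> \<bar>\<omega>\<bar> \<Longrightarrow>
     norm (q Z - q 0) \<le> \<bar>\<omega>\<bar> * ((\<Sum>i<2 ^ p. norm (increment Z w p i)) + D * \<theta> ^ p)"
    using riccati_transmission_bound[OF K \<theta> L, of "\<bar>\<omega>\<bar>" Z] by (auto 0 3)
  show ?thesis
  proof (intro exI conjI allI impI)
    fix n k p assume n: "set_integrable lborel {0..Z} n" and e0: "\<forall>m. energy Z (osc 0 n) m \<le> K * \<theta> ^ m"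
      and ek: "\<forall>m. energy Z (osc k n) m \<le> K * \<theta> ^ m"
    have y: "young Z (osc k n) (\<lambda>t. iexp (k * t) * complex_of_real (n t)) K \<theta>"
    proof
      show "primitive_on Z (osc k n) (\<lambda>t. iexp (k * t) * complex_of_real (n t))"
        unfolding osc_def[abs_def] by (intro primitive_on_integral set_integrable_osc n)
    qed (use Z \<theta> ek in auto)
    have g: "continuous_on {0..Z} (\<lambda>t. iexp (\<omega> * drift n t))"
      unfolding exp_drift_eq by (rule primitive_on_continuous[OF primitive_on_exp_drift[OF n]])
    have eg: "\<forall>m. energy Z (\<lambda>t. iexp (\<omega> * drift n t)) m \<le> \<bar>\<omega>\<bar> * K"
    proof
      fix m
      have "K * \<theta> ^ m \<le> K * 1" using K \<theta> by (intro mult_left_mono power_le_one) auto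
      hence "\<bar>\<omega>\<bar> * energy Z (osc 0 n) m \<le> \<bar>\<omega>\<bar> * K" using e0[rule_format, of m] by (intro mult_left_mono) auto
      thus "energy Z (\<lambda>t. iexp (\<omega> * drift n t)) m \<le> \<bar>\<omega>\<bar> * K"
        using energy_exp_drift_le[of Z \<omega> n m] by linarith
    qed
    show "norm (1 / zs_a (coupling k \<omega> n) Z - 1) \<le> \<bar>\<omega>\<bar> * ((\<Sum>i<2 ^ p. norm (increment Z (osc k n) p i)) + D * \<theta> ^ p)"
      using bd[OF y g _ eg riccati_pair_coupling[OF n], of p] by (simp add: zs_initial norm_mult)
  qed (rule D)
qed

section \<open>Continuity in the frequency\<close>

lemma norm_set_integral_mono:
  assumes "set_integrable lborel {0..Z} (f :: real \<Rightarrow> complex)" "set_integrable lborel {0..Z} F"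
    "\<And>t. t \<in> {0..Z} \<Longrightarrow> norm (f t) \<le> F t" "z \<in> {0..Z}"
  shows "(LINT t:{0..z}|lborel. norm (f t)) \<le> (LINT t:{0..Z}|lborel. F t)"
  unfolding set_lebesgue_integral_def
proof (rule integral_mono)
  have "set_integrable lborel {0..z} (\<lambda>t. norm (f t))"
    by (rule set_integrable_subset[OF set_integrable_norm[OF assms(1)]]) (use assms(4) in auto)
  thus "integrable lborel (\<lambda>t. indicator {0..z} t *\<^sub>R norm (f t))" unfolding set_integrable_def .
  show "integrable lborel (\<lambda>t. indicator {0..Z} t *\<^sub>R F t)" using assms(2) unfolding set_integrable_def .
  show "indicator {0..z} t *\<^sub>R norm (f t) \<le> indicator {0..Z} t *\<^sub>R F t" for t
    using assms(3)[of t] assms(4) norm_ge_zero[of "f t"] by (auto simp: indicator_def simp del: norm_ge_zero)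
qed

lemma iterint_tendsto:
  assumes h: "\<And>m. set_integrable lborel {0..Z} (h m)" "set_integrable lborel {0..Z} h'"
    and F: "set_integrable lborel {0..Z} F" "\<And>m t. t \<in> {0..Z} \<Longrightarrow> norm (h m t) \<le> F t"
    and lim: "\<And>t. t \<in> {0..Z} \<Longrightarrow> (\<lambda>m. h m t) \<longlonglongrightarrow> h' t" and z: "z \<in> {0..Z}"
  shows "(\<lambda>m. iterint (h m) j z) \<longlonglongrightarrow> iterint h' j z"
  using z
proof (induction j arbitrary: z)
  case (Suc j)
  define X where "X = (LINT t:{0..Z}|lborel. F t)"
  have bd: "norm (iterint (h m) j t) \<le> X ^ j / fact j" if t: "t \<in> {0..Z}" for m t
  proof (rule order_trans[OF norm_iterint_le[OF h(1) t]])
    show "(LINT t:{0..t}|lborel. norm (h m t)) ^ j / fact j \<le> X ^ j / fact j"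
      unfolding X_def set_lebesgue_integral_def[of lborel "{0..t}" "\<lambda>t. norm (h m t)"]
      by (intro divide_right_mono power_mono norm_set_integral_mono[OF h(1) F t, unfolded set_lebesgue_integral_def[of lborel "{0..t}"]]
          Bochner_Integration.integral_nonneg) auto
  qed
  have meas: "(\<lambda>t. indicator {0..z} t *\<^sub>R ((if even j then f t else cnj (f t)) * iterint f j t)) \<in> borel_measurable lborel"
    if "set_integrable lborel {0..Z} f" for f
    using primitive_on_subset_integrable[OF primitive_on_iterint(2)[OF that] Suc.prems, of j]
    unfolding set_integrable_def by (rule borel_measurable_integrable)
  have "(\<lambda>m. LINT t|lborel. indicator {0..z} t *\<^sub>R ((if even j then h m t else cnj (h m t)) * iterint (h m) j t))
    \<longlonglongrightarrow> (LINT t|lborel. indicator {0..z} t *\<^sub>R ((if even j then h' t else cnj (h' t)) * iterint h' j t))"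
  proof (rule integral_dominated_convergence[OF meas[OF h(2)] meas[OF h(1)]])
    have "set_integrable lborel {0..z} (\<lambda>t. F t * (X ^ j / fact j))"
      by (intro set_integrable_mult_left, rule set_integrable_subset[OF F(1)]) (use Suc.prems in auto)
    thus "integrable lborel (\<lambda>t. indicator {0..z} t *\<^sub>R (F t * (X ^ j / fact j)))" unfolding set_integrable_def .
    show "AE t in lborel. (\<lambda>m. indicator {0..z} t *\<^sub>R ((if even j then h m t else cnj (h m t)) * iterint (h m) j t))
      \<longlonglongrightarrow> indicator {0..z} t *\<^sub>R ((if even j then h' t else cnj (h' t)) * iterint h' j t)"
    proof (rule AE_I2)
      fix t
      show "(\<lambda>m. indicator {0..z} t *\<^sub>R ((if even j then h m t else cnj (h m t)) * iterint (h m) j t))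
      \<longlonglongrightarrow> indicator {0..z} t *\<^sub>R ((if even j then h' t else cnj (h' t)) * iterint h' j t)"
      proof (cases "t \<in> {0..z}")
        case True
        hence t: "t \<in> {0..Z}" using Suc.prems by auto
        have "(\<lambda>m. if even j then h m t else cnj (h m t)) \<longlonglongrightarrow> (if even j then h' t else cnj (h' t))"
          using lim[OF t] by (cases "even j") (auto intro: tendsto_cnj)
        thus ?thesis by (intro tendsto_scaleR tendsto_const tendsto_mult Suc.IH t)
      qed simp
    qed
    show "AE t in lborel. norm (indicator {0..z} t *\<^sub>R ((if even j then h m t else cnj (h m t)) * iterint (h m) j t))
      \<le> indicator {0..z} t *\<^sub>R (F t * (X ^ j / fact j))" for m
    proof (rule AE_I2)
      fix t
      show "norm (indicator {0..z} t *\<^sub>R ((if even j then h m t else cnj (h m t)) * iterint (h m) j t))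
        \<le> indicator {0..z} t *\<^sub>R (F t * (X ^ j / fact j))"
      proof (cases "t \<in> {0..z}")
        case True
        hence t: "t \<in> {0..Z}" using Suc.prems by auto
        have "0 \<le> F t" using F(2)[OF t, of 0] norm_ge_zero order_trans by blast
        hence "norm (h m t) * norm (iterint (h m) j t) \<le> F t * (X ^ j / fact j)"
          using F(2)[OF t] bd[OF t] by (intro mult_mono) auto
        thus ?thesis using True by (simp add: norm_mult)
      qed simp
    qed
  qed
  thus ?case unfolding iterint.simps set_lebesgue_integral_def .
qed simp

lemma zs_a_tendsto:
  assumes Z: "0 \<le> Z" and h: "\<And>m. set_integrable lborel {0..Z} (h m)" "set_integrable lborel {0..Z} h'"
    and F: "set_integrable lborel {0..Z} F" "\<And>m t. t \<in> {0..Z} \<Longrightarrow> norm (h m t) \<le> F t"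
    and lim: "\<And>t. t \<in> {0..Z} \<Longrightarrow> (\<lambda>m. h m t) \<longlonglongrightarrow> h' t"
  shows "(\<lambda>m. zs_a (h m) Z) \<longlonglongrightarrow> zs_a h' Z"
proof -
  define X where "X = (LINT t:{0..Z}|lborel. F t)"
  have ZZ: "Z \<in> {0..Z}" using Z by simp
  have "norm (iterint (h m) (2 * k) Z) \<le> (X\<^sup>2) ^ k / fact k" for m k
    unfolding X_def by (intro norm_iterint_even_odd_le[OF h(1) ZZ] norm_set_integral_mono[OF h(1) F ZZ])
  hence "\<forall>\<^sub>F (k, m) in at_top \<times>\<^sub>F sequentially. norm (iterint (h m) (2 * k) Z) \<le> (X\<^sup>2) ^ k / fact k"
    by (intro always_eventually) auto
  from tannerys_theorem[OF iterint_tendsto[OF h F lim ZZ] this summable_power_div_fact]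
  show ?thesis unfolding zs_a_def by simp
qed

lemma norm_coupling: "norm (coupling k \<omega> n t) = \<bar>\<omega>\<bar> / 2 * \<bar>n t\<bar>"
  unfolding coupling_def by (simp add: norm_mult)

text \<open>By \<open>transmission_coeff_eq\<close>, the conjugate of the transmission coefficient
  with the phase exp (i \<omega> V(Z) / 2) divided out.\<close>

definition reduced_transmission :: "real \<Rightarrow> real \<Rightarrow> real \<Rightarrow> (real \<Rightarrow> real) \<Rightarrow> real \<Rightarrow> complex" where
  "reduced_transmission Z \<tau> \<epsilon> n \<omega> = 1 / zs_a (coupling (2 * \<omega> / \<epsilon> powr \<tau>) \<omega> n) Z"

lemma norm_reduced_transmission_le:
  assumes "0 \<le> Z" "set_integrable lborel {0..Z} n"
  shows "norm (reduced_transmission Z \<tau> \<epsilon> n \<omega>) \<le> 1"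
  unfolding reduced_transmission_def using zs_norms(1)[OF set_integrable_coupling[OF assms(2)], of Z] assms(1)
  by (auto simp: norm_divide divide_le_eq_1)

text \<open>This continuity is the source of measurability, both jointly in frequency and sample and
  of the wave as a random function. The path is fixed here, so its own L1 norm may be used for
  domination.\<close>

lemma isCont_reduced_transmission:
  assumes Z: "0 \<le> Z" and n: "set_integrable lborel {0..Z} n"
  shows "isCont (reduced_transmission Z \<tau> \<epsilon> n) \<omega>"
  unfolding continuous_at_sequentially
proof (intro allI impI)
  fix x assume x: "x \<longlonglongrightarrow> \<omega>"
  then obtain B where B: "\<And>m. \<bar>x m\<bar> \<le> B" using convergent_imp_Bseq[OF convergentI[OF x]]
    unfolding Bseq_def by (auto simp: real_norm_def)
  have "(\<lambda>m. zs_a (coupling (2 * x m / \<epsilon> powr \<tau>) (x m) n) Z) \<longlonglongrightarrow> zs_a (coupling (2 * \<omega> / \<epsilon> powr \<tau>) \<omega> n) Z"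
  proof (rule zs_a_tendsto[OF Z set_integrable_coupling[OF n] set_integrable_coupling[OF n], where F="\<lambda>t. B / 2 * \<bar>n t\<bar>"])
    show "set_integrable lborel {0..Z} (\<lambda>t. B / 2 * \<bar>n t\<bar>)"
      using set_integrable_abs[OF n] by (rule set_integrable_mult_right)
    show "norm (coupling (2 * x m / \<epsilon> powr \<tau>) (x m) n t) \<le> B / 2 * \<bar>n t\<bar>" for m t
      unfolding norm_coupling using B[of m] by (intro mult_right_mono) auto
    show "(\<lambda>m. coupling (2 * x m / \<epsilon> powr \<tau>) (x m) n t) \<longlonglongrightarrow> coupling (2 * \<omega> / \<epsilon> powr \<tau>) \<omega> n t" for t
    proof -
      have "(\<lambda>m. 2 * x m * inverse (\<epsilon> powr \<tau>)) \<longlonglongrightarrow> 2 * \<omega> * inverse (\<epsilon> powr \<tau>)"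
        by (intro tendsto_intros x)
      moreover define y where "y = (\<lambda>m. 2 * x m / \<epsilon> powr \<tau>)"
      moreover define \<eta> where "\<eta> = 2 * \<omega> / \<epsilon> powr \<tau>"
      ultimately have y: "y \<longlonglongrightarrow> \<eta>" unfolding divide_inverse by simp
      show ?thesis unfolding coupling_def \<eta>_def[symmetric] fun_cong[OF y_def, symmetric] by (intro tendsto_intros x y) auto
    qed
  qed
  thus "(reduced_transmission Z \<tau> \<epsilon> n \<circ> x) \<longlonglongrightarrow> reduced_transmission Z \<tau> \<epsilon> n \<omega>"
    unfolding reduced_transmission_def o_def
    using zs_norms(3)[OF set_integrable_coupling[OF n], of Z] Z by (intro tendsto_intros) auto
qed

section \<open>Random media\<close>

text \<open>Joint measurability is given on \<open>{0..Z}\<close> alone. Composing with the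
  projection of the line onto this interval before cutting off extends it to the line, where
  Fubini's theorem is applied.\<close>

lemma borel_measurable_clamped_process:
  fixes \<nu> :: "real \<Rightarrow> 'a \<Rightarrow> real"
  assumes m: "(\<lambda>(z, x). \<nu> z x) \<in> borel_measurable (restrict_space borel {0..Z} \<Otimes>\<^sub>M M)" and Z: "0 \<le> Z"
  shows "(\<lambda>(z, x). indicator {0..Z} z *\<^sub>R \<nu> z x) \<in> borel_measurable (borel \<Otimes>\<^sub>M M)"
proof -
  define cl where "cl z = max 0 (min Z z)" for z :: real
  have "cl \<in> measurable borel (restrict_space borel {0..Z})"
    unfolding cl_def[abs_def] by (rule measurable_restrict_space2) (use Z in auto)
  hence "(\<lambda>p. (cl (fst p), snd p)) \<in> measurable (borel \<Otimes>\<^sub>M M) (restrict_space borel {0..Z} \<Otimes>\<^sub>M M)"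
    by measurable
  from measurable_compose[OF this m]
  have [measurable]: "(\<lambda>p. \<nu> (cl (fst p)) (snd p)) \<in> borel_measurable (borel \<Otimes>\<^sub>M M)" by simp
  have "(\<lambda>p. indicator {0..Z} (fst p) *\<^sub>R \<nu> (cl (fst p)) (snd p)) \<in> borel_measurable (borel \<Otimes>\<^sub>M M)"
    by measurable
  also have "(\<lambda>p. indicator {0..Z} (fst p) *\<^sub>R \<nu> (cl (fst p)) (snd p)) = (\<lambda>(z, x). indicator {0..Z} z *\<^sub>R \<nu> z x)"
    by (auto simp: fun_eq_iff indicator_def cl_def)
  finally show ?thesis .
qed

locale medium = prob_space M for M :: "'a measure" +
  fixes Z :: real and \<nu> :: "real \<Rightarrow> 'a \<Rightarrow> real"
  assumes Z: "0 < Z" and medium: "centered_medium_process Z M \<nu>"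
begin

lemma path: "x \<in> space M \<Longrightarrow> set_integrable lborel {0..Z} (\<lambda>z. \<nu> z x)"
  using medium unfolding centered_medium_process_def by auto

lemma \<nu>_joint [measurable]: "(\<lambda>(z, x). indicator {0..Z} z * \<nu> z x) \<in> borel_measurable (borel \<Otimes>\<^sub>M M)"
  using borel_measurable_clamped_process[of \<nu> Z M] medium Z unfolding centered_medium_process_def by simp

text \<open>A parameter integral with a variable upper limit is again jointly measurable. This form
  can be iterated, which \<open>iterint_joint\<close> does.\<close>

lemma borel_measurable_path_integral:
  assumes f: "(\<lambda>(z, x). indicator {0..Z} z *\<^sub>R (f x z :: complex)) \<in> borel_measurable (borel \<Otimes>\<^sub>M M)"
  shows "(\<lambda>(z, x). indicator {0..Z} z *\<^sub>R (LINT t:{0..z}|lborel. f x t)) \<in> borel_measurable (borel \<Otimes>\<^sub>M M)"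
proof -
  have [measurable]: "(\<lambda>p. indicator {0..Z} (fst p) *\<^sub>R f (snd p) (fst p)) \<in> borel_measurable (borel \<Otimes>\<^sub>M M)"
    using f by (simp add: case_prod_unfold)
  have [measurable]: "(\<lambda>q. indicator {0..Z} (snd q) *\<^sub>R f (snd (fst q)) (snd q)) \<in> borel_measurable ((borel \<Otimes>\<^sub>M M) \<Otimes>\<^sub>M lborel)"
  proof -
    have "(\<lambda>q. (snd q, snd (fst q))) \<in> measurable ((borel \<Otimes>\<^sub>M M) \<Otimes>\<^sub>M lborel) (borel \<Otimes>\<^sub>M M)" by measurable
    from measurable_compose[OF this, of "\<lambda>p. indicator {0..Z} (fst p) *\<^sub>R f (snd p) (fst p)" borel] show ?thesis by simp
  qed
  have [measurable]: "(\<lambda>q. indicator {0..fst (fst q)} (snd q :: real) :: real) \<in> borel_measurable ((borel \<Otimes>\<^sub>M M) \<Otimes>\<^sub>M lborel)"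
    unfolding indicator_def atLeastAtMost_iff by measurable
  have "(\<lambda>p. indicator {0..Z} (fst p) *\<^sub>R (LINT t|lborel. indicator {0..fst p} t *\<^sub>R (indicator {0..Z} t *\<^sub>R f (snd p) t)))
     \<in> borel_measurable (borel \<Otimes>\<^sub>M M)"
  proof (intro borel_measurable_scaleR lborel.borel_measurable_lebesgue_integral)
    show "(\<lambda>(p, t). indicator {0..fst p} t *\<^sub>R (indicator {0..Z} t *\<^sub>R f (snd p) t)) \<in> borel_measurable ((borel \<Otimes>\<^sub>M M) \<Otimes>\<^sub>M lborel)"
      unfolding case_prod_unfold by measurable
  qed measurable
  also have "(\<lambda>p. indicator {0..Z} (fst p) *\<^sub>R (LINT t|lborel. indicator {0..fst p} t *\<^sub>R (indicator {0..Z} t *\<^sub>R f (snd p) t)))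
    = (\<lambda>(z, x). indicator {0..Z} z *\<^sub>R (LINT t:{0..z}|lborel. f x t))"
  proof (intro ext, clarify)
    fix z x
    have "(LINT t|lborel. indicator {0..z} t *\<^sub>R (indicator {0..Z} t *\<^sub>R f x t)) = (LINT t|lborel. indicator {0..z} t *\<^sub>R f x t)"
      if "z \<in> {0..Z}" using that by (intro Bochner_Integration.integral_cong) (auto simp: indicator_def)
    thus "indicator {0..Z} (fst (z, x)) *\<^sub>R (LINT t|lborel. indicator {0..fst (z, x)} t *\<^sub>R (indicator {0..Z} t *\<^sub>R f (snd (z, x)) t))
      = indicator {0..Z} z *\<^sub>R (LINT t:{0..z}|lborel. f x t)"
      unfolding set_lebesgue_integral_def by (cases "z \<in> {0..Z}") auto
  qed
  finally show ?thesis .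
qed

lemma borel_measurable_section:
  assumes f: "(\<lambda>(z, x). indicator {0..Z} z *\<^sub>R (f x z :: complex)) \<in> borel_measurable (borel \<Otimes>\<^sub>M M)" and z: "z \<in> {0..Z}"
  shows "(\<lambda>x. f x z) \<in> borel_measurable M"
proof -
  have "(\<lambda>x. (z, x)) \<in> measurable M (borel \<Otimes>\<^sub>M M)" by measurable
  from measurable_compose[OF this f] show ?thesis using z by simp
qed

lemma indicator_prod_measurable:
  assumes f: "(\<lambda>(z, x). indicator {0..Z} z *\<^sub>R (f x z :: complex)) \<in> borel_measurable (borel \<Otimes>\<^sub>M M)"
    and g: "(\<lambda>(z, x). indicator {0..Z} z *\<^sub>R (g x z :: complex)) \<in> borel_measurable (borel \<Otimes>\<^sub>M M)"
  shows "(\<lambda>(z, x). indicator {0..Z} z *\<^sub>R (f x z * g x z)) \<in> borel_measurable (borel \<Otimes>\<^sub>M M)"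
proof -
  have "(\<lambda>p. (indicator {0..Z} (fst p) *\<^sub>R f (snd p) (fst p)) * (indicator {0..Z} (fst p) *\<^sub>R g (snd p) (fst p))) \<in> borel_measurable (borel \<Otimes>\<^sub>M M)"
    using f g by (intro borel_measurable_times) (simp_all add: case_prod_unfold)
  also have "(\<lambda>p. (indicator {0..Z} (fst p) *\<^sub>R f (snd p) (fst p)) * (indicator {0..Z} (fst p) *\<^sub>R g (snd p) (fst p)))
    = (\<lambda>(z, x). indicator {0..Z} z *\<^sub>R (f x z * g x z))" by (auto simp: fun_eq_iff indicator_def)
  finally show ?thesis .
qed

lemma osc_density_measurable:
  "(\<lambda>(z, x). indicator {0..Z} z *\<^sub>R (iexp (k * z) * complex_of_real (\<nu> z x))) \<in> borel_measurable (borel \<Otimes>\<^sub>M M)"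
proof -
  have "(\<lambda>p. iexp (k * fst p) * complex_of_real ((\<lambda>(z, x). indicator {0..Z} z * \<nu> z x) p)) \<in> borel_measurable (borel \<Otimes>\<^sub>M M)"
    by measurable
  also have "(\<lambda>p. iexp (k * fst p) * complex_of_real ((\<lambda>(z, x). indicator {0..Z} z * \<nu> z x) p))
    = (\<lambda>(z, x). indicator {0..Z} z *\<^sub>R (iexp (k * z) * complex_of_real (\<nu> z x)))"
    by (auto simp: fun_eq_iff indicator_def)
  finally show ?thesis .
qed

lemma osc_joint: "(\<lambda>(z, x). indicator {0..Z} z *\<^sub>R osc k (\<lambda>z. \<nu> z x) z) \<in> borel_measurable (borel \<Otimes>\<^sub>M M)"
  unfolding osc_def by (rule borel_measurable_path_integral[OF osc_density_measurable])

lemma borel_measurable_osc: "z \<in> {0..Z} \<Longrightarrow> (\<lambda>x. osc k (\<lambda>z. \<nu> z x) z) \<in> borel_measurable M"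
  by (rule borel_measurable_section[OF osc_joint])

lemma coupling_joint:
  "(\<lambda>(z, x). indicator {0..Z} z *\<^sub>R coupling k \<omega> (\<lambda>z. \<nu> z x) z) \<in> borel_measurable (borel \<Otimes>\<^sub>M M)"
proof -
  have "(\<lambda>p. indicator {0..Z} (fst p) *\<^sub>R (\<i> * complex_of_real \<omega> / 2 *
     exp (\<i> * complex_of_real \<omega> * ((\<lambda>(z, x). indicator {0..Z} z *\<^sub>R osc 0 (\<lambda>z. \<nu> z x) z) p)))) \<in> borel_measurable (borel \<Otimes>\<^sub>M M)"
    using osc_joint[of 0] by measurable
  also have "(\<lambda>p. indicator {0..Z} (fst p) *\<^sub>R (\<i> * complex_of_real \<omega> / 2 *
     exp (\<i> * complex_of_real \<omega> * ((\<lambda>(z, x). indicator {0..Z} z *\<^sub>R osc 0 (\<lambda>z. \<nu> z x) z) p))))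
    = (\<lambda>(z, x). indicator {0..Z} z *\<^sub>R (\<i> * complex_of_real \<omega> / 2 * iexp (\<omega> * drift (\<lambda>z. \<nu> z x) z)))"
    unfolding exp_drift_eq osc_0 by (auto simp: fun_eq_iff indicator_def)
  finally have "(\<lambda>(z, x). indicator {0..Z} z *\<^sub>R (\<i> * complex_of_real \<omega> / 2 * iexp (\<omega> * drift (\<lambda>z. \<nu> z x) z)))
    \<in> borel_measurable (borel \<Otimes>\<^sub>M M)" .
  from indicator_prod_measurable[where f="\<lambda>x z. \<i> * complex_of_real \<omega> / 2 * iexp (\<omega> * drift (\<lambda>z. \<nu> z x) z)",
    OF this osc_density_measurable[of k]]
  show ?thesis unfolding coupling_def by (simp only: mult.assoc)
qed

lemma iterint_joint:
  "(\<lambda>(z, x). indicator {0..Z} z *\<^sub>R iterint (coupling k \<omega> (\<lambda>z. \<nu> z x)) j z) \<in> borel_measurable (borel \<Otimes>\<^sub>M M)"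
proof (induction j)
  case 0
  have "(\<lambda>p. indicator {0..Z} (fst p) *\<^sub>R (1::complex)) \<in> borel_measurable (borel \<Otimes>\<^sub>M M)" by measurable
  thus ?case by (simp add: case_prod_unfold)
next
  case (Suc j)
  have "(\<lambda>(z, x). indicator {0..Z} z *\<^sub>R cnj (coupling k \<omega> (\<lambda>z. \<nu> z x) z)) \<in> borel_measurable (borel \<Otimes>\<^sub>M M)"
  proof -
    have "(\<lambda>p. cnj ((\<lambda>(z, x). indicator {0..Z} z *\<^sub>R coupling k \<omega> (\<lambda>z. \<nu> z x) z) p)) \<in> borel_measurable (borel \<Otimes>\<^sub>M M)"
      using borel_measurable_continuous_onI[OF continuous_on_cnj[OF continuous_on_id]]
      by (intro measurable_compose[OF coupling_joint]) auto
    also have "(\<lambda>p. cnj ((\<lambda>(z, x). indicator {0..Z} z *\<^sub>R coupling k \<omega> (\<lambda>z. \<nu> z x) z) p))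
      = (\<lambda>(z, x). indicator {0..Z} z *\<^sub>R cnj (coupling k \<omega> (\<lambda>z. \<nu> z x) z))" by (auto simp: fun_eq_iff indicator_def)
    finally show ?thesis .
  qed
  hence "(\<lambda>(z, x). indicator {0..Z} z *\<^sub>R ((if even j then coupling k \<omega> (\<lambda>z. \<nu> z x) z else cnj (coupling k \<omega> (\<lambda>z. \<nu> z x) z))
     * iterint (coupling k \<omega> (\<lambda>z. \<nu> z x)) j z)) \<in> borel_measurable (borel \<Otimes>\<^sub>M M)"
    using coupling_joint by (intro indicator_prod_measurable Suc.IH) (cases "even j"; simp)
  thus ?case unfolding iterint.simps by (rule borel_measurable_path_integral)
qed

lemma borel_measurable_reduced_transmission:
  "(\<lambda>x. reduced_transmission Z \<tau> \<epsilon> (\<lambda>z. \<nu> z x) \<omega>) \<in> borel_measurable M"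
proof -
  have [measurable]: "(\<lambda>x. iterint (coupling k \<omega> (\<lambda>z. \<nu> z x)) j Z) \<in> borel_measurable M" for k j
    using borel_measurable_section[OF iterint_joint] Z by simp
  show ?thesis unfolding reduced_transmission_def zs_a_def by measurable
qed

end

section \<open>Oscillatory integrals and second moments\<close>

text \<open>A shift by the half period pi / k reverses the sign of the exponential, so twice the
  integral is bounded by the L1 distance between \<open>f\<close> and its translate. Almost
  everywhere continuity gives pointwise convergence of the translates, and, as translation preserves
  the L1 norm, Scheffe's lemma upgrades it to L1.\<close>

lemma riemann_lebesgue_cont_AE:
  fixes f :: "real \<Rightarrow> complex"
  assumes f: "integrable lborel f" and cont: "AE t in lborel. isCont f t"
    and k: "filterlim (\<lambda>n. \<bar>k n :: real\<bar>) at_top sequentially"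
  shows "(\<lambda>n. LINT t|lborel. iexp (k n * t) * f t) \<longlonglongrightarrow> 0"
proof -
  define d where "d n = pi / k n" for n
  have d0: "d \<longlonglongrightarrow> 0"
  proof -
    have "(\<lambda>n. pi / \<bar>k n\<bar>) \<longlonglongrightarrow> 0"
      by (rule real_tendsto_divide_at_top[OF tendsto_const k])
    hence "(\<lambda>n. \<bar>d n\<bar>) \<longlonglongrightarrow> 0" unfolding d_def by simp
    thus ?thesis by (rule tendsto_rabs_zero_cancel)
  qed
  have fd: "integrable lborel (\<lambda>t. f (d n + t))" for n
    using lborel_integrable_real_affine[OF f, of 1 "d n"] by simp
  have "(\<lambda>n. \<integral>\<^sup>+ t. norm (f (d n + t) - f t) \<partial>lborel) \<longlonglongrightarrow> 0"
  proof (rule Scheffe_lemma1[OF fd f])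
    show "AE t in lborel. (\<lambda>n. f (d n + t)) \<longlonglongrightarrow> f t"
      using cont
    proof eventually_elim
      fix t assume c: "isCont f t"
      have "(\<lambda>n. d n + t) \<longlonglongrightarrow> t" using tendsto_add[OF d0 tendsto_const[of t]] by simp
      thus "(\<lambda>n. f (d n + t)) \<longlonglongrightarrow> f t" by (rule isCont_tendsto_compose[OF c])
    qed
    have [measurable]: "f \<in> borel_measurable borel" using f by auto
    have "(\<integral>\<^sup>+ t. norm (f (d n + t)) \<partial>lborel) = (\<integral>\<^sup>+ t. norm (f t) \<partial>lborel)" for n
      using nn_integral_real_affine[of "\<lambda>t. ennreal (norm (f t))" 1 "d n"] by simp
    thus "limsup (\<lambda>n. \<integral>\<^sup>+ t. norm (f (d n + t)) \<partial>lborel) \<le> (\<integral>\<^sup>+ t. norm (f t) \<partial>lborel)"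
      by (simp add: Limsup_const)
  qed
  moreover have "ennreal (norm (2 * (LINT t|lborel. iexp (k n * t) * f t)))
      \<le> (\<integral>\<^sup>+ t. norm (f (d n + t) - f t) \<partial>lborel)" if kn: "k n \<noteq> 0" for n
  proof -
    have [measurable]: "f \<in> borel_measurable borel" using f by auto
    have bi: "integrable lborel (\<lambda>t. iexp (k n * t) * g t)" if "integrable lborel g" for g :: "real \<Rightarrow> complex"
    proof (rule Bochner_Integration.integrable_bound[OF that])
      show "(\<lambda>t. iexp (k n * t) * g t) \<in> borel_measurable lborel" using that by auto
    qed (simp add: norm_mult)
    have shift: "iexp (k n * (d n + t)) = - iexp (k n * t)" for t
    proof -
      have "\<i> * complex_of_real (k n * (d n + t)) = \<i> * complex_of_real pi + \<i> * complex_of_real (k n * t)"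
        using kn unfolding d_def by (simp add: field_simps)
      thus ?thesis by (simp only: exp_add) simp
    qed
    have "(LINT t|lborel. iexp (k n * t) * f t)
       = (LINT t|lborel. iexp (k n * (d n + t)) * f (d n + t))"
      using lborel_integral_real_affine[of 1 "\<lambda>t. iexp (k n * t) * f t" "d n"] by simp
    also have "\<dots> = - (LINT t|lborel. iexp (k n * t) * f (d n + t))"
      unfolding shift by simp
    finally have "2 * (LINT t|lborel. iexp (k n * t) * f t)
       = (LINT t|lborel. iexp (k n * t) * f t) - (LINT t|lborel. iexp (k n * t) * f (d n + t))"
      by simp
    also have "\<dots> = (LINT t|lborel. iexp (k n * t) * (f t - f (d n + t)))"
      unfolding right_diff_distrib by (rule Bochner_Integration.integral_diff[symmetric, OF bi[OF f] bi[OF fd]])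
    finally have e: "2 * (LINT t|lborel. iexp (k n * t) * f t)
      = (LINT t|lborel. iexp (k n * t) * (f t - f (d n + t)))" .
    have "ennreal (norm (LINT t|lborel. iexp (k n * t) * (f t - f (d n + t))))
       \<le> (\<integral>\<^sup>+ t. norm (iexp (k n * t) * (f t - f (d n + t))) \<partial>lborel)"
      by (intro integral_norm_bound_ennreal bi Bochner_Integration.integrable_diff f fd)
    thus ?thesis unfolding e by (simp add: norm_mult norm_minus_commute)
  qed
  moreover have "\<forall>\<^sub>F n in sequentially. k n \<noteq> 0"
    using filterlim_at_top_dense[THEN iffD1, OF k, rule_format, of 0] by eventually_elim auto
  ultimately have ev: "\<forall>\<^sub>F n in sequentially. ennreal (norm (2 * (LINT t|lborel. iexp (k n * t) * f t)))
      \<le> (\<integral>\<^sup>+ t. norm (f (d n + t) - f t) \<partial>lborel)" and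
    lim: "(\<lambda>n. \<integral>\<^sup>+ t. norm (f (d n + t) - f t) \<partial>lborel) \<longlonglongrightarrow> 0"
    by (auto elim: eventually_mono)
  have "(\<lambda>n. ennreal (norm (2 * (LINT t|lborel. iexp (k n * t) * f t)))) \<longlonglongrightarrow> 0"
    by (rule tendsto_sandwich[OF always_eventually[OF allI[OF zero_le]] ev tendsto_const lim])
  hence "(\<lambda>n. norm (2 * (LINT t|lborel. iexp (k n * t) * f t))) \<longlonglongrightarrow> 0"
    by (subst (asm) ennreal_tendsto_0_iff) auto
  hence "(\<lambda>n. 2 * (LINT t|lborel. iexp (k n * t) * f t)) \<longlonglongrightarrow> 0"
    by (rule tendsto_norm_zero_cancel)
  from tendsto_mult[OF tendsto_const[of "1/2"] this]
  show ?thesis by simp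
qed

section \<open>The weakly singular kernel on a square\<close>

lemma nn_integral_powr_Icc:
  fixes \<gamma> d :: real
  assumes "\<gamma> < 1" "0 \<le> d"
  shows "(\<integral>\<^sup>+ u. ennreal (indicator {-d..d} u * \<bar>u\<bar> powr (- \<gamma>)) \<partial>lborel) = ennreal (2 * (d powr (1 - \<gamma>) / (1 - \<gamma>)))"
proof -
  define I where "I = d powr (1 - \<gamma>) / (1 - \<gamma>)"
  define f where "f u = indicator {0..d} u * u powr (- \<gamma>)" for u :: real
  have fm [measurable]: "f \<in> borel_measurable borel" unfolding f_def by measurable
  have I0: "0 \<le> I" unfolding I_def using assms by simp
  have "((\<lambda>x. x powr (- \<gamma>)) has_integral I) {0..d}"
    using has_integral_powr_from_0[of "- \<gamma>" d] assms by (simp add: I_def add.commute)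
  hence "((\<lambda>x. if x \<in> {0..d} then x powr (- \<gamma>) else 0) has_integral I) UNIV"
    by (simp only: has_integral_restrict_UNIV)
  also have "(\<lambda>x. if x \<in> {0..d} then x powr (- \<gamma>) else 0) = f" by (auto simp: f_def fun_eq_iff)
  finally have nf: "(\<integral>\<^sup>+ u. ennreal (f u) \<partial>lborel) = ennreal I"
    by (intro nn_integral_has_integral_lborel fm) (auto simp: f_def)
  have nf': "(\<integral>\<^sup>+ u. ennreal (f (- u)) \<partial>lborel) = ennreal I"
    using nn_integral_real_affine[of "\<lambda>u. ennreal (f u)" "-1" 0] nf by simp
  have "(\<integral>\<^sup>+ u. ennreal (indicator {-d..d} u * \<bar>u\<bar> powr (- \<gamma>)) \<partial>lborel) = (\<integral>\<^sup>+ u. ennreal (f u) + ennreal (f (- u)) \<partial>lborel)"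
  proof (rule nn_integral_cong_AE)
    show "AE u in lborel. ennreal (indicator {-d..d} u * \<bar>u\<bar> powr (- \<gamma>)) = ennreal (f u) + ennreal (f (- u))"
      using AE_lborel_singleton[of 0] by eventually_elim (auto simp: f_def indicator_def)
  qed
  also have "\<dots> = ennreal I + ennreal I" using nf nf' by (subst nn_integral_add) auto
  also have "\<dots> = ennreal (2 * I)" using I0 by (simp flip: ennreal_plus)
  finally show ?thesis unfolding I_def .
qed

abbreviation lborel2 :: "(real \<times> real) measure" where
  "lborel2 \<equiv> lborel \<Otimes>\<^sub>M lborel"

lemma AE_off_diagonal: "AE p in lborel2. fst p \<noteq> snd p"
proof (rule lborel_pair.AE_pair_measure)
  show "{p \<in> space lborel2. fst p \<noteq> snd p} \<in> sets lborel2"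
    by measurable
  have "AE y in lborel. x \<noteq> y" for x :: real
    using AE_lborel_singleton[of x] by eventually_elim auto
  thus "AE x in lborel. AE y in lborel. fst (x, y) \<noteq> (snd (x, y) :: real)" by simp
qed

definition kern :: "real \<Rightarrow> real \<Rightarrow> real \<Rightarrow> real \<times> real \<Rightarrow> real" where
  "kern \<gamma> a b p = indicator {a..b} (fst p) * indicator {a..b} (snd p) * \<bar>fst p - snd p\<bar> powr (- \<gamma>)"

lemma kern_nonneg: "0 \<le> kern \<gamma> a b p"
  by (simp add: kern_def)

lemma kern_measurable [measurable]: "kern \<gamma> a b \<in> borel_measurable lborel2"
  unfolding kern_def[abs_def] by measurable

text \<open>For fixed first variable, the second one ranges within distance \<open>b - a\<close> of
  the singularity, which costs a power 1 - \<gamma>; the first variable adds a power 1. The total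
  exponent 2 - \<gamma> exceeds 1, and this excess is the whole source of the regularity above
  1/2.\<close>

lemma nn_integral_kern_le:
  assumes \<gamma>: "\<gamma> < 1" and ab: "a \<le> b"
  shows "(\<integral>\<^sup>+ p. ennreal (kern \<gamma> a b p) \<partial>lborel2) \<le> ennreal (2 / (1 - \<gamma>) * (b - a) powr (2 - \<gamma>))"
proof -
  define X where "X = 2 * ((b - a) powr (1 - \<gamma>) / (1 - \<gamma>))"
  have inner: "(\<integral>\<^sup>+ t2. ennreal (kern \<gamma> a b (t1, t2)) \<partial>lborel) \<le> ennreal X * indicator {a..b} t1" for t1
  proof -
    have "(\<integral>\<^sup>+ t2. ennreal (kern \<gamma> a b (t1, t2)) \<partial>lborel)
      = (\<integral>\<^sup>+ u. ennreal (kern \<gamma> a b (t1, t1 + u)) \<partial>lborel)"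
      using nn_integral_real_affine[of "\<lambda>t2. ennreal (kern \<gamma> a b (t1, t2))" 1 t1] by simp
    also have "\<dots> \<le> (\<integral>\<^sup>+ u. indicator {a..b} t1 * ennreal (indicator {- (b - a)..b - a} u * \<bar>u\<bar> powr (- \<gamma>)) \<partial>lborel)"
      by (intro nn_integral_mono) (auto simp: kern_def indicator_def)
    also have "\<dots> = indicator {a..b} t1 * ennreal X"
      unfolding X_def using ab by (subst nn_integral_cmult) (measurable, simp only: nn_integral_powr_Icc[OF \<gamma>] diff_ge_0_iff_ge)
    finally show ?thesis by (simp add: mult.commute)
  qed
  have "(\<integral>\<^sup>+ p. ennreal (kern \<gamma> a b p) \<partial>lborel2) = (\<integral>\<^sup>+ t1. \<integral>\<^sup>+ t2. ennreal (kern \<gamma> a b (t1, t2)) \<partial>lborel \<partial>lborel)"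
    by (rule lborel.nn_integral_fst[symmetric]) measurable
  also have "\<dots> \<le> (\<integral>\<^sup>+ t1. ennreal X * indicator {a..b} t1 \<partial>lborel)"
    by (intro nn_integral_mono inner)
  also have "\<dots> = ennreal X * ennreal (b - a)" using ab by (subst nn_integral_cmult) auto
  also have "\<dots> = ennreal (X * (b - a))" using ab \<gamma> by (subst ennreal_mult) (auto simp: X_def)
  also have "X * (b - a) = 2 / (1 - \<gamma>) * (b - a) powr (2 - \<gamma>)"
  proof (cases "b = a")
    case False
    hence "(b - a) powr (2 - \<gamma>) = (b - a) powr (1 - \<gamma>) * (b - a) powr 1"
      unfolding powr_add[symmetric] by simp
    thus ?thesis using False ab by (simp add: X_def)
  qed (simp add: X_def)
  finally show ?thesis .
qed

lemma integrable_kern: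
  assumes "\<gamma> < 1" "a \<le> b"
  shows "integrable lborel2 (kern \<gamma> a b)"
proof (rule integrableI_bounded)
  show "(\<integral>\<^sup>+ p. ennreal (norm (kern \<gamma> a b p)) \<partial>lborel2) < \<infinity>"
    using nn_integral_kern_le[OF assms] kern_nonneg[of \<gamma> a b] by (auto simp: le_less_trans top_unique)
qed measurable

lemma integral_kern_le:
  assumes "\<gamma> < 1" "a \<le> b"
  shows "(LINT p|lborel2. kern \<gamma> a b p) \<le> 2 / (1 - \<gamma>) * (b - a) powr (2 - \<gamma>)"
  using nn_integral_kern_le[OF assms] assms kern_nonneg
  by (subst (asm) nn_integral_eq_integral[OF integrable_kern[OF assms]]) (auto simp: ennreal_le_iff)

section \<open>Covariances and second moments of oscillating integrals\<close>

context medium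
begin

definition cov :: "real \<Rightarrow> real \<Rightarrow> real" where
  "cov t1 t2 = (\<integral>x. \<nu> t1 x * \<nu> t2 x \<partial>M)"

lemma \<nu>_measurable: "t \<in> {0..Z} \<Longrightarrow> \<nu> t \<in> borel_measurable M"
  and \<nu>_square_integrable: "t \<in> {0..Z} \<Longrightarrow> integrable M (\<lambda>x. (\<nu> t x)\<^sup>2)"
  using medium unfolding centered_medium_process_def by auto

lemma cov_measurable [measurable]:
  "(\<lambda>p. indicator {0..Z} (fst p) * indicator {0..Z} (snd p) * cov (fst p) (snd p)) \<in> borel_measurable lborel2"
proof -
  have m1: "(\<lambda>q. (\<lambda>(z, x). indicator {0..Z} z * \<nu> z x) (fst (fst q), snd q)) \<in> borel_measurable (lborel2 \<Otimes>\<^sub>M M)"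
    by (rule measurable_compose[OF _ \<nu>_joint]) measurable
  have m2: "(\<lambda>q. (\<lambda>(z, x). indicator {0..Z} z * \<nu> z x) (snd (fst q), snd q)) \<in> borel_measurable (lborel2 \<Otimes>\<^sub>M M)"
    by (rule measurable_compose[OF _ \<nu>_joint]) measurable
  have "(\<lambda>p. \<integral>x. (indicator {0..Z} (fst p) * \<nu> (fst p) x) * (indicator {0..Z} (snd p) * \<nu> (snd p) x) \<partial>M) \<in> borel_measurable lborel2"
    by (rule borel_measurable_lebesgue_integral) (use borel_measurable_times[OF m1 m2] in \<open>simp add: case_prod_unfold\<close>)
  also have "(\<lambda>p. \<integral>x. (indicator {0..Z} (fst p) * \<nu> (fst p) x) * (indicator {0..Z} (snd p) * \<nu> (snd p) x) \<partial>M)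
    = (\<lambda>p. indicator {0..Z} (fst p) * indicator {0..Z} (snd p) * cov (fst p) (snd p))"
    by (auto simp: fun_eq_iff cov_def indicator_def)
  finally show ?thesis .
qed

end

text \<open>\<open>C\<close> and \<gamma> are parameters because they will be common to all
  \<epsilon>: whatever is built from them and \<open>Z\<close> alone is automatically
  uniform.\<close>

locale medium_bound = medium +
  fixes C \<gamma> :: real
  assumes \<gamma>: "\<gamma> < 1" and C: "0 \<le> C"
    and cov_bound: "\<And>t1 t2. t1 \<in> {0..Z} \<Longrightarrow> t2 \<in> {0..Z} \<Longrightarrow> t1 \<noteq> t2 \<Longrightarrow> \<bar>cov t1 t2\<bar> \<le> C * \<bar>t1 - t2\<bar> powr (- \<gamma>)"
begin

definition osc_cov :: "real \<Rightarrow> real \<Rightarrow> real \<Rightarrow> real \<times> real \<Rightarrow> complex" where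
  "osc_cov k a b p = iexp (k * (fst p - snd p)) *
     complex_of_real (indicator {a..b} (fst p) * indicator {a..b} (snd p) * cov (fst p) (snd p))"

lemma osc_cov_measurable:
  assumes "0 \<le> a" "b \<le> Z"
  shows "osc_cov k a b \<in> borel_measurable lborel2"
proof -
  have "(\<lambda>p. iexp (k * (fst p - snd p)) * complex_of_real (indicator {a..b} (fst p) * indicator {a..b} (snd p) *
     (indicator {0..Z} (fst p) * indicator {0..Z} (snd p) * cov (fst p) (snd p)))) \<in> borel_measurable lborel2"
    by measurable
  also have "(\<lambda>p. iexp (k * (fst p - snd p)) * complex_of_real (indicator {a..b} (fst p) * indicator {a..b} (snd p) *
     (indicator {0..Z} (fst p) * indicator {0..Z} (snd p) * cov (fst p) (snd p)))) = osc_cov k a b"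
    using assms by (auto simp: fun_eq_iff osc_cov_def indicator_def)
  finally show ?thesis .
qed

lemma norm_osc_cov_le:
  assumes "0 \<le> a" "b \<le> Z" "fst p \<noteq> snd p"
  shows "norm (osc_cov k a b p) \<le> C * kern \<gamma> a b p"
  using assms cov_bound[of "fst p" "snd p"] unfolding osc_cov_def kern_def
  by (auto simp: norm_mult indicator_def)

lemma integrable_osc_cov:
  assumes "0 \<le> a" "a \<le> b" "b \<le> Z"
  shows "integrable lborel2 (osc_cov k a b)"
proof (rule Bochner_Integration.integrable_bound)
  show "integrable lborel2 (\<lambda>p. C * kern \<gamma> a b p)"
    using integrable_kern[OF \<gamma> assms(2)] by simp
  show "AE p in lborel2. norm (osc_cov k a b p) \<le> norm (C * kern \<gamma> a b p)"
    using AE_off_diagonal by eventually_elim (use norm_osc_cov_le assms C kern_nonneg in auto)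
qed (rule osc_cov_measurable[OF assms(1,3)])

text \<open>
  The variances need not be integrable in \<open>t\<close>, so Fubini's theorem is only available after
  restriction to the set \<open>B\<close> where they are at most \<open>L\<close>.
\<close>
lemma integral_square_osc_truncated:
  fixes L k a b :: real
  assumes ab: "0 \<le> a" "a \<le> b" "b \<le> Z"
  defines "B \<equiv> {t \<in> {a..b}. (\<integral>x. (indicator {0..Z} t * \<nu> t x)\<^sup>2 \<partial>M) \<le> L}"
  defines "S \<equiv> \<lambda>x. LINT t|lborel. iexp (k * t) * complex_of_real (indicator B t * (indicator {0..Z} t * \<nu> t x))"
  shows "S \<in> borel_measurable M"
    "(\<integral>\<^sup>+ x. ennreal ((norm (S x))\<^sup>2) \<partial>M) \<le>
      ennreal (norm (LINT p|lborel2. indicator B (fst p) *\<^sub>R indicator B (snd p) *\<^sub>R osc_cov k a b p))"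
    "B \<in> sets borel"
proof -
  have s_meas: "(\<lambda>t. \<integral>x. (indicator {0..Z} t * \<nu> t x)\<^sup>2 \<partial>M) \<in> borel_measurable borel"
  proof (rule borel_measurable_lebesgue_integral)
    have "(\<lambda>p. ((\<lambda>(z, x). indicator {0..Z} z * \<nu> z x) p)\<^sup>2) \<in> borel_measurable (borel \<Otimes>\<^sub>M M)"
      by (intro borel_measurable_power \<nu>_joint)
    thus "(\<lambda>(t, x). (indicator {0..Z} t * \<nu> t x)\<^sup>2) \<in> borel_measurable (borel \<Otimes>\<^sub>M M)"
      by (simp add: case_prod_unfold)
  qed
  have "{t \<in> space borel. (\<integral>x. (indicator {0..Z} t * \<nu> t x)\<^sup>2 \<partial>M) \<le> L} \<in> sets borel"
    using s_meas by measurable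
  hence "{a..b} \<inter> {t \<in> space borel. (\<integral>x. (indicator {0..Z} t * \<nu> t x)\<^sup>2 \<partial>M) \<le> L} \<in> sets borel" by auto
  also have "{a..b} \<inter> {t \<in> space borel. (\<integral>x. (indicator {0..Z} t * \<nu> t x)\<^sup>2 \<partial>M) \<le> L} = B"
    unfolding B_def by auto
  finally show B [measurable]: "B \<in> sets borel" .
  define u where "u t x = indicator B t * (indicator {0..Z} t * \<nu> t x)" for t x
  have uj: "(\<lambda>p. u (fst p) (snd p)) \<in> borel_measurable (borel \<Otimes>\<^sub>M M)"
  proof -
    have "(\<lambda>p. indicator B (fst p) * (\<lambda>(z, x). indicator {0..Z} z * \<nu> z x) p) \<in> borel_measurable (borel \<Otimes>\<^sub>M M)"
      by measurable
    thus ?thesis by (simp add: u_def case_prod_unfold)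
  qed
  have usq: "integrable M (\<lambda>x. (u t x)\<^sup>2)" "(\<integral>x. (u t x)\<^sup>2 \<partial>M) \<le> max L 0" for t
  proof -
    show "integrable M (\<lambda>x. (u t x)\<^sup>2)"
      using \<nu>_square_integrable[of t] by (cases "t \<in> {0..Z}") (auto simp: u_def indicator_def)
    show "(\<integral>x. (u t x)\<^sup>2 \<partial>M) \<le> max L 0"
      by (cases "t \<in> B") (auto simp: u_def B_def le_max_iff_disj)
  qed
  have um: "u t \<in> borel_measurable M" for t
    using measurable_compose[OF _ uj, of "\<lambda>x. (t, x)" M] by simp
  have prod_le: "\<bar>u t1 x * u t2 x\<bar> \<le> ((u t1 x)\<^sup>2 + (u t2 x)\<^sup>2) / 2" for t1 t2 x
  proof -
    have "0 \<le> (\<bar>u t1 x\<bar> - \<bar>u t2 x\<bar>)\<^sup>2" by simp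
    thus ?thesis unfolding power2_diff by (simp add: abs_mult)
  qed
  have up: "integrable M (\<lambda>x. u t1 x * u t2 x)" for t1 t2
  proof (rule Bochner_Integration.integrable_bound)
    show "integrable M (\<lambda>x. ((u t1 x)\<^sup>2 + (u t2 x)\<^sup>2) / 2)" using usq by auto
    show "(\<lambda>x. u t1 x * u t2 x) \<in> borel_measurable M" using um by measurable
    show "AE x in M. norm (u t1 x * u t2 x) \<le> norm (((u t1 x)\<^sup>2 + (u t2 x)\<^sup>2) / 2)"
      using prod_le by (intro AE_I2) (auto intro: order_trans[OF _ abs_ge_self])
  qed
  define F where "F q = iexp (k * (fst (fst q) - snd (fst q))) * complex_of_real (u (fst (fst q)) (snd q) * u (snd (fst q)) (snd q))"
    for q :: "(real \<times> real) \<times> 'a"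
  interpret P: pair_sigma_finite "lborel2" M
    by (intro pair_sigma_finite.intro) (simp_all add: lborel_prod sigma_finite_lborel sigma_finite_measure_axioms)
  have Fm: "F \<in> borel_measurable (lborel2 \<Otimes>\<^sub>M M)"
  proof -
    have [measurable]: "(\<lambda>q. u (fst (fst q)) (snd q)) \<in> borel_measurable (lborel2 \<Otimes>\<^sub>M M)"
      using measurable_compose[OF _ uj, of "\<lambda>q. (fst (fst q), snd q)" "lborel2 \<Otimes>\<^sub>M M"] by simp
    have [measurable]: "(\<lambda>q. u (snd (fst q)) (snd q)) \<in> borel_measurable (lborel2 \<Otimes>\<^sub>M M)"
      using measurable_compose[OF _ uj, of "\<lambda>q. (snd (fst q), snd q)" "lborel2 \<Otimes>\<^sub>M M"] by simp
    show ?thesis unfolding F_def[abs_def] by measurable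
  qed
  have nF: "norm (F (p, x)) = \<bar>u (fst p) x * u (snd p) x\<bar>" for p x
    unfolding F_def by (simp add: norm_mult abs_mult)
  \<comment> \<open>The truncation pays off here: by the inequality between products and squares,
    the expected modulus of \<open>F\<close> is at most \<open>max L 0\<close>, and it vanishes
    outside a square of finite area.\<close>
  have FI: "integrable (lborel2 \<Otimes>\<^sub>M M) F"
  proof (rule P.Fubini_integrable[OF Fm])
    show "AE p in lborel2. integrable M (\<lambda>x. F (p, x))"
      unfolding F_def fst_conv snd_conv by (intro AE_I2 integrable_mult_right integrable_of_real up)
    show "integrable lborel2 (\<lambda>p. \<integral>x. norm (F (p, x)) \<partial>M)"
    proof (rule Bochner_Integration.integrable_bound)
      have "emeasure lborel2 ({a..b} \<times> {a..b}) = ennreal (b - a) * ennreal (b - a)"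
        using ab by (subst lborel.emeasure_pair_measure_Times) auto
      also have "\<dots> < \<infinity>" by (simp add: ennreal_mult_less_top)
      finally show "integrable lborel2 (\<lambda>p. indicator ({a..b} \<times> {a..b}) p * max L 0)"
        by (intro integrable_mult_left integrable_real_indicator) auto
      show "(\<lambda>p. \<integral>x. norm (F (p, x)) \<partial>M) \<in> borel_measurable lborel2"
        by (rule borel_measurable_lebesgue_integral) (use Fm in \<open>simp add: case_prod_unfold\<close>)
      show "AE p in lborel2. norm (\<integral>x. norm (F (p, x)) \<partial>M) \<le> norm (indicator ({a..b} \<times> {a..b}) p * max L 0)"
      proof (rule AE_I2)
        fix p
        show "norm (\<integral>x. norm (F (p, x)) \<partial>M) \<le> norm (indicator ({a..b} \<times> {a..b}) p * max L 0)"
        proof (cases "p \<in> {a..b} \<times> {a..b}")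
          case True
          have "(\<integral>x. norm (F (p, x)) \<partial>M) \<le> (\<integral>x. ((u (fst p) x)\<^sup>2 + (u (snd p) x)\<^sup>2) / 2 \<partial>M)"
            unfolding nF using usq up prod_le by (intro integral_mono integrable_abs) auto
          also have "\<dots> \<le> max L 0" using usq(2)[of "fst p"] usq(2)[of "snd p"] usq(1) by simp
          finally show ?thesis using True by (simp add: Bochner_Integration.integral_nonneg)
        next
          case False
          hence "F (p, x) = 0" for x unfolding F_def u_def B_def by (cases p) (auto simp: indicator_def)
          thus ?thesis by simp
        qed
      qed
    qed
  qed
  have Sm: "S \<in> borel_measurable M"
    unfolding S_def u_def[symmetric]
  proof (rule lborel.borel_measurable_lebesgue_integral)
    have [measurable]: "(\<lambda>p. u (snd p) (fst p)) \<in> borel_measurable (M \<Otimes>\<^sub>M lborel)"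
      using measurable_compose[OF _ uj, of "\<lambda>p. (snd p, fst p)" "M \<Otimes>\<^sub>M lborel"] by simp
    show "(\<lambda>(x, t). iexp (k * t) * complex_of_real (u t x)) \<in> borel_measurable (M \<Otimes>\<^sub>M lborel)"
      unfolding case_prod_unfold by measurable
  qed
  show "S \<in> borel_measurable M" by fact
  have FI': "integrable (lborel2 \<Otimes>\<^sub>M M) (case_prod (\<lambda>p x. F (p, x)))" using FI by simp
  \<comment> \<open>The exponential of the difference of two times factors into E and its conjugate,
    so the double integral of \<open>F\<close> is S times its conjugate.\<close>
  have AES: "AE x in M. (\<integral>p. F (p, x) \<partial>lborel2) = complex_of_real ((norm (S x))\<^sup>2)"
    using P.AE_integrable_snd[OF FI']
  proof eventually_elim
    fix x assume i: "integrable lborel2 (\<lambda>p. F (p, x))"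
    define E where "E t = iexp (k * t)" for t
    have e: "iexp (k * (t1 - t2)) = E t1 * cnj (E t2)" for t1 t2
      unfolding E_def cnj_exp_i_real exp_add[symmetric] by (simp add: algebra_simps)
    have "(\<integral>p. F (p, x) \<partial>lborel2) = (LINT t1|lborel. LINT t2|lborel. F ((t1, t2), x))"
      by (rule lborel_pair.integral_fst'[OF i, symmetric])
    also have "\<dots> = (LINT t1|lborel. LINT t2|lborel. (E t1 * complex_of_real (u t1 x)) * cnj (E t2 * complex_of_real (u t2 x)))"
      unfolding F_def fst_conv snd_conv e
      by (simp only: complex_cnj_mult complex_cnj_complex_of_real of_real_mult mult_ac)
    also have "\<dots> = S x * cnj (S x)" unfolding S_def u_def[symmetric] E_def[symmetric]
      by (simp only: integral_mult_right_zero integral_mult_left_zero Bochner_Integration.integral_cnj)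
    finally show "(\<integral>p. F (p, x) \<partial>lborel2) = complex_of_real ((norm (S x))\<^sup>2)"
      by (simp only: complex_norm_square)
  qed
  have iS: "integrable M (\<lambda>x. complex_of_real ((norm (S x))\<^sup>2))"
    using P.integrable_snd[OF FI'] AES Sm
    by (subst integrable_cong_AE[of _ _ "\<lambda>x. \<integral>p. F (p, x) \<partial>lborel2"]) auto
  hence iS': "integrable M (\<lambda>x. (norm (S x))\<^sup>2)" by (simp only: complex_of_real_integrable_eq)
  have "complex_of_real (\<integral>x. (norm (S x))\<^sup>2 \<partial>M) = (\<integral>x. complex_of_real ((norm (S x))\<^sup>2) \<partial>M)"
    by (rule integral_complex_of_real[symmetric])
  also have "\<dots> = (\<integral>x. (\<integral>p. F (p, x) \<partial>lborel2) \<partial>M)"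
    using P.integrable_snd[OF FI'] AES Sm by (intro integral_cong_AE) auto
  also have "\<dots> = (LINT p|lborel2. \<integral>x. F (p, x) \<partial>M)"
    by (rule P.Fubini_integral[OF FI'])
  also have "\<dots> = (LINT p|lborel2. indicator B (fst p) *\<^sub>R indicator B (snd p) *\<^sub>R osc_cov k a b p)"
  proof (rule Bochner_Integration.integral_cong[OF refl])
    fix p :: "real \<times> real"
    have "(\<integral>x. F (p, x) \<partial>M) = iexp (k * (fst p - snd p)) * complex_of_real (\<integral>x. u (fst p) x * u (snd p) x \<partial>M)"
      unfolding F_def fst_conv snd_conv by (simp only: integral_mult_right_zero integral_complex_of_real)
    also have "(\<integral>x. u (fst p) x * u (snd p) x \<partial>M) = indicator B (fst p) * indicator B (snd p) * cov (fst p) (snd p)"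
      using ab by (auto simp: u_def cov_def indicator_def B_def)
    also have "iexp (k * (fst p - snd p)) * complex_of_real (indicator B (fst p) * indicator B (snd p) * cov (fst p) (snd p))
      = indicator B (fst p) *\<^sub>R indicator B (snd p) *\<^sub>R osc_cov k a b p"
      unfolding osc_cov_def B_def by (auto simp: indicator_def)
    finally show "(\<integral>x. F (p, x) \<partial>M) = indicator B (fst p) *\<^sub>R indicator B (snd p) *\<^sub>R osc_cov k a b p" .
  qed
  finally have eq: "complex_of_real (\<integral>x. (norm (S x))\<^sup>2 \<partial>M) = (LINT p|lborel2. indicator B (fst p) *\<^sub>R indicator B (snd p) *\<^sub>R osc_cov k a b p)" .
  have "(\<integral>\<^sup>+ x. ennreal ((norm (S x))\<^sup>2) \<partial>M) = ennreal (\<integral>x. (norm (S x))\<^sup>2 \<partial>M)"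
    by (rule nn_integral_eq_integral[OF iS']) auto
  also have "\<dots> \<le> ennreal (norm (complex_of_real (\<integral>x. (norm (S x))\<^sup>2 \<partial>M)))"
    by (intro ennreal_leI) (simp add: abs_ge_self)
  finally show "(\<integral>\<^sup>+ x. ennreal ((norm (S x))\<^sup>2) \<partial>M) \<le>
      ennreal (norm (LINT p|lborel2. indicator B (fst p) *\<^sub>R indicator B (snd p) *\<^sub>R osc_cov k a b p))"
    unfolding eq .
qed

end

text \<open>Cauchy-Schwarz up to a factor 2, from X <= d + X^2 / d with d = sqrt J. The case J = 0
  is separate because d is then not a divisor.\<close>

lemma (in prob_space) nn_integral_le_sqrt_second_moment:
  fixes X :: "'a \<Rightarrow> real"
  assumes X [measurable]: "X \<in> borel_measurable M" and X0: "\<And>x. 0 \<le> X x" and J0: "0 \<le> J"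
    and J: "(\<integral>\<^sup>+ x. ennreal ((X x)\<^sup>2) \<partial>M) \<le> ennreal J"
  shows "(\<integral>\<^sup>+ x. ennreal (X x) \<partial>M) \<le> ennreal (2 * sqrt J)"
proof (cases "J = 0")
  case True
  hence "(\<integral>\<^sup>+ x. ennreal ((X x)\<^sup>2) \<partial>M) = 0" using J by simp
  hence "AE x in M. ennreal ((X x)\<^sup>2) = 0" by (subst (asm) nn_integral_0_iff_AE) auto
  hence "AE x in M. ennreal (X x) = 0" by eventually_elim (auto simp: ennreal_eq_0_iff)
  hence "(\<integral>\<^sup>+ x. ennreal (X x) \<partial>M) = 0" by (subst nn_integral_0_iff_AE) auto
  thus ?thesis by simp
next
  case False
  define d where "d = sqrt J"
  have d: "0 < d" using False J0 by (simp add: d_def)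
  have "(\<integral>\<^sup>+ x. ennreal (X x) \<partial>M) \<le> (\<integral>\<^sup>+ x. ennreal d + ennreal (1 / d) * ennreal ((X x)\<^sup>2) \<partial>M)"
  proof (rule nn_integral_mono)
    fix x
    have "0 \<le> (X x - d)\<^sup>2 + X x * d" using X0[of x] d by simp
    hence "X x * d \<le> d * d + (X x)\<^sup>2" by (simp add: power2_eq_square algebra_simps)
    hence "X x \<le> (d * d + (X x)\<^sup>2) / d" using d by (simp add: pos_le_divide_eq)
    also have "\<dots> = d + 1 / d * (X x)\<^sup>2" using d by (simp add: field_simps)
    finally have "ennreal (X x) \<le> ennreal (d + 1 / d * (X x)\<^sup>2)" by (rule ennreal_leI)
    thus "ennreal (X x) \<le> ennreal d + ennreal (1 / d) * ennreal ((X x)\<^sup>2)"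
      using d by (simp add: ennreal_plus ennreal_mult flip: ennreal_mult')
  qed
  also have "\<dots> = ennreal d + ennreal (1 / d) * (\<integral>\<^sup>+ x. ennreal ((X x)\<^sup>2) \<partial>M)"
    by (subst nn_integral_add) (auto simp: nn_integral_cmult emeasure_space_1)
  also have "\<dots> \<le> ennreal d + ennreal (1 / d) * ennreal J"
    by (intro add_left_mono mult_left_mono J) auto
  also have "\<dots> = ennreal (d + 1 / d * J)"
    using d J0 by (simp only: ennreal_plus ennreal_mult divide_nonneg_nonneg less_imp_le zero_le_one mult_nonneg_nonneg)
  also have "d + 1 / d * J = 2 * sqrt J"
  proof -
    have "J = d * d" using J0 by (simp add: d_def)
    hence "1 / d * J = d" using d by simp
    thus ?thesis unfolding d_def by simp
  qed
  finally show ?thesis .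
qed

section \<open>Increments, energies and exceptional events\<close>

context medium_bound
begin

abbreviation trajectory :: "'a \<Rightarrow> real \<Rightarrow> real" where
  "trajectory x \<equiv> \<lambda>z. \<nu> z x"

text \<open>The truncation is removed on both sides: pathwise the truncated integrals converge to
  the increment, and Fatou's lemma passes to the limit in the second moment; on the right, the
  covariance is dominated by the integrable kernel. No bound on the variances survives.\<close>

lemma second_moment_osc:
  assumes ab: "0 \<le> a" "a \<le> b" "b \<le> Z"
  shows "(\<integral>\<^sup>+ x. ennreal ((norm (osc k (trajectory x) b - osc k (trajectory x) a))\<^sup>2) \<partial>M)
    \<le> ennreal (norm (LINT p|lborel2. osc_cov k a b p))"
proof -
  define B where "B n = {t \<in> {a..b}. (\<integral>x. (indicator {0..Z} t * \<nu> t x)\<^sup>2 \<partial>M) \<le> real n}" for n :: nat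
  define S where "S n x = (LINT t|lborel. iexp (k * t) * complex_of_real (indicator (B n) t * (indicator {0..Z} t * \<nu> t x)))" for n x
  have trunc: "S n \<in> borel_measurable M"
    "(\<integral>\<^sup>+ x. ennreal ((norm (S n x))\<^sup>2) \<partial>M) \<le>
      ennreal (norm (LINT p|lborel2. indicator (B n) (fst p) *\<^sub>R indicator (B n) (snd p) *\<^sub>R osc_cov k a b p))"
    "B n \<in> sets borel" for n
    unfolding S_def[abs_def] B_def by (rule integral_square_osc_truncated[OF ab])+
  \<comment> \<open>Each single time has a finite second moment and so belongs to the truncation set
    from some index on; no uniformity over times is claimed.\<close>
  have Bev: "\<forall>\<^sub>F n in sequentially. indicator (B n) t = (indicator {a..b} t :: real)" for t
  proof (cases "t \<in> {a..b}")
    case True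
    obtain n0 :: nat where "(\<integral>x. (indicator {0..Z} t * \<nu> t x)\<^sup>2 \<partial>M) \<le> real n0" using real_arch_simple by blast
    hence "t \<in> B n" if "n \<ge> n0" for n using True that unfolding B_def by auto
    thus ?thesis using True by (auto simp: eventually_sequentially intro!: exI[of _ n0])
  qed (auto simp: B_def)
  have Slim: "(\<lambda>n. S n x) \<longlonglongrightarrow> osc k (trajectory x) b - osc k (trajectory x) a" if x: "x \<in> space M" for x
  proof -
    have i: "set_integrable lborel {0..Z} (trajectory x)" by (rule path[OF x])
    have im [measurable]: "(\<lambda>t. indicator {0..Z} t * \<nu> t x) \<in> borel_measurable borel"
      using i unfolding set_integrable_def by (auto dest: borel_measurable_integrable)
    have io: "set_integrable lborel {a..b} (\<lambda>t. iexp (k * t) * complex_of_real (\<nu> t x))"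
      by (rule set_integrable_subset[OF set_integrable_osc[OF i]]) (use ab in auto)
    have "(\<lambda>n. S n x) \<longlonglongrightarrow> (LINT t|lborel. indicator {a..b} t *\<^sub>R (iexp (k * t) * complex_of_real (\<nu> t x)))"
      unfolding S_def
    proof (rule integral_dominated_convergence)
      show "integrable lborel (\<lambda>t. \<bar>indicator {0..Z} t * \<nu> t x\<bar>)"
        using i unfolding set_integrable_def by (intro integrable_abs) simp
      show "(\<lambda>t. indicator {a..b} t *\<^sub>R (iexp (k * t) * complex_of_real (\<nu> t x))) \<in> borel_measurable lborel"
        using io unfolding set_integrable_def by (rule borel_measurable_integrable)
      have [measurable]: "B n \<in> sets borel" for n by (rule trunc(3))
      show "(\<lambda>t. iexp (k * t) * complex_of_real (indicator (B n) t * (indicator {0..Z} t * \<nu> t x))) \<in> borel_measurable lborel" for n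
        by measurable
      show "AE t in lborel. norm (iexp (k * t) * complex_of_real (indicator (B n) t * (indicator {0..Z} t * \<nu> t x)))
          \<le> \<bar>indicator {0..Z} t * \<nu> t x\<bar>" for n
        by (intro AE_I2) (auto simp: norm_mult indicator_def)
      show "AE t in lborel. (\<lambda>n. iexp (k * t) * complex_of_real (indicator (B n) t * (indicator {0..Z} t * \<nu> t x)))
          \<longlonglongrightarrow> indicator {a..b} t *\<^sub>R (iexp (k * t) * complex_of_real (\<nu> t x))"
      proof (rule AE_I2)
        fix t
        have "\<forall>\<^sub>F n in sequentially. iexp (k * t) * complex_of_real (indicator (B n) t * (indicator {0..Z} t * \<nu> t x))
           = indicator {a..b} t *\<^sub>R (iexp (k * t) * complex_of_real (\<nu> t x))"
          using Bev[of t] by eventually_elim (use ab in \<open>auto simp: indicator_def\<close>)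
        thus "(\<lambda>n. iexp (k * t) * complex_of_real (indicator (B n) t * (indicator {0..Z} t * \<nu> t x)))
          \<longlonglongrightarrow> indicator {a..b} t *\<^sub>R (iexp (k * t) * complex_of_real (\<nu> t x))"
          by (rule tendsto_eventually)
      qed
    qed
    also have "(LINT t|lborel. indicator {a..b} t *\<^sub>R (iexp (k * t) * complex_of_real (\<nu> t x)))
      = osc k (trajectory x) b - osc k (trajectory x) a"
    proof -
      have "primitive_on Z (osc k (trajectory x)) (\<lambda>t. iexp (k * t) * complex_of_real (\<nu> t x))"
        unfolding osc_def[abs_def] by (intro primitive_on_integral set_integrable_osc i)
      from primitive_on_diff[OF this ab] show ?thesis unfolding set_lebesgue_integral_def by simp
    qed
    finally show ?thesis .
  qed
  have Ilim: "(\<lambda>n. LINT p|lborel2. indicator (B n) (fst p) *\<^sub>R indicator (B n) (snd p) *\<^sub>R osc_cov k a b p)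
     \<longlonglongrightarrow> (LINT p|lborel2. osc_cov k a b p)"
  proof (rule integral_dominated_convergence)
    show m: "osc_cov k a b \<in> borel_measurable lborel2" by (rule osc_cov_measurable[OF ab(1,3)])
    show "integrable lborel2 (\<lambda>p. norm (osc_cov k a b p))"
      by (intro integrable_norm integrable_osc_cov ab)
    have [measurable]: "B n \<in> sets borel" for n by (rule trunc(3))
    show "(\<lambda>p. indicator (B n) (fst p) *\<^sub>R indicator (B n) (snd p) *\<^sub>R osc_cov k a b p) \<in> borel_measurable lborel2" for n
      using m by measurable
    show "AE p in lborel2. norm (indicator (B n) (fst p) *\<^sub>R indicator (B n) (snd p) *\<^sub>R osc_cov k a b p) \<le> norm (osc_cov k a b p)" for n
      by (intro AE_I2) (auto simp: indicator_def)
    show "AE p in lborel2. (\<lambda>n. indicator (B n) (fst p) *\<^sub>R indicator (B n) (snd p) *\<^sub>R osc_cov k a b p) \<longlonglongrightarrow> osc_cov k a b p"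
    proof (rule AE_I2)
      fix p :: "real \<times> real"
      have "\<forall>\<^sub>F n in sequentially. indicator (B n) (fst p) *\<^sub>R indicator (B n) (snd p) *\<^sub>R osc_cov k a b p = osc_cov k a b p"
        using Bev[of "fst p"] Bev[of "snd p"] by eventually_elim (auto simp: osc_cov_def indicator_def)
      thus "(\<lambda>n. indicator (B n) (fst p) *\<^sub>R indicator (B n) (snd p) *\<^sub>R osc_cov k a b p) \<longlonglongrightarrow> osc_cov k a b p"
        by (rule tendsto_eventually)
    qed
  qed
  have [measurable]: "S n \<in> borel_measurable M" for n by (rule trunc(1))
  have "(\<integral>\<^sup>+ x. ennreal ((norm (osc k (trajectory x) b - osc k (trajectory x) a))\<^sup>2) \<partial>M)
     = (\<integral>\<^sup>+ x. liminf (\<lambda>n. ennreal ((norm (S n x))\<^sup>2)) \<partial>M)"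
  proof (rule nn_integral_cong)
    fix x assume x: "x \<in> space M"
    have "(\<lambda>n. ennreal ((norm (S n x))\<^sup>2)) \<longlonglongrightarrow> ennreal ((norm (osc k (trajectory x) b - osc k (trajectory x) a))\<^sup>2)"
      by (intro tendsto_ennrealI tendsto_power tendsto_norm Slim x)
    from lim_imp_Liminf[OF _ this]
    show "ennreal ((norm (osc k (trajectory x) b - osc k (trajectory x) a))\<^sup>2) = liminf (\<lambda>n. ennreal ((norm (S n x))\<^sup>2))" by simp
  qed
  also have "\<dots> \<le> liminf (\<lambda>n. \<integral>\<^sup>+ x. ennreal ((norm (S n x))\<^sup>2) \<partial>M)"
    by (rule nn_integral_liminf) measurable
  also have "\<dots> \<le> liminf (\<lambda>n. ennreal (norm (LINT p|lborel2. indicator (B n) (fst p) *\<^sub>R indicator (B n) (snd p) *\<^sub>R osc_cov k a b p)))"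
    by (intro Liminf_mono always_eventually allI trunc(2))
  also have "\<dots> = ennreal (norm (LINT p|lborel2. osc_cov k a b p))"
    by (intro lim_imp_Liminf tendsto_ennrealI tendsto_norm Ilim) simp
  finally show ?thesis .
qed

lemma norm_integral_osc_cov_le:
  assumes ab: "0 \<le> a" "a \<le> b" "b \<le> Z"
  shows "norm (LINT p|lborel2. osc_cov k a b p) \<le> C * (2 / (1 - \<gamma>) * (b - a) powr (2 - \<gamma>))"
proof -
  have "norm (LINT p|lborel2. osc_cov k a b p) \<le> (LINT p|lborel2. C * kern \<gamma> a b p)"
  proof (rule order_trans[OF integral_norm_bound integral_mono_AE])
    show "AE p in lborel2. norm (osc_cov k a b p) \<le> C * kern \<gamma> a b p"
      using AE_off_diagonal by eventually_elim (use norm_osc_cov_le ab in auto)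
  qed (use integrable_kern[OF \<gamma> ab(2)] integrable_osc_cov[OF ab] in auto)
  also have "\<dots> \<le> C * (2 / (1 - \<gamma>) * (b - a) powr (2 - \<gamma>))"
    unfolding integral_mult_right_zero by (intro mult_left_mono integral_kern_le \<gamma> ab C)
  finally show ?thesis .
qed

text \<open>
  The second moment of the energy at level \<open>m\<close> is of order \<open>decay ^ (4 * m)\<close>, which leaves room for
  the threshold \<open>K * decay ^ m\<close> in the definition of \<open>bad\<close>.
\<close>
definition decay :: real where "decay = 2 powr (- (1 - \<gamma>) / 4)"

definition energy_const :: real where "energy_const = C * (2 / (1 - \<gamma>) * Z powr (2 - \<gamma>))"

lemma decay: "0 < decay" "decay < 1"
  unfolding decay_def using \<gamma> by (auto simp: powr_less_one)

lemma energy_const_nonneg: "0 \<le> energy_const"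
  unfolding energy_const_def using C \<gamma> by simp

lemma increment_osc_measurable [measurable]: "j < 2 ^ m \<Longrightarrow> (\<lambda>x. increment Z (osc k (trajectory x)) m j) \<in> borel_measurable M"
  unfolding increment_def using dyadic_in[of Z j m] dyadic_in[of Z "Suc j" m] Z
  by (intro borel_measurable_diff borel_measurable_osc) auto

lemma energy_osc_measurable [measurable]: "(\<lambda>x. energy Z (osc k (trajectory x)) m) \<in> borel_measurable M"
  unfolding energy_def L2_set_def
  by (intro measurable_compose[OF _ borel_measurable_sqrt] borel_measurable_sum borel_measurable_power borel_measurable_norm increment_osc_measurable) auto

text \<open>2^m increments, each of second moment of order (Z / 2^m)^(2 - \<gamma>), add up to the
  order 2^(- m (1 - \<gamma>)).\<close>

lemma second_moment_energy:
  "(\<integral>\<^sup>+ x. ennreal ((energy Z (osc k (trajectory x)) m)\<^sup>2) \<partial>M) \<le> ennreal (energy_const * decay ^ (4 * m))"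
proof -
  have "(\<integral>\<^sup>+ x. ennreal ((energy Z (osc k (trajectory x)) m)\<^sup>2) \<partial>M)
     = (\<integral>\<^sup>+ x. (\<Sum>j<2 ^ m. ennreal ((norm (increment Z (osc k (trajectory x)) m j))\<^sup>2)) \<partial>M)"
    unfolding energy_def L2_set_def by (simp add: sum_nonneg sum_ennreal)
  also have "\<dots> = (\<Sum>j<2 ^ m. \<integral>\<^sup>+ x. ennreal ((norm (increment Z (osc k (trajectory x)) m j))\<^sup>2) \<partial>M)"
    by (rule nn_integral_sum) measurable
  also have "\<dots> \<le> (\<Sum>j<(2::nat) ^ m. ennreal (C * (2 / (1 - \<gamma>) * (Z / 2 ^ m) powr (2 - \<gamma>))))"
  proof (rule sum_mono)
    fix j :: nat assume j: "j \<in> {..<2 ^ m}"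
    have ab: "0 \<le> dyadic Z m j" "dyadic Z m j \<le> dyadic Z m (Suc j)" "dyadic Z m (Suc j) \<le> Z"
      using dyadic_in[of Z j m] dyadic_in[of Z "Suc j" m] dyadic_mono[of Z j "Suc j" m] Z j by auto
    have "dyadic Z m (Suc j) - dyadic Z m j = Z / 2 ^ m" by (simp add: dyadic_def field_simps)
    with order_trans[OF second_moment_osc[OF ab, of k] ennreal_leI[OF norm_integral_osc_cov_le[OF ab]]]
    show "(\<integral>\<^sup>+ x. ennreal ((norm (increment Z (osc k (trajectory x)) m j))\<^sup>2) \<partial>M) \<le> ennreal (C * (2 / (1 - \<gamma>) * (Z / 2 ^ m) powr (2 - \<gamma>)))"
      unfolding increment_def by simp
  qed
  also have "\<dots> = ennreal (2 ^ m * (C * (2 / (1 - \<gamma>) * (Z / 2 ^ m) powr (2 - \<gamma>))))"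
    using C \<gamma> by (subst sum_ennreal) simp_all
  also have "2 ^ m * (C * (2 / (1 - \<gamma>) * (Z / 2 ^ m) powr (2 - \<gamma>))) = energy_const * decay ^ (4 * m)"
  proof -
    have "(Z / 2 ^ m) powr (2 - \<gamma>) = Z powr (2 - \<gamma>) * (2 powr (- real m)) powr (2 - \<gamma>)"
      using Z by (simp add: powr_mult[symmetric] powr_minus powr_realpow divide_inverse)
    also have "\<dots> = Z powr (2 - \<gamma>) * 2 powr (- real m * (2 - \<gamma>))" by (simp add: powr_powr)
    finally have 1: "(Z / 2 ^ m) powr (2 - \<gamma>) = Z powr (2 - \<gamma>) * 2 powr (- real m * (2 - \<gamma>))" .
    have 2: "decay ^ (4 * m) = 2 powr (- (1 - \<gamma>) / 4 * real (4 * m))"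
      unfolding decay_def by (subst powr_realpow[symmetric]) (simp_all add: powr_powr)
    have 3: "(2::real) ^ m * 2 powr (- real m * (2 - \<gamma>)) = decay ^ (4 * m)"
    proof -
      have "- (1 - \<gamma>) / 4 * real (4 * m) = real m + - real m * (2 - \<gamma>)" by (simp add: field_simps)
      thus ?thesis unfolding 2 by (simp only: powr_add powr_realpow zero_less_numeral)
    qed
    show ?thesis unfolding 1 energy_const_def 3[symmetric] by simp
  qed
  finally show ?thesis .
qed

definition bad :: "real \<Rightarrow> real \<Rightarrow> 'a set" where
  "bad K k = {x \<in> space M. \<exists>m. energy Z (osc k (trajectory x)) m > K * decay ^ m}"

lemma bad_measurable [measurable]: "bad K k \<in> sets M"
  unfolding bad_def by measurable

text \<open>Chebyshev's inequality at level \<open>m\<close> spends decay^(2 m) of the available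
  decay^(4 m), and the rest is summable over the levels. The bound does not involve the frequency
  \<open>k\<close>, so \<open>K\<close> can be fixed before \<epsilon> tends to 0.\<close>

lemma emeasure_bad_le:
  assumes K: "0 < K"
  shows "emeasure M (bad K k) \<le> ennreal (energy_const / (K\<^sup>2 * (1 - decay\<^sup>2)))"
proof -
  define B where "B m = {x \<in> space M. energy Z (osc k (trajectory x)) m > K * decay ^ m}" for m
  have Bm: "B m \<in> sets M" for m unfolding B_def by measurable
  have th: "decay\<^sup>2 < 1" using decay by (simp add: power_less_one_iff)
  have Bb: "emeasure M (B m) \<le> ennreal (energy_const / K\<^sup>2 * (decay\<^sup>2) ^ m)" for m
  proof -
    define c where "c = 1 / (K * decay ^ m)\<^sup>2"
    have c: "0 < c" unfolding c_def using K decay by simp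
    have "emeasure M (B m) \<le> emeasure M ({x \<in> space M. 1 \<le> ennreal c * ennreal ((energy Z (osc k (trajectory x)) m)\<^sup>2)})"
    proof (rule emeasure_mono)
      show "B m \<subseteq> {x \<in> space M. 1 \<le> ennreal c * ennreal ((energy Z (osc k (trajectory x)) m)\<^sup>2)}"
      proof (clarsimp simp: B_def)
        fix x assume "K * decay ^ m < energy Z (osc k (trajectory x)) m"
        hence "(K * decay ^ m)\<^sup>2 \<le> (energy Z (osc k (trajectory x)) m)\<^sup>2" using K decay by (intro power_mono) auto
        hence "1 \<le> c * (energy Z (osc k (trajectory x)) m)\<^sup>2" unfolding c_def using K decay by (simp add: divide_simps)
        thus "1 \<le> ennreal c * ennreal ((energy Z (osc k (trajectory x)) m)\<^sup>2)"
          using c by (simp flip: ennreal_mult)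
      qed
    qed measurable
    also have "\<dots> \<le> ennreal c * (\<integral>\<^sup>+ x. ennreal ((energy Z (osc k (trajectory x)) m)\<^sup>2) * indicator (space M) x \<partial>M)"
      by (intro nn_integral_Markov_inequality borel_measurable_times_ennreal borel_measurable_indicator
           measurable_compose[OF _ measurable_ennreal] borel_measurable_power energy_osc_measurable sets.top)
    also have "(\<integral>\<^sup>+ x. ennreal ((energy Z (osc k (trajectory x)) m)\<^sup>2) * indicator (space M) x \<partial>M) = (\<integral>\<^sup>+ x. ennreal ((energy Z (osc k (trajectory x)) m)\<^sup>2) \<partial>M)"
      by (intro nn_integral_cong) simp
    also have "ennreal c * \<dots> \<le> ennreal c * ennreal (energy_const * decay ^ (4 * m))"
      by (intro mult_left_mono second_moment_energy) simp
    also have "\<dots> = ennreal (c * (energy_const * decay ^ (4 * m)))"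
      using c by (simp add: ennreal_mult')
    also have "c * (energy_const * decay ^ (4 * m)) = energy_const / K\<^sup>2 * (decay\<^sup>2) ^ m"
    proof -
      have "decay ^ (4 * m) = decay ^ (2 * m) * decay ^ (2 * m)" by (simp flip: power_add)
      thus ?thesis unfolding c_def using decay K by (simp add: power_mult_distrib power_mult[symmetric] mult.commute field_simps)
    qed
    finally show ?thesis .
  qed
  have "bad K k = (\<Union>m. B m)" unfolding bad_def B_def by auto
  hence "emeasure M (bad K k) \<le> (\<Sum>m. emeasure M (B m))"
    using emeasure_subadditive_countably[of B M] Bm by auto
  also have "\<dots> \<le> (\<Sum>m. ennreal (energy_const / K\<^sup>2 * (decay\<^sup>2) ^ m))"
    by (intro suminf_le Bb) auto
  also have "\<dots> = ennreal (\<Sum>m. energy_const / K\<^sup>2 * (decay\<^sup>2) ^ m)"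
    using energy_const_nonneg th by (intro suminf_ennreal2 summable_mult summable_geometric) auto
  also have "(\<Sum>m. energy_const / K\<^sup>2 * (decay\<^sup>2) ^ m) = energy_const / (K\<^sup>2 * (1 - decay\<^sup>2))"
    using th by (subst suminf_mult) (auto simp: suminf_geometric summable_geometric)
  finally show ?thesis .
qed

end

section \<open>The mean transmission defect\<close>

context medium_bound
begin

lemma norm_reduced_transmission_minus_1_le:
  "x \<in> space M \<Longrightarrow> norm (reduced_transmission Z \<tau> \<epsilon> (trajectory x) \<omega> - 1) \<le> 2"
  using norm_reduced_transmission_le[OF _ path, of x \<tau> \<epsilon> \<omega>] Z
    norm_triangle_ineq4[of "reduced_transmission Z \<tau> \<epsilon> (trajectory x) \<omega>" 1] by simp

lemma integrable_transmission_defect: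
  "integrable M (\<lambda>x. norm (reduced_transmission Z \<tau> \<epsilon> (trajectory x) \<omega> - 1))"
proof (rule integrable_const_bound[where B=2])
  show "(\<lambda>x. norm (reduced_transmission Z \<tau> \<epsilon> (trajectory x) \<omega> - 1)) \<in> borel_measurable M"
    using borel_measurable_reduced_transmission by measurable
qed (use norm_reduced_transmission_minus_1_le in auto)

text \<open>Outside two exceptional events, at frequencies 0 and \<kappa>, the pathwise bound
  \<open>near\<close> holds; on each of them the defect is at most 2, whence the factor 4.
  \<open>near\<close> is a hypothesis so that one constant \<open>D\<close>, chosen from
  \<open>K\<close> alone, serves all media. The increments enter in mean, estimated by the root of
  their second moments.\<close>

lemma expected_transmission_defect_le:
  fixes \<omega> \<epsilon> \<tau> K D :: real
  assumes K: "0 < K" and D: "0 \<le> D"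
    and near: "\<And>n k p. set_integrable lborel {0..Z} n \<Longrightarrow> \<forall>m. energy Z (osc 0 n) m \<le> K * decay ^ m \<Longrightarrow>
      \<forall>m. energy Z (osc k n) m \<le> K * decay ^ m \<Longrightarrow>
      norm (1 / zs_a (coupling k \<omega> n) Z - 1) \<le> \<bar>\<omega>\<bar> * ((\<Sum>i<2 ^ p. norm (increment Z (osc k n) p i)) + D * decay ^ p)"
  defines "\<kappa> \<equiv> 2 * \<omega> / \<epsilon> powr \<tau>"
  shows "(\<integral>x. norm (reduced_transmission Z \<tau> \<epsilon> (trajectory x) \<omega> - 1) \<partial>M)
    \<le> 4 * (energy_const / (K\<^sup>2 * (1 - decay\<^sup>2))) + \<bar>\<omega>\<bar> *
       ((\<Sum>i<2 ^ p. 2 * sqrt (norm (LINT q|lborel2. osc_cov \<kappa> (dyadic Z p i) (dyadic Z p (Suc i)) q))) + D * decay ^ p)"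
proof -
  let ?b = "energy_const / (K\<^sup>2 * (1 - decay\<^sup>2))"
  let ?J = "\<lambda>i. norm (LINT q|lborel2. osc_cov \<kappa> (dyadic Z p i) (dyadic Z p (Suc i)) q)"
  let ?q = "\<lambda>x. norm (reduced_transmission Z \<tau> \<epsilon> (trajectory x) \<omega> - 1)"
  have pw: "ennreal (?q x) \<le> 2 * indicator (bad K 0) x + 2 * indicator (bad K \<kappa>) x
     + ennreal \<bar>\<omega>\<bar> * ((\<Sum>i<2 ^ p. ennreal (norm (increment Z (osc \<kappa> (trajectory x)) p i))) + ennreal (D * decay ^ p))"
    if x: "x \<in> space M" for x
  proof (cases "x \<in> bad K 0 \<or> x \<in> bad K \<kappa>")
    case True
    have "ennreal (?q x) \<le> ennreal 2"
      by (rule ennreal_leI[OF norm_reduced_transmission_minus_1_le[OF x]])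
    also have "\<dots> \<le> 2 * indicator (bad K 0) x + 2 * indicator (bad K \<kappa>) x"
      using True by (auto simp: indicator_def)
    also have "\<dots> \<le> 2 * indicator (bad K 0) x + 2 * indicator (bad K \<kappa>) x
     + ennreal \<bar>\<omega>\<bar> * ((\<Sum>i<2 ^ p. ennreal (norm (increment Z (osc \<kappa> (trajectory x)) p i))) + ennreal (D * decay ^ p))"
      by (rule add_increasing2) auto
    finally show ?thesis .
  next
    case False
    hence "\<forall>m. energy Z (osc 0 (trajectory x)) m \<le> K * decay ^ m" "\<forall>m. energy Z (osc \<kappa> (trajectory x)) m \<le> K * decay ^ m"
      using x unfolding bad_def by (auto simp: not_less)
    from near[OF path[OF x] this, of p]
    have "?q x \<le> \<bar>\<omega>\<bar> * ((\<Sum>i<2 ^ p. norm (increment Z (osc \<kappa> (trajectory x)) p i)) + D * decay ^ p)"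
      unfolding reduced_transmission_def \<kappa>_def .
    hence "ennreal (?q x) \<le> ennreal (\<bar>\<omega>\<bar> * ((\<Sum>i<2 ^ p. norm (increment Z (osc \<kappa> (trajectory x)) p i)) + D * decay ^ p))"
      by (rule ennreal_leI)
    also have "\<dots> = ennreal \<bar>\<omega>\<bar> * ((\<Sum>i<2 ^ p. ennreal (norm (increment Z (osc \<kappa> (trajectory x)) p i))) + ennreal (D * decay ^ p))"
      using D decay by (simp add: ennreal_mult ennreal_plus sum_nonneg sum_ennreal)
    also have "\<dots> \<le> 2 * indicator (bad K 0) x + 2 * indicator (bad K \<kappa>) x
     + ennreal \<bar>\<omega>\<bar> * ((\<Sum>i<2 ^ p. ennreal (norm (increment Z (osc \<kappa> (trajectory x)) p i))) + ennreal (D * decay ^ p))"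
      by (rule add_increasing) auto
    finally show ?thesis .
  qed
  have incJ: "(\<integral>\<^sup>+ x. ennreal (norm (increment Z (osc \<kappa> (trajectory x)) p i)) \<partial>M) \<le> ennreal (2 * sqrt (?J i))" if i: "i < 2 ^ p" for i
  proof (rule nn_integral_le_sqrt_second_moment)
    have ab: "0 \<le> dyadic Z p i" "dyadic Z p i \<le> dyadic Z p (Suc i)" "dyadic Z p (Suc i) \<le> Z"
      using dyadic_in[of Z i p] dyadic_in[of Z "Suc i" p] dyadic_mono[of Z i "Suc i" p] Z i by auto
    show "(\<integral>\<^sup>+ x. ennreal ((norm (increment Z (osc \<kappa> (trajectory x)) p i))\<^sup>2) \<partial>M) \<le> ennreal (?J i)"
      using second_moment_osc[OF ab, of \<kappa>] unfolding increment_def .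
    show "(\<lambda>x. norm (increment Z (osc \<kappa> (trajectory x)) p i)) \<in> borel_measurable M"
      using increment_osc_measurable[OF i] by measurable
  qed auto
  have th: "decay\<^sup>2 < 1" using decay by (simp add: power_less_one_iff)
  have b0: "0 \<le> ?b" using energy_const_nonneg K th by (intro divide_nonneg_nonneg mult_nonneg_nonneg) auto
  have mi: "(\<lambda>x. ennreal (norm (increment Z (osc \<kappa> (trajectory x)) p i))) \<in> borel_measurable M" if "i < 2 ^ p" for i
    using increment_osc_measurable[OF that] by measurable
  have "ennreal (\<integral>x. ?q x \<partial>M) = (\<integral>\<^sup>+ x. ennreal (?q x) \<partial>M)"
    by (rule nn_integral_eq_integral[OF integrable_transmission_defect, symmetric]) simp
  also have "\<dots> \<le> (\<integral>\<^sup>+ x. 2 * indicator (bad K 0) x + 2 * indicator (bad K \<kappa>) x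
     + ennreal \<bar>\<omega>\<bar> * ((\<Sum>i<2 ^ p. ennreal (norm (increment Z (osc \<kappa> (trajectory x)) p i))) + ennreal (D * decay ^ p)) \<partial>M)"
    by (intro nn_integral_mono pw)
  also have "\<dots> = (\<integral>\<^sup>+ x. 2 * indicator (bad K 0) x + 2 * indicator (bad K \<kappa>) x \<partial>M)
     + (\<integral>\<^sup>+ x. ennreal \<bar>\<omega>\<bar> * ((\<Sum>i<2 ^ p. ennreal (norm (increment Z (osc \<kappa> (trajectory x)) p i))) + ennreal (D * decay ^ p)) \<partial>M)"
    using mi by (intro nn_integral_add) auto
  also have "(\<integral>\<^sup>+ x. 2 * indicator (bad K 0) x + 2 * indicator (bad K \<kappa>) x \<partial>M) = 2 * emeasure M (bad K 0) + 2 * emeasure M (bad K \<kappa>)"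
    by (subst nn_integral_add) (auto simp: nn_integral_cmult_indicator)
  also have "(\<integral>\<^sup>+ x. ennreal \<bar>\<omega>\<bar> * ((\<Sum>i<2 ^ p. ennreal (norm (increment Z (osc \<kappa> (trajectory x)) p i))) + ennreal (D * decay ^ p)) \<partial>M)
    = ennreal \<bar>\<omega>\<bar> * ((\<Sum>i<2 ^ p. \<integral>\<^sup>+ x. ennreal (norm (increment Z (osc \<kappa> (trajectory x)) p i)) \<partial>M) + ennreal (D * decay ^ p))"
    using mi by (subst nn_integral_cmult, simp, subst nn_integral_add, simp, simp, subst nn_integral_sum) (auto simp: emeasure_space_1)
  also have "2 * emeasure M (bad K 0) + 2 * emeasure M (bad K \<kappa>)
     + ennreal \<bar>\<omega>\<bar> * ((\<Sum>i<2 ^ p. \<integral>\<^sup>+ x. ennreal (norm (increment Z (osc \<kappa> (trajectory x)) p i)) \<partial>M) + ennreal (D * decay ^ p))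
    \<le> 2 * ennreal ?b + 2 * ennreal ?b + ennreal \<bar>\<omega>\<bar> * ((\<Sum>i<2 ^ p. ennreal (2 * sqrt (?J i))) + ennreal (D * decay ^ p))"
    by (intro add_mono mult_left_mono emeasure_bad_le K sum_mono incJ) auto
  also have "(\<Sum>i<2 ^ p. ennreal (2 * sqrt (?J i))) = ennreal (\<Sum>i<2 ^ p. 2 * sqrt (?J i))"
    by (rule sum_ennreal) simp
  also have "2 * ennreal ?b + 2 * ennreal ?b + ennreal \<bar>\<omega>\<bar> * (ennreal (\<Sum>i<2 ^ p. 2 * sqrt (?J i)) + ennreal (D * decay ^ p))
    = ennreal (4 * ?b + \<bar>\<omega>\<bar> * ((\<Sum>i<2 ^ p. 2 * sqrt (?J i)) + D * decay ^ p))"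
  proof -
    have s: "0 \<le> (\<Sum>i<2 ^ p. 2 * sqrt (?J i))" by (intro sum_nonneg) simp
    have d: "0 \<le> D * decay ^ p" using D decay by simp
    have 2: "2 * ennreal ?b = ennreal (2 * ?b)" using b0 by (subst ennreal_mult) auto
    have "ennreal \<bar>\<omega>\<bar> * (ennreal (\<Sum>i<2 ^ p. 2 * sqrt (?J i)) + ennreal (D * decay ^ p))
      = ennreal (\<bar>\<omega>\<bar> * ((\<Sum>i<2 ^ p. 2 * sqrt (?J i)) + D * decay ^ p))"
      by (simp only: ennreal_plus[OF s d, symmetric] ennreal_mult[OF abs_ge_zero add_nonneg_nonneg[OF s d], symmetric])
    moreover have "ennreal (2 * ?b) + ennreal (2 * ?b) = ennreal (4 * ?b)"
      using b0 by (subst ennreal_plus[symmetric]) auto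
    moreover have "0 \<le> \<bar>\<omega>\<bar> * ((\<Sum>i<2 ^ p. 2 * sqrt (?J i)) + D * decay ^ p)" using s d by simp
    moreover have "0 \<le> 4 * ?b" using b0 by simp
    ultimately show ?thesis unfolding 2 by (simp only: ennreal_plus)
  qed
  finally show ?thesis
  proof (subst (asm) ennreal_le_iff)
    have "0 \<le> (\<Sum>i<2 ^ p. 2 * sqrt (?J i))" by (intro sum_nonneg) simp
    thus "0 \<le> 4 * ?b + \<bar>\<omega>\<bar> * ((\<Sum>i<2 ^ p. 2 * sqrt (?J i)) + D * decay ^ p)" using b0 D decay by simp
  qed
qed

end

text \<open>Covariance and frequency vary simultaneously, so the two limits are separated. The
  covariances converge in L1 of the square, dominated by the kernel, and replacing them by the limit
  \<open>K0\<close> costs an error independent of the unimodular factor. With the density fixed, the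
  Riemann-Lebesgue lemma acts in the first time for almost every second time.\<close>

lemma osc_cov_integral_tendsto_0:
  fixes M :: "nat \<Rightarrow> 'a measure"
  assumes mb: "\<And>n. medium_bound (M n) Z (\<nu> n) C \<gamma>"
    and lim: "\<And>t1 t2. t1 \<in> {0..Z} \<Longrightarrow> t2 \<in> {0..Z} \<Longrightarrow> t1 \<noteq> t2 \<Longrightarrow> (\<lambda>n. medium.cov (M n) (\<nu> n) t1 t2) \<longlonglongrightarrow> K0 t1 t2"
    and cont: "\<And>t2. t2 \<in> {0..Z} \<Longrightarrow> continuous_on ({0..Z} - {t2}) (\<lambda>t1. K0 t1 t2)"
    and k: "filterlim (\<lambda>n. \<bar>k n :: real\<bar>) at_top sequentially"
    and ab: "0 \<le> a" "a \<le> b" "b \<le> Z"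
  shows "(\<lambda>n. LINT p|lborel2. medium_bound.osc_cov (M n) (\<nu> n) (k n) a b p) \<longlonglongrightarrow> 0"
proof -
  interpret mb0: medium_bound "M 0" Z "\<nu> 0" C \<gamma> by (rule mb)
  note \<gamma> = mb0.\<gamma> and C = mb0.C
  \<comment> \<open>\<open>kern\<close> is 0 on the diagonal, as \<open>0 powr a = 0\<close>. With
    \<open>G\<close> and \<open>H\<close> set to 0 there as well, domination by the kernel and
    convergence hold at every point instead of almost everywhere.\<close>
  define G where "G p = (if fst p \<noteq> snd p then indicator {a..b} (fst p) * indicator {a..b} (snd p) * K0 (fst p) (snd p) else 0)" for p
  define e where "e n p = iexp (k n * (fst p - snd p))" for n and p :: "real \<times> real"
  define H where "H n p = (if fst p \<noteq> snd p then medium_bound.osc_cov (M n) (\<nu> n) 0 a b p else 0)" for n p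
  have Hm: "H n \<in> borel_measurable lborel2" for n
  proof -
    interpret medium_bound "M n" Z "\<nu> n" C \<gamma> by (rule mb)
    have [measurable]: "osc_cov 0 a b \<in> borel_measurable lborel2" using ab by (intro osc_cov_measurable)
    show ?thesis unfolding H_def[abs_def] by measurable
  qed
  have Hb: "norm (H n p) \<le> C * kern \<gamma> a b p" for n p
  proof -
    interpret medium_bound "M n" Z "\<nu> n" C \<gamma> by (rule mb)
    show ?thesis using norm_osc_cov_le[OF ab(1,3), of p 0] C kern_nonneg[of \<gamma> a b p] unfolding H_def by auto
  qed
  have HG: "(\<lambda>n. H n p) \<longlonglongrightarrow> complex_of_real (G p)" for p
  proof (cases "fst p \<noteq> snd p \<and> fst p \<in> {a..b} \<and> snd p \<in> {a..b}")
    case True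
    have "H n p = complex_of_real (medium.cov (M n) (\<nu> n) (fst p) (snd p))" for n
    proof -
      interpret medium_bound "M n" Z "\<nu> n" C \<gamma> by (rule mb)
      show ?thesis using True unfolding H_def osc_cov_def by simp
    qed
    moreover have "G p = K0 (fst p) (snd p)" using True unfolding G_def by simp
    ultimately show ?thesis using lim[of "fst p" "snd p"] True ab by (auto intro!: tendsto_of_real)
  next
    case False
    have "H n p = 0" for n
    proof -
      interpret medium_bound "M n" Z "\<nu> n" C \<gamma> by (rule mb)
      show ?thesis using False unfolding H_def osc_cov_def by auto
    qed
    moreover have "G p = 0" using False unfolding G_def by auto
    ultimately show ?thesis by simp
  qed
  have Gm: "(\<lambda>p. complex_of_real (G p)) \<in> borel_measurable lborel2"
    by (rule borel_measurable_LIMSEQ_metric[OF Hm HG])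
  have Gb: "norm (complex_of_real (G p)) \<le> C * kern \<gamma> a b p" for p
    by (rule LIMSEQ_le_const2[OF tendsto_norm[OF HG]]) (use Hb in auto)
  have kint: "integrable lborel2 (\<lambda>p. C * kern \<gamma> a b p)"
    using integrable_kern[OF \<gamma> ab(2)] by simp
  have em [measurable]: "e n \<in> borel_measurable lborel2" for n
    unfolding e_def[abs_def] by measurable
  have ne: "norm (e n p) = 1" for n p unfolding e_def by simp
  have eGi: "integrable lborel2 (\<lambda>p. e n p * complex_of_real (G p))" for n
    by (rule Bochner_Integration.integrable_bound[OF kint])
      (use Gm Gb C kern_nonneg in \<open>auto simp: norm_mult ne intro!: AE_I2 borel_measurable_times em order_trans[OF _ abs_ge_self]\<close>)
  have eHi: "integrable lborel2 (\<lambda>p. e n p * H n p)" for n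
    by (rule Bochner_Integration.integrable_bound[OF kint])
      (use Hm Hb C kern_nonneg in \<open>auto simp: norm_mult ne intro!: AE_I2 borel_measurable_times em order_trans[OF _ abs_ge_self]\<close>)
  have IH: "(LINT p|lborel2. medium_bound.osc_cov (M n) (\<nu> n) (k n) a b p) = (LINT p|lborel2. e n p * H n p)" for n
  proof -
    interpret medium_bound "M n" Z "\<nu> n" C \<gamma> by (rule mb)
    show ?thesis
    proof (rule integral_cong_AE)
      show "osc_cov (k n) a b \<in> borel_measurable lborel2" using ab by (intro osc_cov_measurable)
      show "(\<lambda>p. e n p * H n p) \<in> borel_measurable lborel2" using Hm by measurable
      show "AE p in lborel2. osc_cov (k n) a b p = e n p * H n p"
        using AE_off_diagonal by eventually_elim (simp add: H_def e_def osc_cov_def)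
    qed
  qed
  have diff: "(\<lambda>n. LINT p|lborel2. norm (H n p - complex_of_real (G p))) \<longlonglongrightarrow> (LINT p|lborel2. 0)"
  proof (rule integral_dominated_convergence)
    show "integrable lborel2 (\<lambda>p. 2 * (C * kern \<gamma> a b p))" using kint by (rule integrable_mult_right)
    show "AE p in lborel2. norm (norm (H n p - complex_of_real (G p))) \<le> 2 * (C * kern \<gamma> a b p)" for n
    proof (rule AE_I2)
      fix p
      show "norm (norm (H n p - complex_of_real (G p))) \<le> 2 * (C * kern \<gamma> a b p)"
        using norm_triangle_ineq4[of "H n p" "complex_of_real (G p)"] Hb[of n p] Gb[of p] unfolding real_norm_def abs_norm_cancel by linarith
    qed
    show "AE p in lborel2. (\<lambda>n. norm (H n p - complex_of_real (G p))) \<longlonglongrightarrow> 0"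
      using HG by (intro AE_I2 tendsto_norm_zero LIM_zero)
    show "(\<lambda>p. norm (H n p - complex_of_real (G p))) \<in> borel_measurable lborel2" for n
      using Hm Gm by measurable
  qed simp
  have d0: "(\<lambda>n. (LINT p|lborel2. e n p * H n p) - (LINT p|lborel2. e n p * complex_of_real (G p))) \<longlonglongrightarrow> 0"
  proof (rule Lim_null_comparison[OF always_eventually[OF allI]])
    show "norm ((LINT p|lborel2. e n p * H n p) - (LINT p|lborel2. e n p * complex_of_real (G p)))
      \<le> (LINT p|lborel2. norm (H n p - complex_of_real (G p)))" for n
    proof -
      have "(LINT p|lborel2. e n p * H n p) - (LINT p|lborel2. e n p * complex_of_real (G p))
        = (LINT p|lborel2. e n p * (H n p - complex_of_real (G p)))"
        unfolding right_diff_distrib by (rule Bochner_Integration.integral_diff[symmetric, OF eHi eGi])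
      also have "norm \<dots> \<le> (LINT p|lborel2. norm (e n p * (H n p - complex_of_real (G p))))"
        by (rule integral_norm_bound)
      finally show ?thesis by (simp add: norm_mult ne)
    qed
  qed (use diff in simp)
  have g: "(\<lambda>n. LINT p|lborel2. e n p * complex_of_real (G p)) \<longlonglongrightarrow> 0"
  proof -
    have Gi: "integrable lborel2 (case_prod (\<lambda>t1 t2. complex_of_real (G (t1, t2))))"
    proof -
      have "integrable lborel2 (\<lambda>p. complex_of_real (G p))"
        by (rule Bochner_Integration.integrable_bound[OF kint Gm])
          (use Gb in \<open>auto intro!: AE_I2 order_trans[OF _ abs_ge_self]\<close>)
      thus ?thesis by (simp add: case_prod_unfold)
    qed
    have nGi: "integrable lborel2 (case_prod (\<lambda>t1 t2. norm (complex_of_real (G (t1, t2)))))"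
      using integrable_norm[OF Gi] by (simp add: case_prod_unfold)
    define R where "R n t2 = (LINT t1|lborel. iexp (k n * t1) * complex_of_real (G (t1, t2)))" for n t2
    have inner: "(LINT t1|lborel. e n (t1, t2) * complex_of_real (G (t1, t2))) = exp (- (\<i> * complex_of_real (k n * t2))) * R n t2" for n t2
    proof -
      have "e n (t1, t2) = exp (- (\<i> * complex_of_real (k n * t2))) * iexp (k n * t1)" for t1
        unfolding e_def exp_add[symmetric] by (simp add: algebra_simps)
      thus ?thesis unfolding R_def by (simp only: mult.assoc integral_mult_right_zero)
    qed
    have Geq: "(LINT p|lborel2. e n p * complex_of_real (G p)) = (LINT t2|lborel. exp (- (\<i> * complex_of_real (k n * t2))) * R n t2)" for n
      unfolding inner[symmetric] using lborel_pair.integral_snd[of "\<lambda>t1 t2. e n (t1, t2) * complex_of_real (G (t1, t2))"] eGi[of n]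
      by (simp add: case_prod_unfold)
    have "(\<lambda>n. LINT t2|lborel. exp (- (\<i> * complex_of_real (k n * t2))) * R n t2) \<longlonglongrightarrow> (LINT t2|(lborel :: real measure). (0::complex))"
    proof (rule integral_dominated_convergence)
      show "integrable lborel (\<lambda>t2. LINT t1|lborel. norm (complex_of_real (G (t1, t2))))"
        by (rule lborel_pair.integrable_snd[OF nGi])
      show "(\<lambda>t2. exp (- (\<i> * complex_of_real (k n * t2))) * R n t2) \<in> borel_measurable lborel" for n
        unfolding inner[symmetric] using lborel_pair.integrable_snd[of "\<lambda>t1 t2. e n (t1, t2) * complex_of_real (G (t1, t2))"] eGi[of n]
        by (simp add: case_prod_unfold borel_measurable_integrable)
      show "AE t2 in lborel. norm (exp (- (\<i> * complex_of_real (k n * t2))) * R n t2) \<le> (LINT t1|lborel. norm (complex_of_real (G (t1, t2))))" for n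
      proof (rule AE_I2)
        fix t2
        have "norm (exp (- (\<i> * complex_of_real (k n * t2)))) = 1" by (simp add: norm_exp_eq_Re)
        hence "norm (exp (- (\<i> * complex_of_real (k n * t2))) * R n t2) = norm (R n t2)" by (simp only: norm_mult mult_1)
        also have "\<dots> \<le> (LINT t1|lborel. norm (iexp (k n * t1) * complex_of_real (G (t1, t2))))"
          unfolding R_def by (rule integral_norm_bound)
        finally show "norm (exp (- (\<i> * complex_of_real (k n * t2))) * R n t2) \<le> (LINT t1|lborel. norm (complex_of_real (G (t1, t2))))"
          by (simp add: norm_mult)
      qed
      show "AE t2 in lborel. (\<lambda>n. exp (- (\<i> * complex_of_real (k n * t2))) * R n t2) \<longlonglongrightarrow> 0"
        using lborel_pair.AE_integrable_snd[OF Gi]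
      proof eventually_elim
        fix t2 assume i: "integrable lborel (\<lambda>t1. complex_of_real (G (t1, t2)))"
        have "AE t1 in lborel. isCont (\<lambda>t1. complex_of_real (G (t1, t2))) t1"
          using AE_lborel_singleton[of a] AE_lborel_singleton[of b] AE_lborel_singleton[of t2]
        proof eventually_elim
          fix t1 assume n: "t1 \<noteq> a" "t1 \<noteq> b" "t1 \<noteq> t2"
          show "isCont (\<lambda>t1. complex_of_real (G (t1, t2))) t1"
          proof (cases "t1 \<in> {a<..<b} \<and> t2 \<in> {a..b}")
            case True
            have "continuous_on ({a<..<b} - {t2}) (\<lambda>t1. complex_of_real (K0 t1 t2))"
              by (intro continuous_on_of_real continuous_on_subset[OF cont]) (use True ab in auto)
            hence "isCont (\<lambda>t1. complex_of_real (K0 t1 t2)) t1"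
              using True n by (subst (asm) continuous_on_eq_continuous_at) auto
            have "\<forall>\<^sub>F t in nhds t1. complex_of_real (G (t, t2)) = complex_of_real (K0 t t2)"
            proof (rule eventually_nhds_in_open[of "{a<..<b} - {t2}", THEN eventually_mono])
              show "t1 \<in> {a<..<b} - {t2}" using True n by auto
            qed (use True in \<open>auto simp: G_def\<close>)
            from isCont_cong[OF this] \<open>isCont (\<lambda>t1. complex_of_real (K0 t1 t2)) t1\<close> show ?thesis by (rule iffD2)
          next
            case False
            have "\<forall>\<^sub>F t in nhds t1. complex_of_real (G (t, t2)) = 0"
            proof (cases "t2 \<in> {a..b}")
              case True
              show ?thesis
              proof (rule eventually_nhds_in_open[of "{..<a} \<union> {b<..}", THEN eventually_mono])
                show "t1 \<in> {..<a} \<union> {b<..}" using False True n by auto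
              qed (auto simp: G_def indicator_def)
            qed (auto simp: G_def)
            from isCont_cong[OF this] show ?thesis by (rule iffD2) (rule continuous_const)
          qed
        qed
        from riemann_lebesgue_cont_AE[OF i this k] have R0: "(\<lambda>n. R n t2) \<longlonglongrightarrow> 0" unfolding R_def .
        have nrm: "norm (exp (- (\<i> * complex_of_real (k n * t2))) * R n t2) = norm (R n t2)" for n
        proof -
          have "norm (exp (- (\<i> * complex_of_real (k n * t2)))) = 1" by (simp add: norm_exp_eq_Re)
          thus ?thesis by (simp only: norm_mult mult_1)
        qed
        show "(\<lambda>n. exp (- (\<i> * complex_of_real (k n * t2))) * R n t2) \<longlonglongrightarrow> 0"
          by (rule tendsto_norm_zero_cancel) (simp only: nrm tendsto_norm_zero[OF R0])
      qed
    qed simp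
    thus ?thesis unfolding Geq by simp
  qed
  from tendsto_add[OF d0 g] show ?thesis unfolding IH by simp
qed

text \<open>The order of choices is the argument: \<open>K\<close> makes the exceptional events
  unlikely for all \<open>n\<close>, \<open>D\<close> depends on \<open>K\<close>, then
  \<open>p\<close> makes the tail small, and only with \<open>p\<close> fixed does \<open>n\<close>
  tend to infinity in the finitely many increments that remain.\<close>

lemma transmission_defect_tendsto_0:
  fixes M :: "nat \<Rightarrow> 'a measure" and \<omega> \<tau> :: real
  assumes mb: "\<And>n. medium_bound (M n) Z (\<nu> n) C \<gamma>"
    and lim: "\<And>t1 t2. t1 \<in> {0..Z} \<Longrightarrow> t2 \<in> {0..Z} \<Longrightarrow> t1 \<noteq> t2 \<Longrightarrow> (\<lambda>n. medium.cov (M n) (\<nu> n) t1 t2) \<longlonglongrightarrow> K0 t1 t2"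
    and cont: "\<And>t2. t2 \<in> {0..Z} \<Longrightarrow> continuous_on ({0..Z} - {t2}) (\<lambda>t1. K0 t1 t2)"
    and \<epsilon>: "\<And>n. 0 < \<epsilon> n" "\<epsilon> \<longlonglongrightarrow> 0" and \<tau>: "0 < \<tau>"
  shows "(\<lambda>n. \<integral>x. norm (reduced_transmission Z \<tau> (\<epsilon> n) (\<lambda>z. \<nu> n z x) \<omega> - 1) \<partial>M n) \<longlonglongrightarrow> 0"
proof -
  interpret mb0: medium_bound "M 0" Z "\<nu> 0" C \<gamma> by (rule mb)
  \<comment> \<open>\<open>decay\<close> and \<open>energy_const\<close> are built from
    \<open>C\<close>, \<gamma> and \<open>Z\<close> only, so the medium of index 0 supplies the
    constants of all.\<close>
  define \<theta> where "\<theta> = mb0.decay"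
  define A where "A = mb0.energy_const"
  have \<theta>: "0 < \<theta>" "\<theta> < 1" unfolding \<theta>_def by (rule mb0.decay)+
  have A: "0 \<le> A" unfolding A_def by (rule mb0.energy_const_nonneg)
  have th: "\<theta>\<^sup>2 < 1" using \<theta> by (simp add: power_less_one_iff)
  define \<kappa> where "\<kappa> n = 2 * \<omega> / \<epsilon> n powr \<tau>" for n
  define J where "J p i n = norm (LINT q|lborel2. medium_bound.osc_cov (M n) (\<nu> n) (\<kappa> n) (dyadic Z p i) (dyadic Z p (Suc i)) q)" for p i n
  have Jlim: "(\<lambda>n. J p i n) \<longlonglongrightarrow> 0" if i: "i < 2 ^ p" and \<omega>: "\<omega> \<noteq> 0" for p i
  proof -
    have "(\<lambda>n. \<epsilon> n powr \<tau>) \<longlonglongrightarrow> 0"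
      by (rule tendsto_zero_powrI[OF \<epsilon>(2) tendsto_const _ \<tau>]) (use \<epsilon>(1) in \<open>auto intro: always_eventually less_imp_le\<close>)
    hence "filterlim (\<lambda>n. inverse (\<epsilon> n powr \<tau>)) at_top sequentially"
      by (rule filterlim_inverse_at_top) (use order_less_imp_not_eq2[OF \<epsilon>(1)] in \<open>auto intro!: always_eventually\<close>)
    hence "filterlim (\<lambda>n. \<bar>2 * \<omega>\<bar> * inverse (\<epsilon> n powr \<tau>)) at_top sequentially"
      using \<omega> by (intro filterlim_tendsto_pos_mult_at_top[OF tendsto_const]) auto
    also have "(\<lambda>n. \<bar>2 * \<omega>\<bar> * inverse (\<epsilon> n powr \<tau>)) = (\<lambda>n. \<bar>\<kappa> n\<bar>)"
      by (auto simp: \<kappa>_def abs_mult divide_inverse)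
    finally have k: "filterlim (\<lambda>n. \<bar>\<kappa> n\<bar>) at_top sequentially" .
    have ab: "0 \<le> dyadic Z p i" "dyadic Z p i \<le> dyadic Z p (Suc i)" "dyadic Z p (Suc i) \<le> Z"
      using dyadic_in[of Z i p] dyadic_in[of Z "Suc i" p] dyadic_mono[of Z i "Suc i" p] mb0.Z i by auto
    show ?thesis unfolding J_def
      by (rule tendsto_norm_zero[OF osc_cov_integral_tendsto_0[OF mb lim cont k ab]])
  qed
  define E where "E n = (\<integral>x. norm (reduced_transmission Z \<tau> (\<epsilon> n) (\<lambda>z. \<nu> n z x) \<omega> - 1) \<partial>M n)" for n
  have E0: "0 \<le> E n" for n unfolding E_def by (rule Bochner_Integration.integral_nonneg) simp
  have "\<forall>\<^sub>F n in sequentially. E n < \<eta>" if \<eta>: "0 < \<eta>" for \<eta>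
  proof -
    define c where "c = A / (1 - \<theta>\<^sup>2)"
    \<comment> \<open>Since K^2 >= K, this gives 4 c / K^2 <= 4 c / K < \<eta> / 3; the summand 1
      makes K at least 1 even if c = 0.\<close>
    define K where "K = 1 + 12 * c / \<eta>"
    have c: "0 \<le> c" unfolding c_def using A th by simp
    have K: "1 \<le> K" unfolding K_def using c \<eta> by simp
    have "4 * (A / (K\<^sup>2 * (1 - \<theta>\<^sup>2))) < \<eta> / 3"
    proof -
      have "K \<le> K\<^sup>2" using K by (simp add: power2_eq_square)
      have "4 * (A / (K\<^sup>2 * (1 - \<theta>\<^sup>2))) = 4 * c / K\<^sup>2" unfolding c_def by (simp add: field_simps)
      also have "\<dots> \<le> 4 * c / K" using \<open>K \<le> K\<^sup>2\<close> c K by (intro divide_left_mono) auto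
      also have "\<dots> < \<eta> / 3"
      proof -
        have "12 * c < \<eta> * K" unfolding K_def using \<eta> by (simp add: field_simps)
        thus ?thesis using K by (simp add: field_simps)
      qed
      finally show ?thesis .
    qed
    moreover obtain D where D: "0 \<le> D" and near: "\<And>n k p. set_integrable lborel {0..Z} n \<Longrightarrow> \<forall>m. energy Z (osc 0 n) m \<le> K * \<theta> ^ m \<Longrightarrow>
      \<forall>m. energy Z (osc k n) m \<le> K * \<theta> ^ m \<Longrightarrow>
      norm (1 / zs_a (coupling k \<omega> n) Z - 1) \<le> \<bar>\<omega>\<bar> * ((\<Sum>i<2 ^ p. norm (increment Z (osc k n) p i)) + D * \<theta> ^ p)"
      using transmission_near_one[OF mb0.Z _ \<theta>, of K \<omega>] K by (auto 0 4)
    moreover obtain p where p: "\<bar>\<omega>\<bar> * (D * \<theta> ^ p) < \<eta> / 3"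
    proof -
      have "(\<lambda>p. \<bar>\<omega>\<bar> * (D * \<theta> ^ p)) \<longlonglongrightarrow> \<bar>\<omega>\<bar> * (D * 0)"
        using \<theta> by (intro tendsto_intros LIMSEQ_power_zero) auto
      hence "\<forall>\<^sub>F p in sequentially. \<bar>\<omega>\<bar> * (D * \<theta> ^ p) < \<eta> / 3"
        by (rule order_tendstoD) (use \<eta> in auto)
      thus ?thesis using that by (auto simp: eventually_sequentially)
    qed
    have "(\<lambda>n. \<bar>\<omega>\<bar> * (\<Sum>i<2 ^ p. 2 * sqrt (J p i n))) \<longlonglongrightarrow> 0"
    proof (cases "\<omega> = 0")
      case False
      have "(\<lambda>n. \<bar>\<omega>\<bar> * (\<Sum>i<2 ^ p. 2 * sqrt (J p i n))) \<longlonglongrightarrow> \<bar>\<omega>\<bar> * (\<Sum>i<(2::nat) ^ p. 2 * sqrt 0)"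
        by (intro tendsto_mult tendsto_const tendsto_sum tendsto_real_sqrt Jlim False) auto
      thus ?thesis by simp
    qed simp
    hence "\<forall>\<^sub>F n in sequentially. \<bar>\<omega>\<bar> * (\<Sum>i<2 ^ p. 2 * sqrt (J p i n)) < \<eta> / 3"
      by (rule order_tendstoD) (use \<eta> in auto)
    thus ?thesis
    proof eventually_elim
      fix n assume small: "\<bar>\<omega>\<bar> * (\<Sum>i<2 ^ p. 2 * sqrt (J p i n)) < \<eta> / 3"
      interpret medium_bound "M n" Z "\<nu> n" C \<gamma> by (rule mb)
      have "E n \<le> 4 * (A / (K\<^sup>2 * (1 - \<theta>\<^sup>2))) + \<bar>\<omega>\<bar> * ((\<Sum>i<2 ^ p. 2 * sqrt (J p i n)) + D * \<theta> ^ p)"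
        unfolding E_def A_def \<theta>_def J_def \<kappa>_def
        by (rule expected_transmission_defect_le) (use K D near in \<open>auto simp: \<theta>_def\<close>)
      also have "\<dots> = 4 * (A / (K\<^sup>2 * (1 - \<theta>\<^sup>2))) + \<bar>\<omega>\<bar> * (\<Sum>i<2 ^ p. 2 * sqrt (J p i n)) + \<bar>\<omega>\<bar> * (D * \<theta> ^ p)"
        by (simp only: distrib_left add.assoc)
      finally show "E n < \<eta>" using small p \<open>4 * (A / (K\<^sup>2 * (1 - \<theta>\<^sup>2))) < \<eta> / 3\<close> by linarith
    qed
  qed
  hence "E \<longlonglongrightarrow> 0" by (intro order_tendstoI) (use E0 in \<open>auto intro: always_eventually order.strict_trans2\<close>)
  thus ?thesis unfolding E_def .
qed

section \<open>Fourier inversion\<close>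

text \<open>The characteristic function of the standard normal law after the substitution x =
  \<sigma> \<omega>: a Gaussian cut-off of width 1 / \<sigma> in frequency is a mollifier of width
  \<sigma> in time.\<close>

lemma integral_gaussian_iexp:
  fixes u \<sigma> :: real
  assumes \<sigma>: "0 < \<sigma>"
  shows "(LINT \<omega>|lborel. iexp (\<omega> * u) * complex_of_real (exp (- (\<sigma> * \<omega>)\<^sup>2 / 2)))
    = complex_of_real (2 * pi * (std_normal_density (u / \<sigma>) / \<sigma>))"
proof -
  have "complex_of_real (exp (- (u / \<sigma>)\<^sup>2 / 2)) = char std_normal_distribution (u / \<sigma>)"
    by (simp add: char_std_normal_distribution)
  also have "\<dots> = (LINT x|lborel. std_normal_density x *\<^sub>R iexp (u / \<sigma> * x))"
    unfolding char_def by (subst integral_density) auto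
  also have "\<dots> = \<bar>\<sigma>\<bar> *\<^sub>R (LINT \<omega>|lborel. std_normal_density (0 + \<sigma> * \<omega>) *\<^sub>R iexp (u / \<sigma> * (0 + \<sigma> * \<omega>)))"
    by (rule lborel_integral_real_affine) (use \<sigma> in auto)
  also have "(\<lambda>\<omega>. std_normal_density (0 + \<sigma> * \<omega>) *\<^sub>R iexp (u / \<sigma> * (0 + \<sigma> * \<omega>)))
     = (\<lambda>\<omega>. complex_of_real (1 / sqrt (2 * pi)) * (iexp (\<omega> * u) * complex_of_real (exp (- (\<sigma> * \<omega>)\<^sup>2 / 2))))"
    using \<sigma> by (auto simp: fun_eq_iff std_normal_density_def scaleR_conv_of_real mult_ac)
  finally have e: "complex_of_real (exp (- (u / \<sigma>)\<^sup>2 / 2)) = complex_of_real (\<sigma> / sqrt (2 * pi)) *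
     (LINT \<omega>|lborel. iexp (\<omega> * u) * complex_of_real (exp (- (\<sigma> * \<omega>)\<^sup>2 / 2)))"
    using \<sigma> by (simp only: integral_mult_right_zero scaleR_conv_of_real abs_of_pos of_real_mult[symmetric] mult.assoc[symmetric]) (simp add: mult_ac)
  have "sqrt (2 * pi) * sqrt (2 * pi) = 2 * pi" by simp
  hence "2 * pi * (std_normal_density (u / \<sigma>) / \<sigma>) = sqrt (2 * pi) / \<sigma> * exp (- (u / \<sigma>)\<^sup>2 / 2)"
    unfolding std_normal_density_def using \<sigma> by (simp add: field_simps)
  hence "complex_of_real (2 * pi * (std_normal_density (u / \<sigma>) / \<sigma>)) = complex_of_real (sqrt (2 * pi) / \<sigma>) * complex_of_real (exp (- (u / \<sigma>)\<^sup>2 / 2))"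
    by (simp only: of_real_mult)
  also have "\<dots> = (LINT \<omega>|lborel. iexp (\<omega> * u) * complex_of_real (exp (- (\<sigma> * \<omega>)\<^sup>2 / 2)))"
    unfolding e using \<sigma> by (simp add: field_simps)
  finally show ?thesis ..
qed

lemma integrable_gaussian:
  fixes \<sigma> :: real
  assumes \<sigma>: "0 < \<sigma>"
  shows "integrable lborel (\<lambda>\<omega>. exp (- (\<sigma> * \<omega>)\<^sup>2 / 2))"
proof -
  have "integrable lborel std_normal_density" using integrable_normal_density[of 1 0] by simp
  from lborel_integrable_real_affine[OF this, of \<sigma> 0]
  have "integrable lborel (\<lambda>\<omega>. std_normal_density (\<sigma> * \<omega>))" using \<sigma> by simp
  hence "integrable lborel (\<lambda>\<omega>. sqrt (2 * pi) * std_normal_density (\<sigma> * \<omega>))" by (rule integrable_mult_right)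
  thus ?thesis unfolding std_normal_density_def by simp
qed

text \<open>\<open>f\<close> is continuous and integrable but not given as bounded, so it is split.
  Within distance 1 of \<open>s\<close> it is bounded by compactness, and rescaling permits
  dominated convergence. Further out the Gaussian is at most its value at distance 1, which beats 1
  / \<sigma>, and integrability of \<open>f\<close> suffices.\<close>

lemma gaussian_mollifier_tendsto:
  fixes f :: "real \<Rightarrow> real" and \<sigma> :: "nat \<Rightarrow> real"
  assumes f: "continuous_on UNIV f" "integrable lborel f" and \<sigma>: "\<And>n. 0 < \<sigma> n" "\<sigma> \<longlonglongrightarrow> 0"
  shows "(\<lambda>n. LINT y|lborel. f y * (std_normal_density ((y - s) / \<sigma> n) / \<sigma> n)) \<longlonglongrightarrow> f s"
proof -
  define f1 where "f1 y = indicator {s-1..s+1} y * f y" for y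
  define f2 where "f2 y = indicator (- {s-1..s+1}) y * f y" for y
  have [measurable]: "f \<in> borel_measurable borel" using f(2) by auto
  obtain B where B: "\<And>y. y \<in> {s-1..s+1} \<Longrightarrow> \<bar>f y\<bar> \<le> B"
    using compact_continuous_image[OF continuous_on_subset[OF f(1) subset_UNIV] compact_Icc, of "s - 1" "s + 1"]
    by (meson bounded_real compact_imp_bounded imageI)
  have B0: "0 \<le> B" using B[of s] by simp
  have dens0: "0 \<le> std_normal_density x" for x by simp
  have i: "integrable lborel (\<lambda>y. f y * (std_normal_density ((y - s) / \<sigma> n) / \<sigma> n))" for n
  proof (rule Bochner_Integration.integrable_bound)
    show "integrable lborel (\<lambda>y. 1 / \<sigma> n * f y)" using f(2) by (rule integrable_mult_right)
    show "AE y in lborel. norm (f y * (std_normal_density ((y - s) / \<sigma> n) / \<sigma> n)) \<le> norm (1 / \<sigma> n * f y)"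
    proof (rule AE_I2)
      fix y
      have "std_normal_density ((y - s) / \<sigma> n) \<le> 1"
      proof -
        have "1 \<le> sqrt (2 * pi)" using pi_ge_two by (intro real_le_rsqrt) auto
        hence "1 / sqrt (2 * pi) \<le> 1" by simp
        moreover have "exp (- ((y - s) / \<sigma> n)\<^sup>2 / 2) \<le> 1" by simp
        ultimately show ?thesis unfolding std_normal_density_def by (intro mult_le_one) auto
      qed
      hence "\<bar>f y\<bar> * (std_normal_density ((y - s) / \<sigma> n) / \<sigma> n) \<le> \<bar>f y\<bar> * (1 / \<sigma> n)"
        using \<sigma>(1)[of n] by (intro mult_left_mono divide_right_mono) auto
      thus "norm (f y * (std_normal_density ((y - s) / \<sigma> n) / \<sigma> n)) \<le> norm (1 / \<sigma> n * f y)"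
        using \<sigma>(1)[of n] by (simp add: abs_mult mult.commute)
    qed
  qed measurable
  have split: "(LINT y|lborel. f y * (std_normal_density ((y - s) / \<sigma> n) / \<sigma> n))
    = (LINT y|lborel. f1 y * (std_normal_density ((y - s) / \<sigma> n) / \<sigma> n)) + (LINT y|lborel. f2 y * (std_normal_density ((y - s) / \<sigma> n) / \<sigma> n))" for n
  proof -
    have ii: "integrable lborel (\<lambda>y. indicator A y *\<^sub>R (f y * (std_normal_density ((y - s) / \<sigma> n) / \<sigma> n)))" if "A \<in> sets lborel" for A
      by (rule integrable_mult_indicator[OF that i])
    have "(LINT y|lborel. f y * (std_normal_density ((y - s) / \<sigma> n) / \<sigma> n)) =
      (LINT y|lborel. indicator {s-1..s+1} y *\<^sub>R (f y * (std_normal_density ((y - s) / \<sigma> n) / \<sigma> n)) + indicator (- {s-1..s+1}) y *\<^sub>R (f y * (std_normal_density ((y - s) / \<sigma> n) / \<sigma> n)))"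
      by (intro Bochner_Integration.integral_cong refl) (auto simp: indicator_def)
    also have "\<dots> = (LINT y|lborel. indicator {s-1..s+1} y *\<^sub>R (f y * (std_normal_density ((y - s) / \<sigma> n) / \<sigma> n))) + (LINT y|lborel. indicator (- {s-1..s+1}) y *\<^sub>R (f y * (std_normal_density ((y - s) / \<sigma> n) / \<sigma> n)))"
      by (rule Bochner_Integration.integral_add[OF ii ii]) auto
    finally show ?thesis unfolding f1_def f2_def by (simp add: mult.assoc)
  qed
  have "(\<lambda>n. LINT y|lborel. f1 y * (std_normal_density ((y - s) / \<sigma> n) / \<sigma> n)) \<longlonglongrightarrow> f s"
  proof -
    have sub: "(LINT y|lborel. f1 y * (std_normal_density ((y - s) / \<sigma> n) / \<sigma> n)) = (LINT x|lborel. f1 (s + \<sigma> n * x) * std_normal_density x)" for n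
    proof -
      have "(LINT y|lborel. f1 y * (std_normal_density ((y - s) / \<sigma> n) / \<sigma> n))
        = \<bar>\<sigma> n\<bar> *\<^sub>R (LINT x|lborel. f1 (s + \<sigma> n * x) * (std_normal_density ((s + \<sigma> n * x - s) / \<sigma> n) / \<sigma> n))"
        by (rule lborel_integral_real_affine) (use \<sigma>(1)[of n] in auto)
      also have "\<dots> = \<sigma> n * (LINT x|lborel. (1 / \<sigma> n) * (f1 (s + \<sigma> n * x) * std_normal_density x))"
        using \<sigma>(1)[of n] by (simp add: less_imp_neq[symmetric])
      also have "\<dots> = (LINT x|lborel. f1 (s + \<sigma> n * x) * std_normal_density x)"
        unfolding integral_mult_right_zero using \<sigma>(1)[of n] by simp
      finally show ?thesis .
    qed
    have "(\<lambda>n. LINT x|lborel. f1 (s + \<sigma> n * x) * std_normal_density x) \<longlonglongrightarrow> (LINT x|lborel. f s * std_normal_density x)"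
    proof (rule integral_dominated_convergence)
      have [measurable]: "f1 \<in> borel_measurable borel" unfolding f1_def[abs_def] by measurable
      show "(\<lambda>x. f1 (s + \<sigma> n * x) * std_normal_density x) \<in> borel_measurable lborel" for n by measurable
      show "integrable lborel (\<lambda>x. B * std_normal_density x)" using integrable_normal_density[of 1 0] by simp
      show "AE x in lborel. norm (f1 (s + \<sigma> n * x) * std_normal_density x) \<le> B * std_normal_density x" for n
      proof (rule AE_I2)
        fix x
        have "\<bar>f1 (s + \<sigma> n * x)\<bar> \<le> B" unfolding f1_def using B B0 by (auto simp: indicator_def)
        thus "norm (f1 (s + \<sigma> n * x) * std_normal_density x) \<le> B * std_normal_density x"
          by (simp add: abs_mult mult_right_mono)
      qed
      show "AE x in lborel. (\<lambda>n. f1 (s + \<sigma> n * x) * std_normal_density x) \<longlonglongrightarrow> f s * std_normal_density x"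
      proof (rule AE_I2)
        fix x
        have c: "isCont f1 s"
        proof -
          have "\<forall>\<^sub>F y in nhds s. f1 y = f y"
            by (rule eventually_nhds_in_open[of "{s-1<..<s+1}", THEN eventually_mono]) (auto simp: f1_def)
          thus ?thesis using f(1) by (subst isCont_cong[of f1 f]) (auto simp: continuous_on_eq_continuous_at)
        qed
        have "(\<lambda>n. s + \<sigma> n * x) \<longlonglongrightarrow> s + 0 * x" by (intro tendsto_intros \<sigma>(2))
        hence "(\<lambda>n. f1 (s + \<sigma> n * x)) \<longlonglongrightarrow> f1 s" by (intro isCont_tendsto_compose[OF c]) simp
        thus "(\<lambda>n. f1 (s + \<sigma> n * x) * std_normal_density x) \<longlonglongrightarrow> f s * std_normal_density x"
          by (intro tendsto_mult tendsto_const) (simp add: f1_def)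
      qed
    qed simp
    also have "(LINT x|lborel. f s * std_normal_density x) = f s" using integral_normal_density[of 1 0] by simp
    finally show ?thesis unfolding sub .
  qed
  moreover have "(\<lambda>n. LINT y|lborel. f2 y * (std_normal_density ((y - s) / \<sigma> n) / \<sigma> n)) \<longlonglongrightarrow> 0"
  proof (rule Lim_null_comparison[OF always_eventually[OF allI]])
    show "norm (LINT y|lborel. f2 y * (std_normal_density ((y - s) / \<sigma> n) / \<sigma> n)) \<le> (LINT y|lborel. \<bar>f y\<bar>) * (std_normal_density (1 / \<sigma> n) / \<sigma> n)" for n
    proof -
      have "norm (LINT y|lborel. f2 y * (std_normal_density ((y - s) / \<sigma> n) / \<sigma> n)) \<le> (LINT y|lborel. norm (f2 y * (std_normal_density ((y - s) / \<sigma> n) / \<sigma> n)))"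
        by (rule integral_norm_bound)
      also have "\<dots> \<le> (LINT y|lborel. \<bar>f y\<bar> * (std_normal_density (1 / \<sigma> n) / \<sigma> n))"
      proof (rule integral_mono)
        show "integrable lborel (\<lambda>y. norm (f2 y * (std_normal_density ((y - s) / \<sigma> n) / \<sigma> n)))"
        proof (rule integrable_norm)
          show "integrable lborel (\<lambda>y. f2 y * (std_normal_density ((y - s) / \<sigma> n) / \<sigma> n))"
            using integrable_mult_indicator[OF _ i[of n], of "- {s-1..s+1}"] by (simp add: f2_def mult.assoc)
        qed
        show "integrable lborel (\<lambda>y. \<bar>f y\<bar> * (std_normal_density (1 / \<sigma> n) / \<sigma> n))"
          using f(2) by (intro integrable_mult_left integrable_abs)
        fix y
        show "norm (f2 y * (std_normal_density ((y - s) / \<sigma> n) / \<sigma> n)) \<le> \<bar>f y\<bar> * (std_normal_density (1 / \<sigma> n) / \<sigma> n)"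
        proof (cases "y \<in> {s-1..s+1}")
          case False
          hence "1 \<le> \<bar>y - s\<bar>" by auto
          hence "1\<^sup>2 \<le> \<bar>y - s\<bar>\<^sup>2" by (rule power_mono) simp
          hence "(1 / \<sigma> n)\<^sup>2 \<le> ((y - s) / \<sigma> n)\<^sup>2" unfolding power_divide by (intro divide_right_mono) auto
          hence "std_normal_density ((y - s) / \<sigma> n) \<le> std_normal_density (1 / \<sigma> n)"
            unfolding std_normal_density_def by (intro mult_left_mono) auto
          thus ?thesis using False \<sigma>(1)[of n] by (auto simp: f2_def abs_mult intro!: mult_left_mono divide_right_mono)
        qed (use \<sigma>(1)[of n] in \<open>auto simp: f2_def intro!: mult_nonneg_nonneg divide_nonneg_pos\<close>)
      qed
      finally show ?thesis by simp
    qed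
    have "((\<lambda>x. std_normal_density (1 / x) / x) \<longlongrightarrow> 0) (at_right 0)"
      unfolding std_normal_density_def by real_asymp
    hence "(\<lambda>n. std_normal_density (1 / \<sigma> n) / \<sigma> n) \<longlonglongrightarrow> 0"
      by (rule filterlim_compose) (use \<sigma> order_less_imp_not_eq2[OF \<sigma>(1)] in \<open>auto simp: filterlim_at intro: always_eventually\<close>)
    from tendsto_mult_right_zero[OF this]
    show "(\<lambda>n. (LINT y|lborel. \<bar>f y\<bar>) * (std_normal_density (1 / \<sigma> n) / \<sigma> n)) \<longlonglongrightarrow> 0" .
  qed
  ultimately show ?thesis unfolding split using tendsto_add by force
qed

text \<open>The Gaussian factor makes the double integral absolutely convergent, so that Fubini's
  theorem yields the mollified source. It is removed on the frequency side by integrability of the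
  Fourier transform and on the time side by continuity of \<open>f\<close>, which gives the equality
  at every \<open>s\<close>.\<close>

lemma fourier_inversion:
  fixes f :: "real \<Rightarrow> real"
  assumes "source_function f"
  shows "(LINT \<omega>|lborel. exp (- (\<i> * complex_of_real (s * \<omega>))) * source_fourier f \<omega>) = complex_of_real (2 * pi * f s)"
proof -
  have f: "continuous_on UNIV f" "integrable lborel f" and F: "integrable lborel (source_fourier f)"
    using assms unfolding source_function_def by auto
  define \<sigma> where "\<sigma> n = 1 / real (Suc n)" for n
  have \<sigma>: "0 < \<sigma> n" "\<sigma> \<longlonglongrightarrow> 0" for n
    unfolding \<sigma>_def[abs_def] using LIMSEQ_Suc[OF lim_1_over_n] by auto
  have [measurable]: "f \<in> borel_measurable borel" "source_fourier f \<in> borel_measurable borel" using f(2) F by auto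
  define e where "e n \<omega> = complex_of_real (exp (- (\<sigma> n * \<omega>)\<^sup>2 / 2))" for n \<omega>
  have e1: "norm (e n \<omega>) \<le> 1" for n \<omega> unfolding e_def by simp
  have "(\<lambda>n. LINT \<omega>|lborel. e n \<omega> * (exp (- (\<i> * complex_of_real (s * \<omega>))) * source_fourier f \<omega>))
     \<longlonglongrightarrow> (LINT \<omega>|lborel. exp (- (\<i> * complex_of_real (s * \<omega>))) * source_fourier f \<omega>)"
  proof (rule integral_dominated_convergence)
    show "integrable lborel (\<lambda>\<omega>. norm (source_fourier f \<omega>))" using F by simp
    show "(\<lambda>\<omega>. e n \<omega> * (exp (- (\<i> * complex_of_real (s * \<omega>))) * source_fourier f \<omega>)) \<in> borel_measurable lborel" for n
      unfolding e_def by measurable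
    show "(\<lambda>\<omega>. exp (- (\<i> * complex_of_real (s * \<omega>))) * source_fourier f \<omega>) \<in> borel_measurable lborel" by measurable
    show "AE \<omega> in lborel. norm (e n \<omega> * (exp (- (\<i> * complex_of_real (s * \<omega>))) * source_fourier f \<omega>)) \<le> norm (source_fourier f \<omega>)" for n
      using e1 by (intro AE_I2) (simp add: norm_mult norm_exp_eq_Re mult_left_le_one_le)
    show "AE \<omega> in lborel. (\<lambda>n. e n \<omega> * (exp (- (\<i> * complex_of_real (s * \<omega>))) * source_fourier f \<omega>))
       \<longlonglongrightarrow> exp (- (\<i> * complex_of_real (s * \<omega>))) * source_fourier f \<omega>"
    proof (rule AE_I2)
      fix \<omega>
      have "(\<lambda>n. e n \<omega>) \<longlonglongrightarrow> complex_of_real (exp (- (0 * \<omega>)\<^sup>2 / 2))"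
        unfolding e_def by (intro tendsto_intros \<sigma>(2)) auto
      hence "(\<lambda>n. e n \<omega>) \<longlonglongrightarrow> 1" by simp
      from tendsto_mult[OF this tendsto_const]
      show "(\<lambda>n. e n \<omega> * (exp (- (\<i> * complex_of_real (s * \<omega>))) * source_fourier f \<omega>))
       \<longlonglongrightarrow> exp (- (\<i> * complex_of_real (s * \<omega>))) * source_fourier f \<omega>" by simp
    qed
  qed
  moreover have "(LINT \<omega>|lborel. e n \<omega> * (exp (- (\<i> * complex_of_real (s * \<omega>))) * source_fourier f \<omega>))
     = complex_of_real (2 * pi * (LINT y|lborel. f y * (std_normal_density ((y - s) / \<sigma> n) / \<sigma> n)))" for n
  proof -
    define G where "G \<omega> y = (e n \<omega> * exp (- (\<i> * complex_of_real (s * \<omega>)))) * (iexp (\<omega> * y) * complex_of_real (f y))" for \<omega> y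
    have nG: "norm (G \<omega> y) = exp (- (\<sigma> n * \<omega>)\<^sup>2 / 2) * \<bar>f y\<bar>" for \<omega> y
      unfolding G_def e_def by (simp add: norm_mult norm_exp_eq_Re)
    have Gm: "case_prod G \<in> borel_measurable lborel2"
      unfolding G_def e_def case_prod_unfold by measurable
    have fi: "integrable lborel (\<lambda>y. iexp (\<omega> * y) * complex_of_real (f y))" for \<omega>
      by (rule Bochner_Integration.integrable_bound[OF f(2)]) (auto simp: norm_mult)
    have Gi: "integrable lborel2 (case_prod G)"
    proof (rule lborel_pair.Fubini_integrable[OF Gm])
      show "integrable lborel (\<lambda>\<omega>. LINT y|lborel. norm (case_prod G (\<omega>, y)))"
        unfolding prod.case nG integral_mult_right_zero by (intro integrable_mult_left integrable_gaussian \<sigma>(1))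
      show "AE \<omega> in lborel. integrable lborel (\<lambda>y. case_prod G (\<omega>, y))"
        unfolding prod.case G_def by (intro AE_I2 integrable_mult_right fi)
    qed
    have "(LINT \<omega>|lborel. e n \<omega> * (exp (- (\<i> * complex_of_real (s * \<omega>))) * source_fourier f \<omega>)) = (LINT \<omega>|lborel. LINT y|lborel. G \<omega> y)"
      unfolding G_def source_fourier_def integral_mult_right_zero by (simp only: mult.assoc)
    also have "\<dots> = (LINT y|lborel. LINT \<omega>|lborel. G \<omega> y)" by (rule lborel_pair.Fubini_integral[OF Gi, symmetric])
    also have "\<dots> = (LINT y|lborel. complex_of_real (2 * pi * (f y * (std_normal_density ((y - s) / \<sigma> n) / \<sigma> n))))"
    proof (rule Bochner_Integration.integral_cong[OF refl])
      fix y
      have "G \<omega> y = complex_of_real (f y) * (iexp (\<omega> * (y - s)) * e n \<omega>)" for \<omega>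
      proof -
        have "iexp (\<omega> * (y - s)) = exp (- (\<i> * complex_of_real (s * \<omega>))) * iexp (\<omega> * y)"
          unfolding exp_add[symmetric] by (simp add: algebra_simps)
        thus ?thesis unfolding G_def by (simp only: mult_ac)
      qed
      hence "(LINT \<omega>|lborel. G \<omega> y) = complex_of_real (f y) * complex_of_real (2 * pi * (std_normal_density ((y - s) / \<sigma> n) / \<sigma> n))"
        unfolding e_def by (simp only: integral_mult_right_zero integral_gaussian_iexp[OF \<sigma>(1)])
      thus "(LINT \<omega>|lborel. G \<omega> y) = complex_of_real (2 * pi * (f y * (std_normal_density ((y - s) / \<sigma> n) / \<sigma> n)))"
        by (simp add: mult_ac)
    qed
    also have "\<dots> = complex_of_real (2 * pi * (LINT y|lborel. f y * (std_normal_density ((y - s) / \<sigma> n) / \<sigma> n)))"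
      unfolding integral_complex_of_real integral_mult_right_zero ..
    finally show ?thesis .
  qed
  moreover have "(\<lambda>n. complex_of_real (2 * pi * (LINT y|lborel. f y * (std_normal_density ((y - s) / \<sigma> n) / \<sigma> n)))) \<longlonglongrightarrow> complex_of_real (2 * pi * f s)"
    by (intro tendsto_of_real tendsto_mult tendsto_const gaussian_mollifier_tendsto f \<sigma>)
  ultimately show ?thesis using LIMSEQ_unique by simp
qed

section \<open>Random elements of the space of bounded continuous functions\<close>

text \<open>Common form of the transmitted wave and of its limit: they differ only in the multiplier
  \<open>T\<close>, a transmission coefficient or a pure phase. Uniform distances between waves then
  reduce to weighted L1 distances between multipliers.\<close>

definition synthesis :: "(real \<Rightarrow> complex) \<Rightarrow> (real \<Rightarrow> complex) \<Rightarrow> real \<Rightarrow> complex" where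
  "synthesis F T s = 1 / (2 * complex_of_real pi) *
     (LINT \<omega>|lborel. exp (- \<i> * complex_of_real (s * \<omega>)) * T \<omega> * F \<omega>)"

lemma synthesis_integrable:
  assumes F: "integrable lborel F" and T: "T \<in> borel_measurable borel" "\<And>\<omega>. norm (T \<omega>) \<le> B"
  shows "integrable lborel (\<lambda>\<omega>. exp (- \<i> * complex_of_real (s * \<omega>)) * T \<omega> * F \<omega>)"
proof (rule Bochner_Integration.integrable_bound)
  have [measurable]: "F \<in> borel_measurable borel" using F by auto
  show "integrable lborel (\<lambda>\<omega>. B * norm (F \<omega>))" using F by (intro integrable_mult_right integrable_norm)
  show "(\<lambda>\<omega>. exp (- \<i> * complex_of_real (s * \<omega>)) * T \<omega> * F \<omega>) \<in> borel_measurable lborel" using T(1) by measurable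
  show "AE \<omega> in lborel. norm (exp (- \<i> * complex_of_real (s * \<omega>)) * T \<omega> * F \<omega>) \<le> norm (B * norm (F \<omega>))"
    using T(2) by (intro AE_I2) (auto simp: norm_mult norm_exp_eq_Re intro!: mult_right_mono order_trans[OF _ abs_ge_self])
qed

lemma synthesis_bcontfun:
  assumes F: "integrable lborel F" and T: "T \<in> borel_measurable borel" "\<And>\<omega>. norm (T \<omega>) \<le> 1"
  shows "synthesis F T \<in> bcontfun"
proof (rule bcontfun_normI)
  note i = synthesis_integrable[OF F T]
  have Fm [measurable]: "F \<in> borel_measurable borel" using F by auto
  have ne: "norm (exp (- \<i> * complex_of_real (s * \<omega>)) * T \<omega> * F \<omega>) \<le> norm (F \<omega>)" for s \<omega>
    using T(2)[of \<omega>] by (simp add: norm_mult norm_exp_eq_Re mult_left_le_one_le)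
  show "norm (synthesis F T s) \<le> norm (1 / (2 * complex_of_real pi)) * (LINT \<omega>|lborel. norm (F \<omega>))" for s
    unfolding synthesis_def norm_mult using F i[of s] ne
    by (intro mult_left_mono order_trans[OF integral_norm_bound] integral_mono integrable_norm) (auto simp: norm_mult)
  show "continuous_on UNIV (synthesis F T)"
    unfolding continuous_on_sequentially
  proof (intro allI ballI impI, elim conjE)
    fix x :: "nat \<Rightarrow> real" and a assume x: "x \<longlonglongrightarrow> a"
    have "(\<lambda>n. LINT \<omega>|lborel. exp (- \<i> * complex_of_real (x n * \<omega>)) * T \<omega> * F \<omega>) \<longlonglongrightarrow> (LINT \<omega>|lborel. exp (- \<i> * complex_of_real (a * \<omega>)) * T \<omega> * F \<omega>)"
    proof (rule integral_dominated_convergence)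
      show "integrable lborel (\<lambda>\<omega>. norm (F \<omega>))" using F by simp
      show "AE \<omega> in lborel. norm (exp (- \<i> * complex_of_real (x n * \<omega>)) * T \<omega> * F \<omega>) \<le> norm (F \<omega>)" for n
        using ne by (intro AE_I2)
      show "AE \<omega> in lborel. (\<lambda>n. exp (- \<i> * complex_of_real (x n * \<omega>)) * T \<omega> * F \<omega>) \<longlonglongrightarrow> exp (- \<i> * complex_of_real (a * \<omega>)) * T \<omega> * F \<omega>"
        by (intro AE_I2 tendsto_intros x)
    qed (use i in \<open>auto intro: borel_measurable_integrable\<close>)
    thus "(synthesis F T \<circ> x) \<longlonglongrightarrow> synthesis F T a"
      unfolding synthesis_def o_def by (intro tendsto_mult tendsto_const)
  qed
qed

lemma dist_synthesis_le:
  assumes F: "integrable lborel F" and T: "T \<in> borel_measurable borel" "\<And>\<omega>. norm (T \<omega>) \<le> 1"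
    and T': "T' \<in> borel_measurable borel" "\<And>\<omega>. norm (T' \<omega>) \<le> 1"
  shows "dist (Bcontfun (synthesis F T)) (Bcontfun (synthesis F T')) \<le> (LINT \<omega>|lborel. norm (T \<omega> - T' \<omega>) * norm (F \<omega>))"
proof (rule dist_bound)
  fix s
  have [measurable]: "F \<in> borel_measurable borel" using F by auto
  have b2: "norm (T \<omega> - T' \<omega>) \<le> 2" for \<omega> using norm_triangle_ineq4[of "T \<omega>" "T' \<omega>"] T(2)[of \<omega>] T'(2)[of \<omega>] by linarith
  have i: "integrable lborel (\<lambda>\<omega>. norm (T \<omega> - T' \<omega>) * norm (F \<omega>))"
  proof (rule Bochner_Integration.integrable_bound)
    show "integrable lborel (\<lambda>\<omega>. 2 * norm (F \<omega>))" using F by (intro integrable_mult_right integrable_norm)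
    show "(\<lambda>\<omega>. norm (T \<omega> - T' \<omega>) * norm (F \<omega>)) \<in> borel_measurable lborel" using T(1) T'(1) by measurable
    show "AE \<omega> in lborel. norm (norm (T \<omega> - T' \<omega>) * norm (F \<omega>)) \<le> norm (2 * norm (F \<omega>))"
      using b2 by (intro AE_I2) (auto intro!: mult_right_mono)
  qed
  note iT = synthesis_integrable[OF F T] and iT' = synthesis_integrable[OF F T']
  have "synthesis F T s - synthesis F T' s = 1 / (2 * complex_of_real pi) *
     (LINT \<omega>|lborel. exp (- \<i> * complex_of_real (s * \<omega>)) * T \<omega> * F \<omega> - exp (- \<i> * complex_of_real (s * \<omega>)) * T' \<omega> * F \<omega>)"
    unfolding synthesis_def by (subst Bochner_Integration.integral_diff[OF iT iT']) (simp add: right_diff_distrib)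
  hence "norm (synthesis F T s - synthesis F T' s) = 1 / (2 * pi) *
     norm (LINT \<omega>|lborel. exp (- \<i> * complex_of_real (s * \<omega>)) * T \<omega> * F \<omega> - exp (- \<i> * complex_of_real (s * \<omega>)) * T' \<omega> * F \<omega>)"
    by (simp add: norm_mult norm_divide)
  also have "\<dots> \<le> 1 * (LINT \<omega>|lborel. norm (T \<omega> - T' \<omega>) * norm (F \<omega>))"
  proof (intro mult_mono order_trans[OF integral_norm_bound] integral_mono i)
    show "1 / (2 * pi) \<le> 1" using pi_ge_two by (simp add: divide_le_eq_1)
    show "integrable lborel (\<lambda>\<omega>. norm (exp (- \<i> * complex_of_real (s * \<omega>)) * T \<omega> * F \<omega> - exp (- \<i> * complex_of_real (s * \<omega>)) * T' \<omega> * F \<omega>))"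
      using iT iT' by (intro integrable_norm Bochner_Integration.integrable_diff)
    fix \<omega>
    have "exp (- \<i> * complex_of_real (s * \<omega>)) * T \<omega> * F \<omega> - exp (- \<i> * complex_of_real (s * \<omega>)) * T' \<omega> * F \<omega>
      = exp (- \<i> * complex_of_real (s * \<omega>)) * ((T \<omega> - T' \<omega>) * F \<omega>)" by (simp add: algebra_simps)
    thus "norm (exp (- \<i> * complex_of_real (s * \<omega>)) * T \<omega> * F \<omega> - exp (- \<i> * complex_of_real (s * \<omega>)) * T' \<omega> * F \<omega>) \<le> norm (T \<omega> - T' \<omega>) * norm (F \<omega>)"
      by (simp add: norm_mult norm_exp_eq_Re)
  qed auto
  finally show "dist (apply_bcontfun (Bcontfun (synthesis F T)) s) (apply_bcontfun (Bcontfun (synthesis F T')) s) \<le> (LINT \<omega>|lborel. norm (T \<omega> - T' \<omega>) * norm (F \<omega>))"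
    unfolding dist_norm Bcontfun_inverse[OF synthesis_bcontfun[OF F T]] Bcontfun_inverse[OF synthesis_bcontfun[OF F T']] by simp
qed

lemma synthesis_tendsto:
  assumes F: "integrable lborel F" and T: "\<And>n. T n \<in> borel_measurable borel" "\<And>n \<omega>. norm (T n \<omega>) \<le> 1"
    and T': "T' \<in> borel_measurable borel" "\<And>\<omega>. norm (T' \<omega>) \<le> 1"
    and lim: "\<And>\<omega>. (\<lambda>n. T n \<omega>) \<longlonglongrightarrow> T' \<omega>"
  shows "(\<lambda>n. Bcontfun (synthesis F (T n))) \<longlonglongrightarrow> Bcontfun (synthesis F T')"
proof -
  have [measurable]: "F \<in> borel_measurable borel" using F by auto
  have "(\<lambda>n. LINT \<omega>|lborel. norm (T n \<omega> - T' \<omega>) * norm (F \<omega>)) \<longlonglongrightarrow> (LINT \<omega>|(lborel :: real measure). 0)"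
  proof (rule integral_dominated_convergence)
    show "integrable lborel (\<lambda>\<omega>. 2 * norm (F \<omega>))" using F by (intro integrable_mult_right integrable_norm)
    show "(\<lambda>\<omega>. norm (T n \<omega> - T' \<omega>) * norm (F \<omega>)) \<in> borel_measurable lborel" for n using T(1)[of n] T'(1) by measurable
    show "AE \<omega> in lborel. norm (norm (T n \<omega> - T' \<omega>) * norm (F \<omega>)) \<le> 2 * norm (F \<omega>)" for n
    proof (rule AE_I2)
      fix \<omega>
      have "norm (T n \<omega> - T' \<omega>) \<le> 2" using norm_triangle_ineq4[of "T n \<omega>" "T' \<omega>"] T(2)[of n \<omega>] T'(2)[of \<omega>] by linarith
      thus "norm (norm (T n \<omega> - T' \<omega>) * norm (F \<omega>)) \<le> 2 * norm (F \<omega>)" by (auto intro!: mult_right_mono)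
    qed
    show "AE \<omega> in lborel. (\<lambda>n. norm (T n \<omega> - T' \<omega>) * norm (F \<omega>)) \<longlonglongrightarrow> 0"
      using lim by (intro AE_I2 tendsto_mult_left_zero tendsto_norm_zero LIM_zero)
  qed simp
  hence "(\<lambda>n. LINT \<omega>|lborel. norm (T n \<omega> - T' \<omega>) * norm (F \<omega>)) \<longlonglongrightarrow> 0" by simp
  hence "(\<lambda>n. dist (Bcontfun (synthesis F (T n))) (Bcontfun (synthesis F T'))) \<longlonglongrightarrow> 0"
    by (rule Lim_null_comparison[OF always_eventually[OF allI], rotated]) (use dist_synthesis_le[OF F T(1,2) T'] in auto)
  thus ?thesis by (rule tendsto_dist_iff[THEN iffD2])
qed

section \<open>Measurability through sampled frequencies\<close>

definition grid :: "nat \<Rightarrow> real \<Rightarrow> real" where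
  "grid n \<omega> = real_of_int \<lfloor>real (Suc n) * \<omega>\<rfloor> / real (Suc n)"

lemma grid_tendsto: "(\<lambda>n. grid n \<omega>) \<longlonglongrightarrow> \<omega>"
proof -
  have "norm (grid n \<omega> - \<omega>) \<le> 1 / real (Suc n)" for n
  proof -
    define N where "N = real (Suc n)"
    have N: "0 < N" by (simp add: N_def)
    have "\<bar>real_of_int \<lfloor>N * \<omega>\<rfloor> - N * \<omega>\<bar> \<le> 1" by linarith
    hence "\<bar>real_of_int \<lfloor>N * \<omega>\<rfloor> - N * \<omega>\<bar> / N \<le> 1 / N" using N by (intro divide_right_mono) auto
    also have "\<bar>real_of_int \<lfloor>N * \<omega>\<rfloor> - N * \<omega>\<bar> / N = \<bar>(real_of_int \<lfloor>N * \<omega>\<rfloor> - N * \<omega>) / N\<bar>" using N by simp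
    also have "(real_of_int \<lfloor>N * \<omega>\<rfloor> - N * \<omega>) / N = grid n \<omega> - \<omega>" unfolding grid_def N_def[symmetric] using N by (simp add: field_simps)
    finally show ?thesis unfolding N_def by simp
  qed
  note bd = this
  have "(\<lambda>n. 1 / real (Suc n)) \<longlonglongrightarrow> 0" by (rule LIMSEQ_Suc[OF lim_1_over_n])
  hence "(\<lambda>n. grid n \<omega> - \<omega>) \<longlonglongrightarrow> 0"
    by (rule Lim_null_comparison[OF always_eventually[OF allI[OF bd]]])
  thus ?thesis by (rule LIM_zero_cancel)
qed

text \<open>A Caratheodory function: sampling the frequency on a countable grid makes each
  approximation measurable, and continuity in the frequency passes to the limit.\<close>

lemma joint_measurable_of_continuous:
  fixes T :: "'a \<Rightarrow> real \<Rightarrow> complex"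
  assumes c: "\<And>x \<omega>. x \<in> space M \<Longrightarrow> isCont (T x) \<omega>" and m: "\<And>\<omega>. (\<lambda>x. T x \<omega>) \<in> borel_measurable M"
  shows "(\<lambda>p. T (snd p) (fst p)) \<in> borel_measurable (lborel \<Otimes>\<^sub>M M)"
proof (rule borel_measurable_LIMSEQ_metric)
  show "(\<lambda>p. T (snd p) (grid n (fst p))) \<in> borel_measurable (lborel \<Otimes>\<^sub>M M)" for n
  proof -
    have 1: "(\<lambda>p. T (snd p) (real_of_int j / real (Suc n))) \<in> borel_measurable (lborel \<Otimes>\<^sub>M M)" for j :: int
      by (rule measurable_compose[OF measurable_snd m])
    have 2: "(\<lambda>p. \<lfloor>real (Suc n) * fst p\<rfloor>) \<in> measurable (lborel \<Otimes>\<^sub>M M) (count_space UNIV)"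
      by measurable
    show ?thesis unfolding grid_def
      by (rule measurable_compose_countable[OF 1 2])
  qed
  show "(\<lambda>n. T (snd p) (grid n (fst p))) \<longlonglongrightarrow> T (snd p) (fst p)" if "p \<in> space (lborel \<Otimes>\<^sub>M M)" for p
    by (rule isCont_tendsto_compose[OF c grid_tendsto]) (use that in \<open>auto simp: space_pair_measure\<close>)
qed

text \<open>
  The space of bounded continuous functions is not separable, so measurability is obtained through
  continuous images of the countably many values of \<open>T x\<close> on a grid.
\<close>
lemma synthesis_measurable:
  fixes T :: "'a \<Rightarrow> real \<Rightarrow> complex"
  assumes F: "integrable lborel F" and c: "\<And>x \<omega>. x \<in> space M \<Longrightarrow> isCont (T x) \<omega>"
    and m: "\<And>\<omega>. (\<lambda>x. T x \<omega>) \<in> borel_measurable M" and b: "\<And>x \<omega>. x \<in> space M \<Longrightarrow> norm (T x \<omega>) \<le> 1"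
  shows "(\<lambda>x. Bcontfun (synthesis F (T x))) \<in> borel_measurable M"
proof (rule borel_measurable_LIMSEQ_metric)
  \<comment> \<open>\<open>\<Psi>\<close> has to be continuous on all sequences, including unbounded
    ones, while the convergence of syntheses requires multipliers bounded by 1. Clipping enforces
    the bound and leaves the actual values of \<open>T\<close> unchanged.\<close>
  define clip where "clip z = z /\<^sub>R max 1 (norm z)" for z :: complex
  have clip1: "norm (clip z) \<le> 1" for z
    unfolding clip_def by (simp add: divide_le_eq_1 le_max_iff_disj divide_inverse_commute[symmetric] divide_simps)
  have clip_id: "clip z = z" if "norm z \<le> 1" for z using that by (simp add: clip_def)
  have clip_lim: "(\<lambda>k. clip (z k)) \<longlonglongrightarrow> clip w" if "z \<longlonglongrightarrow> w" for z w
    unfolding clip_def by (intro tendsto_scaleR tendsto_inverse tendsto_max tendsto_const tendsto_norm that) auto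
  define \<Psi> where "\<Psi> n t = Bcontfun (synthesis F (\<lambda>\<omega>. clip (t \<lfloor>real (Suc n) * \<omega>\<rfloor>)))" for n :: nat and t :: "int \<Rightarrow> complex"
  have mt: "(\<lambda>\<omega>. clip (t \<lfloor>real (Suc n) * \<omega>\<rfloor>)) \<in> borel_measurable borel" for n and t :: "int \<Rightarrow> complex"
    by (rule measurable_compose[where N="count_space UNIV"]) auto
  have "continuous_on UNIV (\<Psi> n)" for n
    unfolding continuous_on_sequentially
  proof (intro allI ballI impI, elim conjE)
    fix t :: "nat \<Rightarrow> int \<Rightarrow> complex" and t' assume t: "t \<longlonglongrightarrow> t'"
    have "(\<lambda>k. t k j) \<longlonglongrightarrow> t' j" for j
      using continuous_on_tendsto_compose[OF continuous_on_product_coordinates t, of j] by simp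
    thus "(\<Psi> n \<circ> t) \<longlonglongrightarrow> \<Psi> n t'"
      unfolding \<Psi>_def o_def by (intro synthesis_tendsto F mt clip1 clip_lim)
  qed
  hence \<Psi>m: "\<Psi> n \<in> borel_measurable borel" for n by (rule borel_measurable_continuous_onI)
  show "(\<lambda>x. \<Psi> n (\<lambda>j. T x (real_of_int j / real (Suc n)))) \<in> borel_measurable M" for n
    by (rule measurable_compose[OF measurable_coordinatewise_then_product \<Psi>m]) (rule m)
  fix x assume x: "x \<in> space M"
  have "\<Psi> n (\<lambda>j. T x (real_of_int j / real (Suc n))) = Bcontfun (synthesis F (\<lambda>\<omega>. T x (grid n \<omega>)))" for n
    unfolding \<Psi>_def grid_def by (simp add: clip_id b[OF x])
  moreover have "(\<lambda>n. Bcontfun (synthesis F (\<lambda>\<omega>. T x (grid n \<omega>)))) \<longlonglongrightarrow> Bcontfun (synthesis F (T x))"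
  proof (rule synthesis_tendsto[OF F])
    show Tm: "T x \<in> borel_measurable borel"
      by (intro borel_measurable_continuous_onI continuous_at_imp_continuous_on) (use c x in auto)
    show "(\<lambda>\<omega>. T x (grid n \<omega>)) \<in> borel_measurable borel" for n
      by (rule measurable_compose[OF _ Tm]) (simp add: grid_def)
    show "(\<lambda>n. T x (grid n \<omega>)) \<longlonglongrightarrow> T x \<omega>" for \<omega> by (rule isCont_tendsto_compose[OF c[OF x] grid_tendsto])
  qed (use b x in auto)
  ultimately show "(\<lambda>n. \<Psi> n (\<lambda>j. T x (real_of_int j / real (Suc n)))) \<longlonglongrightarrow> Bcontfun (synthesis F (T x))" by simp
qed

text \<open>A bounded continuous function on a metric space need not be uniformly continuous. It is
  so near a compact set, even when only one of the two points lies in the set; the compact set will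
  consist of the translates of the source by bounded shifts.\<close>

lemma continuous_near_compact:
  fixes \<phi> :: "'a :: metric_space \<Rightarrow> real"
  assumes \<phi>: "continuous_on UNIV \<phi>" and K: "compact K" and \<eta>: "0 < \<eta>"
  shows "\<exists>\<delta>>0. \<forall>y\<in>K. \<forall>x. dist x y < \<delta> \<longrightarrow> \<bar>\<phi> x - \<phi> y\<bar> < \<eta>"
proof (rule ccontr)
  assume "\<not> ?thesis"
  hence "\<exists>y x. y \<in> K \<and> dist x y < 1 / real (Suc n) \<and> \<eta> \<le> \<bar>\<phi> x - \<phi> y\<bar>" for n
    by (metis not_less of_nat_0_less_iff zero_less_Suc zero_less_divide_1_iff)
  then obtain y x where xy: "\<And>n. y n \<in> K" "\<And>n. dist (x n) (y n) < 1 / real (Suc n)" "\<And>n. \<eta> \<le> \<bar>\<phi> (x n) - \<phi> (y n)\<bar>"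
    by metis
  from K xy(1) obtain l r where r: "strict_mono r" "(y \<circ> r) \<longlonglongrightarrow> l"
    unfolding compact_def by meson
  have "(\<lambda>n. dist (x n) (y n)) \<longlonglongrightarrow> 0"
    by (rule tendsto_sandwich[OF _ _ tendsto_const LIMSEQ_Suc[OF lim_1_over_n]])
      (use xy(2) in \<open>auto intro!: always_eventually less_imp_le simp del: of_nat_Suc\<close>)
  from LIMSEQ_subseq_LIMSEQ[OF this r(1)] have d: "(\<lambda>n. dist (x (r n)) (y (r n))) \<longlonglongrightarrow> 0" by (simp add: o_def)
  have y: "(\<lambda>n. y (r n)) \<longlonglongrightarrow> l" using r(2) by (simp add: o_def)
  have "(\<lambda>n. dist (x (r n)) l) \<longlonglongrightarrow> 0"
  proof (rule tendsto_sandwich[OF _ _ tendsto_const])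
    show "(\<lambda>n. dist (x (r n)) (y (r n)) + dist (y (r n)) l) \<longlonglongrightarrow> 0"
      using tendsto_add[OF d tendsto_dist_iff[THEN iffD1, OF y]] by simp
  qed (auto intro!: always_eventually dist_triangle)
  hence x: "(\<lambda>n. x (r n)) \<longlonglongrightarrow> l" by (rule tendsto_dist_iff[THEN iffD2])
  have c: "isCont \<phi> l" using \<phi> by (simp add: continuous_on_eq_continuous_at)
  have "(\<lambda>n. \<bar>\<phi> (x (r n)) - \<phi> (y (r n))\<bar>) \<longlonglongrightarrow> \<bar>\<phi> l - \<phi> l\<bar>"
    by (intro tendsto_intros isCont_tendsto_compose[OF c] x y)
  hence "\<eta> \<le> \<bar>\<phi> l - \<phi> l\<bar>" by (rule LIMSEQ_le_const) (use xy(3) in auto)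
  thus False using \<eta> by simp
qed

section \<open>Convergence of the transmitted wave\<close>

text \<open>Singularities of different orders are brought to the largest exponent \<open>g\<close>.
  On a bounded interval this costs a constant, since g - \<gamma> lies between 0 and 1.\<close>

lemma powr_minus_le_powr_minus:
  fixes d Z \<gamma> g :: real
  assumes "0 < d" "d \<le> Z" "0 < \<gamma>" "\<gamma> \<le> g" "g < 1"
  shows "d powr (- \<gamma>) \<le> max 1 Z * d powr (- g)"
proof -
  have "d powr (g - \<gamma>) \<le> max 1 Z powr (g - \<gamma>)" using assms by (intro powr_mono2) auto
  also have "\<dots> \<le> max 1 Z powr 1" using assms by (intro powr_mono) auto
  finally have "d powr (g - \<gamma>) \<le> max 1 Z" using assms by simp
  hence "d powr (g - \<gamma>) * d powr (- g) \<le> max 1 Z * d powr (- g)" by (intro mult_right_mono) auto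
  thus ?thesis by (simp add: powr_add[symmetric])
qed

text \<open>(A2) with tolerance 1 bounds the covariance at distances beyond \<epsilon>^\<lambda> z1
  and (A3) covers the shorter ones; together they give one dominating kernel for all \<epsilon>.
  Convergence off the diagonal follows from (A2) alone, as the excluded range shrinks to 0 for each
  tolerance.\<close>

lemma cov_dominated_and_convergent:
  fixes M :: "real \<Rightarrow> 'a measure"
  assumes Z: "0 < Z" and lam: "0 < lam" and A2: "cond_A2 Z M \<nu> lam" and A3: "cond_A3 Z M \<nu> lam"
    and ps: "\<And>\<epsilon>. \<epsilon> > 0 \<Longrightarrow> prob_space (M \<epsilon>)" and cm: "\<And>\<epsilon>. \<epsilon> > 0 \<Longrightarrow> centered_medium_process Z (M \<epsilon>) (\<nu> \<epsilon>)"
  obtains C \<gamma> K0 where "\<And>\<epsilon>. \<epsilon> > 0 \<Longrightarrow> medium_bound (M \<epsilon>) Z (\<nu> \<epsilon>) C \<gamma>"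
    "\<And>t2. t2 \<in> {0..Z} \<Longrightarrow> continuous_on ({0..Z} - {t2}) (\<lambda>t1. K0 t1 t2)"
    "\<And>S t1 t2. (\<And>n. 0 < S n) \<Longrightarrow> S \<longlonglongrightarrow> 0 \<Longrightarrow> t1 \<in> {0..Z} \<Longrightarrow> t2 \<in> {0..Z} \<Longrightarrow> t1 \<noteq> t2 \<Longrightarrow>
       (\<lambda>n. medium.cov (M (S n)) (\<nu> (S n)) t1 t2) \<longlonglongrightarrow> K0 t1 t2"
proof -
  have med: "medium (M \<epsilon>) Z (\<nu> \<epsilon>)" if "\<epsilon> > 0" for \<epsilon>
    using ps[OF that] cm[OF that] Z by (intro medium.intro medium_axioms.intro)
  have cov_eq: "medium.cov (M \<epsilon>) (\<nu> \<epsilon>) t1 t2 = (\<integral>x. \<nu> \<epsilon> t1 x * \<nu> \<epsilon> t2 x \<partial>M \<epsilon>)" if "\<epsilon> > 0" for \<epsilon> t1 t2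
    by (rule medium.cov_def[OF med[OF that]])
  obtain \<gamma> R \<gamma>min \<gamma>max where \<gamma>m: "0 < \<gamma>min" "\<gamma>max < 1"
    and c\<gamma>: "continuous_on ({0..Z} \<times> {0..Z}) (\<lambda>(z1, z2). \<gamma> z1 z2)"
    and cR: "continuous_on ({0..Z} \<times> {0..Z}) (\<lambda>(z1, z2). R z1 z2)"
    and \<gamma>R: "\<And>z1 z2. z1 \<in> {0..Z} \<Longrightarrow> z2 \<in> {0..Z} \<Longrightarrow> \<gamma> z1 z2 \<in> {\<gamma>min..\<gamma>max} \<and> R z1 z2 > 0"
    and lim: "\<And>\<delta>. \<delta> > 0 \<Longrightarrow> \<exists>z\<delta>>0. \<forall>z1\<in>{0..Z}. \<forall>z2\<in>{0..Z}. \<forall>\<epsilon>>0.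
           \<bar>z1 - z2\<bar> > \<epsilon> powr lam * z\<delta> \<longrightarrow>
           \<bar>(\<integral>x. \<nu> \<epsilon> z1 x * \<nu> \<epsilon> z2 x \<partial>M \<epsilon>) - R z1 z2 * \<bar>z1 - z2\<bar> powr (- \<gamma> z1 z2)\<bar>
             \<le> \<delta> * (R z1 z2 * \<bar>z1 - z2\<bar> powr (- \<gamma> z1 z2))"
    using A2 unfolding cond_A2_def by (elim exE conjE) blast
  define K0 where "K0 t1 t2 = R t1 t2 * \<bar>t1 - t2\<bar> powr (- \<gamma> t1 t2)" for t1 t2
  have K0: "0 \<le> K0 t1 t2" if "t1 \<in> {0..Z}" "t2 \<in> {0..Z}" for t1 t2
    using \<gamma>R[OF that] unfolding K0_def by simp
  obtain z1 where z1: "z1 > 0" and far: "\<And>t1 t2 \<epsilon>. t1 \<in> {0..Z} \<Longrightarrow> t2 \<in> {0..Z} \<Longrightarrow> \<epsilon> > 0 \<Longrightarrow> \<bar>t1 - t2\<bar> > \<epsilon> powr lam * z1 \<Longrightarrow>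
      \<bar>(\<integral>x. \<nu> \<epsilon> t1 x * \<nu> \<epsilon> t2 x \<partial>M \<epsilon>) - K0 t1 t2\<bar> \<le> 1 * K0 t1 t2"
    using lim[of 1] unfolding K0_def by auto
  \<comment> \<open>Both conditions use strict inequalities, so (A3) is taken at twice the threshold
    to include the distance exactly at it.\<close>
  have "0 < 2 * z1" using z1 by simp
  from A3[unfolded cond_A3_def, THEN spec, THEN mp, OF this]
  obtain C3 \<gamma>3 where C3: "C3 > 0" and \<gamma>3: "\<gamma>3 \<in> {0<..<1}" and near': "\<forall>\<epsilon>>0. \<forall>t1\<in>{0..Z}. \<forall>t2\<in>{0..Z}.
      t1 \<noteq> t2 \<and> \<bar>t1 - t2\<bar> < \<epsilon> powr lam * (2 * z1) \<longrightarrow> \<bar>\<integral>x. \<nu> \<epsilon> t1 x * \<nu> \<epsilon> t2 x \<partial>M \<epsilon>\<bar> \<le> C3 * \<bar>t1 - t2\<bar> powr (- \<gamma>3)"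
    by blast
  have near: "\<bar>\<integral>x. \<nu> \<epsilon> t1 x * \<nu> \<epsilon> t2 x \<partial>M \<epsilon>\<bar> \<le> C3 * \<bar>t1 - t2\<bar> powr (- \<gamma>3)"
    if "t1 \<in> {0..Z}" "t2 \<in> {0..Z}" "\<epsilon> > 0" "t1 \<noteq> t2" "\<bar>t1 - t2\<bar> < \<epsilon> powr lam * (2 * z1)" for t1 t2 \<epsilon>
    using near'[rule_format, OF that(3,1,2)] that(4,5) by simp
  have "compact ((\<lambda>(z1, z2). R z1 z2) ` ({0..Z} \<times> {0..Z}))"
    by (intro compact_continuous_image cR compact_Times) auto
  from compact_imp_bounded[OF this]
  obtain Rm where Rm': "\<And>w. w \<in> (\<lambda>(z1, z2). R z1 z2) ` ({0..Z} \<times> {0..Z}) \<Longrightarrow> \<bar>w\<bar> \<le> Rm"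
    unfolding bounded_real by blast
  have Rm: "R t1 t2 \<le> Rm" if "t1 \<in> {0..Z}" "t2 \<in> {0..Z}" for t1 t2
  proof -
    have "R t1 t2 \<in> (\<lambda>(z1, z2). R z1 z2) ` ({0..Z} \<times> {0..Z})"
      by (rule image_eqI[of _ _ "(t1, t2)"]) (use that in auto)
    from Rm'[OF this] show ?thesis by linarith
  qed
  have Rm0: "0 \<le> Rm"
  proof -
    have "(0::real) \<in> {0..Z}" using Z by simp
    from Rm[OF this this] \<gamma>R[OF this this] show ?thesis by linarith
  qed
  define g where "g = max \<gamma>max \<gamma>3"
  define W where "W = max 1 Z"
  have g: "g < 1" "0 < g" using \<gamma>m \<gamma>3 unfolding g_def by auto
  \<comment> \<open>Twice \<open>Rm\<close> because tolerance 1 allows the covariance up to twice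
    its limit, \<open>C3\<close> for the short distances, and \<open>W\<close> for the change of
    exponents.\<close>
  define C where "C = (2 * Rm + C3) * W"
  have W: "1 \<le> W" unfolding W_def by simp
  show thesis
  proof (rule that)
    fix \<epsilon> :: real assume \<epsilon>: "\<epsilon> > 0"
    interpret medium "M \<epsilon>" Z "\<nu> \<epsilon>" by (rule med[OF \<epsilon>])
    show "medium_bound (M \<epsilon>) Z (\<nu> \<epsilon>) C g"
    proof
      show "g < 1" by (rule g)
      show "0 \<le> C" unfolding C_def using Rm0 C3 W by simp
      fix t1 t2 assume t: "t1 \<in> {0..Z}" "t2 \<in> {0..Z}" "t1 \<noteq> t2"
      have d: "0 < \<bar>t1 - t2\<bar>" "\<bar>t1 - t2\<bar> \<le> Z" using t by auto
      have dg: "0 \<le> \<bar>t1 - t2\<bar> powr (- g)" by simp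
      show "\<bar>cov t1 t2\<bar> \<le> C * \<bar>t1 - t2\<bar> powr (- g)"
      proof (cases "\<bar>t1 - t2\<bar> > \<epsilon> powr lam * z1")
        case True
        have "\<bar>t1 - t2\<bar> powr (- \<gamma> t1 t2) \<le> W * \<bar>t1 - t2\<bar> powr (- g)"
          unfolding W_def using \<gamma>R[OF t(1,2)] \<gamma>m g(1) unfolding g_def by (intro powr_minus_le_powr_minus d) auto
        hence "K0 t1 t2 \<le> Rm * (W * \<bar>t1 - t2\<bar> powr (- g))"
          unfolding K0_def using Rm[OF t(1,2)] Rm0 by (intro mult_mono) auto
        moreover have "\<bar>cov t1 t2\<bar> \<le> 2 * K0 t1 t2"
          using far[OF t(1,2) \<epsilon> True] K0[OF t(1,2)] unfolding cov_def by linarith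
        moreover have "2 * (Rm * (W * \<bar>t1 - t2\<bar> powr (- g))) \<le> C * \<bar>t1 - t2\<bar> powr (- g)"
          unfolding C_def using C3 W dg by (simp add: algebra_simps)
        ultimately show ?thesis by linarith
      next
        case False
        have "0 < \<epsilon> powr lam * z1" using \<epsilon> z1 by simp
        hence "\<bar>t1 - t2\<bar> < \<epsilon> powr lam * (2 * z1)" using False by linarith
        from near[OF t(1,2) \<epsilon> t(3) this]
        have "\<bar>cov t1 t2\<bar> \<le> C3 * \<bar>t1 - t2\<bar> powr (- \<gamma>3)" unfolding cov_def .
        also have "\<dots> \<le> C3 * (W * \<bar>t1 - t2\<bar> powr (- g))"
          unfolding W_def using \<gamma>3 g(1) C3 unfolding g_def by (intro mult_left_mono powr_minus_le_powr_minus d) auto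
        also have "\<dots> \<le> C * \<bar>t1 - t2\<bar> powr (- g)"
          unfolding C_def using Rm0 W dg by (simp add: algebra_simps)
        finally show ?thesis .
      qed
    qed
  next
    fix t2 assume t2: "t2 \<in> {0..Z}"
    have p: "continuous_on ({0..Z} - {t2}) (\<lambda>t1. (t1, t2))" by (intro continuous_intros)
    have "(\<lambda>t1. (t1, t2)) ` ({0..Z} - {t2}) \<subseteq> {0..Z} \<times> {0..Z}" using t2 by auto
    with continuous_on_compose2[OF cR p] continuous_on_compose2[OF c\<gamma> p]
    have 1: "continuous_on ({0..Z} - {t2}) (\<lambda>t1. R t1 t2)" "continuous_on ({0..Z} - {t2}) (\<lambda>t1. \<gamma> t1 t2)"
      by simp_all
    show "continuous_on ({0..Z} - {t2}) (\<lambda>t1. K0 t1 t2)"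
      unfolding K0_def by (intro continuous_intros 1) auto
  next
    fix S :: "nat \<Rightarrow> real" and t1 t2 assume S: "\<And>n. 0 < S n" "S \<longlonglongrightarrow> 0" and t: "t1 \<in> {0..Z}" "t2 \<in> {0..Z}" "t1 \<noteq> t2"
    have pos: "0 < K0 t1 t2" unfolding K0_def using \<gamma>R[OF t(1,2)] t(3) by simp
    show "(\<lambda>n. medium.cov (M (S n)) (\<nu> (S n)) t1 t2) \<longlonglongrightarrow> K0 t1 t2"
    proof (rule tendstoI)
      fix e :: real assume e: "0 < e"
      define \<delta> where "\<delta> = e / (2 * K0 t1 t2)"
      have \<delta>: "0 < \<delta>" unfolding \<delta>_def using e pos by simp
      obtain zd where zd: "zd > 0" and le: "\<And>\<epsilon>. \<epsilon> > 0 \<Longrightarrow> \<bar>t1 - t2\<bar> > \<epsilon> powr lam * zd \<Longrightarrow>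
          \<bar>(\<integral>x. \<nu> \<epsilon> t1 x * \<nu> \<epsilon> t2 x \<partial>M \<epsilon>) - K0 t1 t2\<bar> \<le> \<delta> * K0 t1 t2"
        using lim[OF \<delta>] t unfolding K0_def by auto
      have "(\<lambda>n. S n powr lam) \<longlonglongrightarrow> 0"
        by (rule tendsto_zero_powrI[OF S(2) tendsto_const _ lam]) (use S(1) in \<open>auto intro: always_eventually less_imp_le\<close>)
      hence "(\<lambda>n. S n powr lam * zd) \<longlonglongrightarrow> 0" by (rule tendsto_mult_left_zero)
      hence "\<forall>\<^sub>F n in sequentially. S n powr lam * zd < \<bar>t1 - t2\<bar>"
        by (rule order_tendstoD) (use t in auto)
      thus "\<forall>\<^sub>F n in sequentially. dist (medium.cov (M (S n)) (\<nu> (S n)) t1 t2) (K0 t1 t2) < e"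
      proof eventually_elim
        case (elim n)
        have "\<bar>medium.cov (M (S n)) (\<nu> (S n)) t1 t2 - K0 t1 t2\<bar> \<le> \<delta> * K0 t1 t2"
          unfolding cov_eq[OF S(1)] by (rule le[OF S(1)]) (use elim in simp)
        also have "\<dots> = e / 2" unfolding \<delta>_def using pos by simp
        finally show ?case using e by (simp add: dist_real_def)
      qed
    qed
  qed
qed

section \<open>The transmitted wave as a random function\<close>

context medium
begin

definition transmission :: "real \<Rightarrow> real \<Rightarrow> 'a \<Rightarrow> real \<Rightarrow> complex" where
  "transmission \<tau> \<epsilon> x \<omega> = transmission_coeff Z \<tau> \<epsilon> (\<lambda>z. \<nu> z x) \<omega> Z"

lemma transmission_eq:
  assumes "x \<in> space M"
  shows "transmission \<tau> \<epsilon> x \<omega> = iexp (\<omega> / 2 * drift (\<lambda>z. \<nu> z x) Z) * cnj (reduced_transmission Z \<tau> \<epsilon> (\<lambda>z. \<nu> z x) \<omega>)"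
  unfolding transmission_def reduced_transmission_def by (rule transmission_coeff_eq[OF Z path[OF assms]])

lemma isCont_transmission: "x \<in> space M \<Longrightarrow> isCont (transmission \<tau> \<epsilon> x) \<omega>"
proof -
  assume x: "x \<in> space M"
  have "isCont (\<lambda>\<omega>. iexp (\<omega> / 2 * drift (\<lambda>z. \<nu> z x) Z) * cnj (reduced_transmission Z \<tau> \<epsilon> (\<lambda>z. \<nu> z x) \<omega>)) \<omega>"
    using Z by (intro continuous_intros isCont_reduced_transmission path x) auto
  thus ?thesis using transmission_eq[OF x] by presburger
qed

lemma norm_transmission_le: "x \<in> space M \<Longrightarrow> norm (transmission \<tau> \<epsilon> x \<omega>) \<le> 1"
  using norm_reduced_transmission_le[OF _ path] Z by (simp add: transmission_eq norm_mult)

lemma drift_measurable: "(\<lambda>x. drift (\<lambda>z. \<nu> z x) Z) \<in> borel_measurable M"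
proof -
  have "(\<lambda>x. Re (osc 0 (\<lambda>z. \<nu> z x) Z)) \<in> borel_measurable M"
  proof -
    have [measurable]: "(\<lambda>x. osc 0 (\<lambda>z. \<nu> z x) Z) \<in> borel_measurable M" by (rule borel_measurable_osc) (use Z in auto)
    show ?thesis by measurable
  qed
  thus ?thesis by (simp add: osc_0)
qed

lemma transmission_measurable: "(\<lambda>x. transmission \<tau> \<epsilon> x \<omega>) \<in> borel_measurable M"
proof (subst measurable_cong[OF transmission_eq])
  have [measurable]: "(\<lambda>x. drift (\<lambda>z. \<nu> z x) Z) \<in> borel_measurable M" by (rule drift_measurable)
  have [measurable]: "(\<lambda>x. cnj (reduced_transmission Z \<tau> \<epsilon> (\<lambda>z. \<nu> z x) \<omega>)) \<in> borel_measurable M"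
    by (rule measurable_compose[OF borel_measurable_reduced_transmission borel_measurable_continuous_onI])
      (intro continuous_intros)
  show "(\<lambda>x. iexp (\<omega> / 2 * drift (\<lambda>z. \<nu> z x) Z) * cnj (reduced_transmission Z \<tau> \<epsilon> (\<lambda>z. \<nu> z x) \<omega>)) \<in> borel_measurable M"
    by measurable
qed

lemma transmitted_wave_eq_synthesis:
  "transmitted_wave Z \<tau> f \<epsilon> (\<lambda>z. \<nu> z x) = synthesis (source_fourier f) (transmission \<tau> \<epsilon> x)"
  unfolding transmitted_wave_def synthesis_def transmission_def by (rule ext) simp

lemma transmission_borel: "x \<in> space M \<Longrightarrow> transmission \<tau> \<epsilon> x \<in> borel_measurable borel"
  by (intro borel_measurable_continuous_onI continuous_at_imp_continuous_on ballI isCont_transmission)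

end

definition shifted_source :: "(real \<Rightarrow> real) \<Rightarrow> real \<Rightarrow> real \<Rightarrow>\<^sub>C complex" where
  "shifted_source f v = Bcontfun (\<lambda>s. complex_of_real (f (s - 1 / 2 * v)))"

lemma shifted_source_eq_synthesis:
  assumes "source_function f"
  shows "(\<lambda>s. complex_of_real (f (s - 1 / 2 * v))) = synthesis (source_fourier f) (\<lambda>\<omega>. iexp (\<omega> / 2 * v))"
proof
  fix s
  have "exp (- \<i> * complex_of_real (s * \<omega>)) * iexp (\<omega> / 2 * v) = exp (- (\<i> * complex_of_real ((s - 1 / 2 * v) * \<omega>)))" for \<omega>
    unfolding exp_add[symmetric] by (simp add: algebra_simps)
  hence "synthesis (source_fourier f) (\<lambda>\<omega>. iexp (\<omega> / 2 * v)) s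
    = 1 / (2 * complex_of_real pi) * complex_of_real (2 * pi * f (s - 1 / 2 * v))"
    unfolding synthesis_def by (simp only: fourier_inversion[OF assms])
  thus "complex_of_real (f (s - 1 / 2 * v)) = synthesis (source_fourier f) (\<lambda>\<omega>. iexp (\<omega> / 2 * v)) s"
    by simp
qed

lemma phase_borel: "(\<lambda>\<omega>. iexp (\<omega> / 2 * v)) \<in> borel_measurable borel"
  by (intro borel_measurable_continuous_onI continuous_intros) auto

lemma shifted_source_bcontfun:
  assumes "source_function f"
  shows "(\<lambda>s. complex_of_real (f (s - 1 / 2 * v))) \<in> bcontfun"
  unfolding shifted_source_eq_synthesis[OF assms]
  by (intro synthesis_bcontfun phase_borel) (use assms in \<open>auto simp: source_function_def\<close>)

text \<open>By Fourier inversion a translation is multiplication by a phase, so continuity in the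
  uniform norm is dominated convergence in frequency.\<close>

lemma continuous_on_shifted_source:
  assumes "source_function f"
  shows "continuous_on UNIV (shifted_source f)"
  unfolding continuous_on_sequentially
proof (intro allI ballI impI, elim conjE)
  fix v :: "nat \<Rightarrow> real" and v' assume v: "v \<longlonglongrightarrow> v'"
  show "(shifted_source f \<circ> v) \<longlonglongrightarrow> shifted_source f v'"
    unfolding shifted_source_def o_def shifted_source_eq_synthesis[OF assms]
    by (intro synthesis_tendsto phase_borel tendsto_intros v) (use assms in \<open>auto simp: source_function_def\<close>)
qed

section \<open>Comparison of the wave with the shifted source\<close>

context medium_bound
begin

text \<open>The oscillating path at frequency 0 over the whole slab. The bound is uniform in
  \<epsilon> and confines the shift to a compact interval up to small probability.\<close>

lemma drift_second_moment:
  "integrable M (\<lambda>x. (drift (trajectory x) Z)\<^sup>2)" "(\<integral>x. (drift (trajectory x) Z)\<^sup>2 \<partial>M) \<le> energy_const"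
proof -
  have "ennreal (norm (LINT p|lborel2. osc_cov 0 0 Z p)) \<le> ennreal energy_const"
    using norm_integral_osc_cov_le[of 0 Z 0] Z unfolding energy_const_def by (intro ennreal_leI) simp
  with second_moment_osc[of 0 Z 0] Z
  have le: "(\<integral>\<^sup>+ x. ennreal ((drift (trajectory x) Z)\<^sup>2) \<partial>M) \<le> ennreal energy_const"
    by (simp add: osc_0 drift_0)
  show i: "integrable M (\<lambda>x. (drift (trajectory x) Z)\<^sup>2)"
  proof (rule integrableI_bounded)
    show "(\<lambda>x. (drift (trajectory x) Z)\<^sup>2) \<in> borel_measurable M"
      by (intro borel_measurable_power drift_measurable)
    show "(\<integral>\<^sup>+ x. ennreal (norm ((drift (trajectory x) Z)\<^sup>2)) \<partial>M) < \<infinity>"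
      using le by (simp add: le_less_trans)
  qed
  show "(\<integral>x. (drift (trajectory x) Z)\<^sup>2 \<partial>M) \<le> energy_const"
    using le by (subst (asm) nn_integral_eq_integral[OF i]) (auto simp: ennreal_le_iff energy_const_nonneg)
qed

text \<open>Exchanges expectation and integration over frequencies, so that the convergence of the
  mean defect at each single frequency is sufficient.\<close>

lemma weighted_defect:
  fixes F :: "real \<Rightarrow> complex" and \<tau> \<epsilon> :: real
  assumes F: "integrable lborel F"
  defines "q \<equiv> \<lambda>x \<omega>. norm (reduced_transmission Z \<tau> \<epsilon> (trajectory x) \<omega> - 1)"
  shows "integrable M (\<lambda>x. LINT \<omega>|lborel. q x \<omega> * norm (F \<omega>))"
    "(\<integral>x. (LINT \<omega>|lborel. q x \<omega> * norm (F \<omega>)) \<partial>M) = (LINT \<omega>|lborel. (\<integral>x. q x \<omega> \<partial>M) * norm (F \<omega>))"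
    "(\<lambda>\<omega>. \<integral>x. q x \<omega> \<partial>M) \<in> borel_measurable borel"
proof -
  have Fm [measurable]: "F \<in> borel_measurable borel" using F by auto
  have [measurable]: "(\<lambda>p. reduced_transmission Z \<tau> \<epsilon> (trajectory (snd p)) (fst p)) \<in> borel_measurable (lborel \<Otimes>\<^sub>M M)"
    by (rule joint_measurable_of_continuous) (use isCont_reduced_transmission[OF _ path] Z borel_measurable_reduced_transmission in auto)
  have qm [measurable]: "(\<lambda>p. q (snd p) (fst p)) \<in> borel_measurable (lborel \<Otimes>\<^sub>M M)"
    unfolding q_def by measurable
  have "(\<lambda>\<omega>. \<integral>x. q x \<omega> \<partial>M) \<in> borel_measurable lborel"
    by (rule borel_measurable_lebesgue_integral) (use qm in \<open>simp add: case_prod_unfold\<close>)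
  thus Em: "(\<lambda>\<omega>. \<integral>x. q x \<omega> \<partial>M) \<in> borel_measurable borel" by simp
  have qi: "integrable M (\<lambda>x. q x \<omega>)" for \<omega> unfolding q_def by (rule integrable_transmission_defect)
  have q0: "0 \<le> q x \<omega>" for x \<omega> unfolding q_def by simp
  have q2: "(\<integral>x. q x \<omega> \<partial>M) \<le> 2" for \<omega>
  proof -
    have "(\<integral>x. q x \<omega> \<partial>M) \<le> (\<integral>x. 2 \<partial>M)"
      unfolding q_def using norm_reduced_transmission_minus_1_le integrable_transmission_defect by (intro integral_mono) auto
    thus ?thesis by (simp add: prob_space)
  qed
  interpret P: pair_sigma_finite "lborel :: real measure" M
    by (intro pair_sigma_finite.intro sigma_finite_lborel sigma_finite_measure_axioms)
  define G where "G \<omega> x = q x \<omega> * norm (F \<omega>)" for \<omega> x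
  have "integrable (lborel \<Otimes>\<^sub>M M) (case_prod G)"
  proof (rule P.Fubini_integrable)
    show "case_prod G \<in> borel_measurable (lborel \<Otimes>\<^sub>M M)" unfolding G_def case_prod_unfold by measurable
    show "AE \<omega> in lborel. integrable M (\<lambda>x. case_prod G (\<omega>, x))"
      unfolding G_def prod.case using qi by (intro AE_I2 integrable_mult_left)
    show "integrable lborel (\<lambda>\<omega>. \<integral>x. norm (case_prod G (\<omega>, x)) \<partial>M)"
    proof (rule Bochner_Integration.integrable_bound)
      show "integrable lborel (\<lambda>\<omega>. 2 * norm (F \<omega>))" using F by (intro integrable_mult_right integrable_norm)
      have eq: "(\<integral>x. norm (case_prod G (\<omega>, x)) \<partial>M) = (\<integral>x. q x \<omega> \<partial>M) * norm (F \<omega>)" for \<omega>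
        unfolding G_def prod.case using q0 by (simp add: abs_mult)
      show "(\<lambda>\<omega>. \<integral>x. norm (case_prod G (\<omega>, x)) \<partial>M) \<in> borel_measurable lborel"
        unfolding eq using Em by measurable
      show "AE \<omega> in lborel. norm (\<integral>x. norm (case_prod G (\<omega>, x)) \<partial>M) \<le> norm (2 * norm (F \<omega>))"
        unfolding eq using q2 q0 by (intro AE_I2) (simp add: abs_mult Bochner_Integration.integral_nonneg mult_right_mono)
    qed
  qed
  note i = this
  show "integrable M (\<lambda>x. LINT \<omega>|lborel. q x \<omega> * norm (F \<omega>))"
    using P.integrable_snd[OF i] unfolding G_def .
  show "(\<integral>x. (LINT \<omega>|lborel. q x \<omega> * norm (F \<omega>)) \<partial>M) = (LINT \<omega>|lborel. (\<integral>x. q x \<omega> \<partial>M) * norm (F \<omega>))"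
    using P.Fubini_integral[OF i] unfolding G_def by simp
qed

text \<open>Both multipliers carry the same unimodular phase; it cancels from the modulus of the
  difference and leaves the defect of the reduced transmission.\<close>

lemma dist_wave_le:
  assumes f: "source_function f" and x: "x \<in> space M"
  shows "dist (Bcontfun (synthesis (source_fourier f) (transmission \<tau> \<epsilon> x))) (shifted_source f (drift (trajectory x) Z))
     \<le> (LINT \<omega>|lborel. norm (reduced_transmission Z \<tau> \<epsilon> (trajectory x) \<omega> - 1) * norm (source_fourier f \<omega>))"
proof -
  have F: "integrable lborel (source_fourier f)" using f by (simp add: source_function_def)
  have "norm (transmission \<tau> \<epsilon> x \<omega> - iexp (\<omega> / 2 * drift (trajectory x) Z)) = norm (reduced_transmission Z \<tau> \<epsilon> (trajectory x) \<omega> - 1)" for \<omega>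
  proof -
    have "transmission \<tau> \<epsilon> x \<omega> - iexp (\<omega> / 2 * drift (trajectory x) Z)
      = iexp (\<omega> / 2 * drift (trajectory x) Z) * cnj (reduced_transmission Z \<tau> \<epsilon> (trajectory x) \<omega> - 1)"
      unfolding transmission_eq[OF x] by (simp add: algebra_simps)
    thus ?thesis by (simp only: norm_mult norm_exp_i_times mult_1 complex_mod_cnj)
  qed
  with dist_synthesis_le[OF F transmission_borel[OF x] norm_transmission_le[OF x] phase_borel, of "drift (trajectory x) Z" \<tau> \<epsilon>]
  show ?thesis unfolding shifted_source_def shifted_source_eq_synthesis[OF f] by simp
qed

lemma wave_measurable:
  assumes "source_function f"
  shows "(\<lambda>x. Bcontfun (synthesis (source_fourier f) (transmission \<tau> \<epsilon> x))) \<in> borel_measurable M"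
  by (rule synthesis_measurable) (use assms isCont_transmission transmission_measurable norm_transmission_le in \<open>auto simp: source_function_def\<close>)

text \<open>Two Markov inequalities, written pointwise: V^2 / R^2 is at least 1 where the shift is
  large, and d / \<delta> where the wave is far from the shifted source. There \<phi> varies by at
  most 2 B; elsewhere \<open>uc\<close> applies.\<close>

lemma expectation_difference_le:
  fixes \<phi> :: "(real \<Rightarrow>\<^sub>C complex) \<Rightarrow> real"
  assumes f: "source_function f" and \<phi>: "continuous_on UNIV \<phi>" "\<And>u. \<bar>\<phi> u\<bar> \<le> B"
    and R: "0 < R" and \<delta>: "0 < \<delta>"
    and uc: "\<And>v u. \<bar>v\<bar> \<le> R \<Longrightarrow> dist u (shifted_source f v) < \<delta> \<Longrightarrow> \<bar>\<phi> u - \<phi> (shifted_source f v)\<bar> < \<eta>"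
  shows "\<bar>(\<integral>x. \<phi> (Bcontfun (synthesis (source_fourier f) (transmission \<tau> \<epsilon> x))) \<partial>M) - (\<integral>x. \<phi> (shifted_source f (drift (trajectory x) Z)) \<partial>M)\<bar>
    \<le> \<eta> + 2 * B * (energy_const / R\<^sup>2 + (LINT \<omega>|lborel. (\<integral>x. norm (reduced_transmission Z \<tau> \<epsilon> (trajectory x) \<omega> - 1) \<partial>M) * norm (source_fourier f \<omega>)) / \<delta>)"
proof -
  have F: "integrable lborel (source_fourier f)" using f by (simp add: source_function_def)
  define X where "X x = Bcontfun (synthesis (source_fourier f) (transmission \<tau> \<epsilon> x))" for x
  define Y where "Y x = shifted_source f (drift (trajectory x) Z)" for x
  define d where "d x = (LINT \<omega>|lborel. norm (reduced_transmission Z \<tau> \<epsilon> (trajectory x) \<omega> - 1) * norm (source_fourier f \<omega>))" for x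
  define V where "V x = drift (trajectory x) Z" for x
  note wd = weighted_defect[OF F, of \<tau> \<epsilon>, folded d_def]
  have \<phi>m: "\<phi> \<in> borel_measurable borel" by (rule borel_measurable_continuous_onI[OF \<phi>(1)])
  have B0: "0 \<le> B" using \<phi>(2)[of undefined] by linarith
  have d0: "0 \<le> d x" for x unfolding d_def by (rule Bochner_Integration.integral_nonneg) simp
  \<comment> \<open>The sign of \<eta> is obtained from \<open>uc\<close> at distance 0.\<close>
  have \<eta>0: "0 < \<eta>" using uc[of 0 "shifted_source f 0"] R \<delta> by simp
  have Xm: "X \<in> borel_measurable M" unfolding X_def by (rule wave_measurable[OF f])
  have Ym: "Y \<in> borel_measurable M" unfolding Y_def
    by (rule measurable_compose[OF drift_measurable borel_measurable_continuous_onI[OF continuous_on_shifted_source[OF f]]])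
  have iX: "integrable M (\<lambda>x. \<phi> (X x))" and iY: "integrable M (\<lambda>x. \<phi> (Y x))"
    using \<phi>(2) measurable_compose[OF Xm \<phi>m] measurable_compose[OF Ym \<phi>m]
    by (auto intro!: integrable_const_bound[where B=B])
  have iV: "integrable M (\<lambda>x. (V x)\<^sup>2)" unfolding V_def by (rule drift_second_moment(1))
  have pw: "\<bar>\<phi> (X x) - \<phi> (Y x)\<bar> \<le> \<eta> + 2 * B * ((V x)\<^sup>2 / R\<^sup>2 + d x / \<delta>)" if x: "x \<in> space M" for x
  proof (cases "\<bar>V x\<bar> \<le> R \<and> d x < \<delta>")
    case True
    hence "dist (X x) (Y x) < \<delta>" using dist_wave_le[OF f x, of \<tau> \<epsilon>] unfolding X_def Y_def d_def by linarith
    hence "\<bar>\<phi> (X x) - \<phi> (Y x)\<bar> < \<eta>" using True uc[of "V x" "X x"] unfolding Y_def V_def by blast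
    moreover have "0 \<le> 2 * B * ((V x)\<^sup>2 / R\<^sup>2 + d x / \<delta>)" using B0 d0[of x] \<delta> by simp
    ultimately show ?thesis by linarith
  next
    case False
    have "1 \<le> (V x)\<^sup>2 / R\<^sup>2 + d x / \<delta>"
    proof (cases "\<bar>V x\<bar> \<le> R")
      case True
      hence "1 \<le> d x / \<delta>" using False \<delta> by simp
      thus ?thesis by (simp add: add_increasing)
    next
      case False
      hence "R\<^sup>2 \<le> \<bar>V x\<bar>\<^sup>2" using R by (intro power_mono) auto
      hence "1 \<le> (V x)\<^sup>2 / R\<^sup>2" using R by simp
      thus ?thesis using d0[of x] \<delta> by (simp add: add_increasing2)
    qed
    hence "2 * B * 1 \<le> 2 * B * ((V x)\<^sup>2 / R\<^sup>2 + d x / \<delta>)" using B0 by (intro mult_left_mono) auto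
    moreover have "\<bar>\<phi> (X x) - \<phi> (Y x)\<bar> \<le> 2 * B" using \<phi>(2)[of "X x"] \<phi>(2)[of "Y x"] by linarith
    ultimately show ?thesis using \<eta>0 by linarith
  qed
  have "\<bar>(\<integral>x. \<phi> (X x) \<partial>M) - (\<integral>x. \<phi> (Y x) \<partial>M)\<bar> = \<bar>\<integral>x. \<phi> (X x) - \<phi> (Y x) \<partial>M\<bar>"
    by (subst Bochner_Integration.integral_diff[OF iX iY]) simp
  also have "\<dots> \<le> (\<integral>x. \<bar>\<phi> (X x) - \<phi> (Y x)\<bar> \<partial>M)" by (rule integral_abs_bound)
  also have "\<dots> \<le> (\<integral>x. \<eta> + 2 * B * ((V x)\<^sup>2 / R\<^sup>2 + d x / \<delta>) \<partial>M)"
    using iX iY iV wd(1) pw by (intro integral_mono) auto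
  also have "\<dots> = \<eta> + 2 * B * ((\<integral>x. (V x)\<^sup>2 \<partial>M) / R\<^sup>2 + (\<integral>x. d x \<partial>M) / \<delta>)"
    using iV wd(1) by (simp add: prob_space)
  also have "\<dots> \<le> \<eta> + 2 * B * (energy_const / R\<^sup>2 + (\<integral>x. d x \<partial>M) / \<delta>)"
    using B0 drift_second_moment(2) unfolding V_def by (intro add_left_mono mult_left_mono add_right_mono divide_right_mono) auto
  finally show ?thesis unfolding X_def Y_def wd(2) .
qed

end

text \<open>The mean defect is at most 2 at every frequency, so its pointwise convergence passes to
  the integral against the Fourier transform of the source. The radius \<open>R\<close> comes first,
  then \<delta> from compactness of the shifts up to \<open>R\<close>, and then the index
  \<open>n\<close>.\<close>

lemma wave_expectation_difference_tendsto_0: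
  fixes M :: "nat \<Rightarrow> 'a measure" and \<phi> :: "(real \<Rightarrow>\<^sub>C complex) \<Rightarrow> real"
  assumes mb: "\<And>n. medium_bound (M n) Z (\<nu> n) C \<gamma>"
    and lim: "\<And>t1 t2. t1 \<in> {0..Z} \<Longrightarrow> t2 \<in> {0..Z} \<Longrightarrow> t1 \<noteq> t2 \<Longrightarrow> (\<lambda>n. medium.cov (M n) (\<nu> n) t1 t2) \<longlonglongrightarrow> K0 t1 t2"
    and cont: "\<And>t2. t2 \<in> {0..Z} \<Longrightarrow> continuous_on ({0..Z} - {t2}) (\<lambda>t1. K0 t1 t2)"
    and \<epsilon>: "\<And>n. 0 < \<epsilon> n" "\<epsilon> \<longlonglongrightarrow> 0" and \<tau>: "0 < \<tau>"
    and f: "source_function f" and \<phi>: "continuous_on UNIV \<phi>" "bounded (range \<phi>)"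
  shows "(\<lambda>n. (\<integral>x. \<phi> (Bcontfun (transmitted_wave Z \<tau> f (\<epsilon> n) (\<lambda>z. \<nu> n z x))) \<partial>M n)
     - (\<integral>x. \<phi> (shifted_source f (drift (\<lambda>z. \<nu> n z x) Z)) \<partial>M n)) \<longlonglongrightarrow> 0"
proof -
  interpret mb0: medium_bound "M 0" Z "\<nu> 0" C \<gamma> by (rule mb)
  have F: "integrable lborel (source_fourier f)" using f by (simp add: source_function_def)
  hence Fm [measurable]: "source_fourier f \<in> borel_measurable borel" by auto
  obtain B where B: "\<And>u. \<bar>\<phi> u\<bar> \<le> B" using \<phi>(2) unfolding bounded_real by auto
  have B0: "0 \<le> B" using B[of undefined] by linarith
  define E where "E n \<omega> = (\<integral>x. norm (reduced_transmission Z \<tau> (\<epsilon> n) (\<lambda>z. \<nu> n z x) \<omega> - 1) \<partial>M n)" for n \<omega>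
  have Elim: "(\<lambda>n. E n \<omega>) \<longlonglongrightarrow> 0" for \<omega>
    unfolding E_def by (rule transmission_defect_tendsto_0[OF mb lim cont \<epsilon> \<tau>])
  have Em: "E n \<in> borel_measurable borel" for n
  proof -
    interpret medium_bound "M n" Z "\<nu> n" C \<gamma> by (rule mb)
    show ?thesis unfolding E_def[abs_def] by (rule weighted_defect(3)[OF F])
  qed
  have E2: "\<bar>E n \<omega>\<bar> \<le> 2" for n \<omega>
  proof -
    interpret medium_bound "M n" Z "\<nu> n" C \<gamma> by (rule mb)
    have "E n \<omega> \<le> (\<integral>x. 2 \<partial>M n)"
      unfolding E_def using norm_reduced_transmission_minus_1_le integrable_transmission_defect by (intro integral_mono) auto
    moreover have "0 \<le> E n \<omega>" unfolding E_def by (rule Bochner_Integration.integral_nonneg) simp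
    ultimately show ?thesis by (simp add: prob_space)
  qed
  have "(\<lambda>n. LINT \<omega>|lborel. E n \<omega> * norm (source_fourier f \<omega>)) \<longlonglongrightarrow> (LINT \<omega>|(lborel :: real measure). 0)"
  proof (rule integral_dominated_convergence)
    show "integrable lborel (\<lambda>\<omega>. 2 * norm (source_fourier f \<omega>))" using F by (intro integrable_mult_right integrable_norm)
    show "(\<lambda>\<omega>. E n \<omega> * norm (source_fourier f \<omega>)) \<in> borel_measurable lborel" for n using Em[of n] by measurable
    show "AE \<omega> in lborel. norm (E n \<omega> * norm (source_fourier f \<omega>)) \<le> 2 * norm (source_fourier f \<omega>)" for n
      using E2 by (intro AE_I2) (auto simp: abs_mult intro!: mult_right_mono)
    show "AE \<omega> in lborel. (\<lambda>n. E n \<omega> * norm (source_fourier f \<omega>)) \<longlonglongrightarrow> 0"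
      using Elim by (intro AE_I2 tendsto_mult_left_zero)
  qed simp
  hence I: "(\<lambda>n. LINT \<omega>|lborel. E n \<omega> * norm (source_fourier f \<omega>)) \<longlonglongrightarrow> 0" by simp
  define A where "A = mb0.energy_const"
  have A: "0 \<le> A" unfolding A_def by (rule mb0.energy_const_nonneg)
  show ?thesis
  proof (rule tendstoI)
    fix e :: real assume e: "0 < e"
    \<comment> \<open>Since R^2 >= R, this yields 2 B A / R^2 <= 2 B A / R < e / 3; the summand 1
      ensures R >= 1.\<close>
    define R where "R = 1 + 6 * B * A / e"
    have R: "1 \<le> R" unfolding R_def using B0 A e by simp
    have RA: "2 * B * (A / R\<^sup>2) < e / 3"
    proof -
      have "R \<le> R\<^sup>2" using R by (simp add: power2_eq_square)
      hence "2 * B * (A / R\<^sup>2) \<le> 2 * B * (A / R)" using R A B0 by (intro mult_left_mono divide_left_mono) auto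
      also have "\<dots> < e / 3"
      proof -
        have "6 * B * A < e * R" unfolding R_def using e by (simp add: field_simps)
        thus ?thesis using R by (simp add: field_simps)
      qed
      finally show ?thesis .
    qed
    have "compact (shifted_source f ` {-R..R})"
      by (intro compact_continuous_image continuous_on_subset[OF continuous_on_shifted_source[OF f]]) auto
    from continuous_near_compact[OF \<phi>(1) this, of "e / 3"] e
    obtain \<delta> where \<delta>: "0 < \<delta>" and uc: "\<And>v u. v \<in> {-R..R} \<Longrightarrow> dist u (shifted_source f v) < \<delta> \<Longrightarrow> \<bar>\<phi> u - \<phi> (shifted_source f v)\<bar> < e / 3"
      by auto
    have "(\<lambda>n. 2 * B * ((LINT \<omega>|lborel. E n \<omega> * norm (source_fourier f \<omega>)) / \<delta>)) \<longlonglongrightarrow> 2 * B * (0 / \<delta>)"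
      using \<delta> by (intro tendsto_mult tendsto_const tendsto_divide I) auto
    hence "\<forall>\<^sub>F n in sequentially. 2 * B * ((LINT \<omega>|lborel. E n \<omega> * norm (source_fourier f \<omega>)) / \<delta>) < e / 3"
      by (rule order_tendstoD) (use e in auto)
    thus "\<forall>\<^sub>F n in sequentially. dist ((\<integral>x. \<phi> (Bcontfun (transmitted_wave Z \<tau> f (\<epsilon> n) (\<lambda>z. \<nu> n z x))) \<partial>M n)
     - (\<integral>x. \<phi> (shifted_source f (drift (\<lambda>z. \<nu> n z x) Z)) \<partial>M n)) 0 < e"
    proof eventually_elim
      case (elim n)
      interpret medium_bound "M n" Z "\<nu> n" C \<gamma> by (rule mb)
      have "\<bar>(\<integral>x. \<phi> (Bcontfun (synthesis (source_fourier f) (transmission \<tau> (\<epsilon> n) x))) \<partial>M n) - (\<integral>x. \<phi> (shifted_source f (drift (trajectory x) Z)) \<partial>M n)\<bar>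
        \<le> e / 3 + 2 * B * (A / R\<^sup>2 + (LINT \<omega>|lborel. E n \<omega> * norm (source_fourier f \<omega>)) / \<delta>)"
        unfolding A_def E_def
        by (rule expectation_difference_le[OF f \<phi>(1) B _ \<delta>]) (use R uc in \<open>auto simp: abs_le_iff\<close>)
      also have "\<dots> < e" using RA elim by (simp add: distrib_left)
      finally show ?case unfolding transmitted_wave_eq_synthesis by simp
    qed
  qed
qed

theorem theorem3p1:
  fixes Z \<tau> :: real
    and f :: "real \<Rightarrow> real"
    and M :: "real \<Rightarrow> 'a measure"
    and \<nu> :: "real \<Rightarrow> real \<Rightarrow> 'a \<Rightarrow> real"
    and N :: "'b measure"
    and V :: "real \<Rightarrow> 'b \<Rightarrow> real"
  assumes "Z > 0" and "\<tau> > 0"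
    and "source_function f"
    and "\<And>\<epsilon>. \<epsilon> > 0 \<Longrightarrow> prob_space (M \<epsilon>)"
    and "\<And>\<epsilon>. \<epsilon> > 0 \<Longrightarrow> centered_medium_process Z (M \<epsilon>) (\<nu> \<epsilon>)"
    and "prob_space N"
    and "\<exists>lam>0. cond_A1 Z M \<nu> N V \<and> cond_A2 Z M \<nu> lam \<and> cond_A3 Z M \<nu> lam"
  shows "converges_in_distribution_uniform
           M (\<lambda>\<epsilon> s x. transmitted_wave Z \<tau> f \<epsilon> (\<lambda>z. \<nu> \<epsilon> z x) s)
           N (\<lambda>s y. complex_of_real (f (s - 1 / 2 * V Z y)))"
proof -
  note f = assms(3)
  have F: "integrable lborel (source_fourier f)" using f by (simp add: source_function_def)
  from assms(7) obtain lam where lam: "0 < lam" and A1: "cond_A1 Z M \<nu> N V"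
    and A2: "cond_A2 Z M \<nu> lam" and A3: "cond_A3 Z M \<nu> lam" by blast
  obtain C \<gamma> K0 where mb: "\<And>\<epsilon>. \<epsilon> > 0 \<Longrightarrow> medium_bound (M \<epsilon>) Z (\<nu> \<epsilon>) C \<gamma>"
    and cont: "\<And>t2. t2 \<in> {0..Z} \<Longrightarrow> continuous_on ({0..Z} - {t2}) (\<lambda>t1. K0 t1 t2)"
    and lim: "\<And>S t1 t2. (\<And>n. 0 < S n) \<Longrightarrow> S \<longlonglongrightarrow> 0 \<Longrightarrow> t1 \<in> {0..Z} \<Longrightarrow> t2 \<in> {0..Z} \<Longrightarrow> t1 \<noteq> t2 \<Longrightarrow>
       (\<lambda>n. medium.cov (M (S n)) (\<nu> (S n)) t1 t2) \<longlonglongrightarrow> K0 t1 t2"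
    using cov_dominated_and_convergent[OF assms(1) lam A2 A3 assms(4,5)] by blast
  have VZ: "V Z \<in> borel_measurable N"
    using A1 assms(1) unfolding cond_A1_def second_order_process_def by auto
  have Jc: "continuous_on UNIV (shifted_source f)" by (rule continuous_on_shifted_source[OF f])
  have Xbc: "transmitted_wave Z \<tau> f \<epsilon> (\<lambda>z. \<nu> \<epsilon> z x) \<in> bcontfun" and Xm: "(\<lambda>x. Bcontfun (transmitted_wave Z \<tau> f \<epsilon> (\<lambda>z. \<nu> \<epsilon> z x))) \<in> borel_measurable (M \<epsilon>)"
    if \<epsilon>: "0 < \<epsilon>" and x: "x \<in> space (M \<epsilon>)" for \<epsilon> x
  proof -
    interpret medium_bound "M \<epsilon>" Z "\<nu> \<epsilon>" C \<gamma> by (rule mb[OF \<epsilon>])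
    show "transmitted_wave Z \<tau> f \<epsilon> (\<lambda>z. \<nu> \<epsilon> z x) \<in> bcontfun"
      unfolding transmitted_wave_eq_synthesis by (rule synthesis_bcontfun[OF F transmission_borel[OF x] norm_transmission_le[OF x]])
    show "(\<lambda>x. Bcontfun (transmitted_wave Z \<tau> f \<epsilon> (\<lambda>z. \<nu> \<epsilon> z x))) \<in> borel_measurable (M \<epsilon>)"
      unfolding transmitted_wave_eq_synthesis by (rule wave_measurable[OF f])
  qed
  \<comment> \<open>\<open>Xm\<close> shares with \<open>Xbc\<close> the premise that a sample point
    is given, so using it requires a point of the space.\<close>
  have ne: "space (M \<epsilon>) \<noteq> {}" if "0 < \<epsilon>" for \<epsilon> using prob_space.not_empty[OF assms(4)[OF that]] .
  have conv: "((\<lambda>\<epsilon>. \<integral>x. \<phi> (Bcontfun (transmitted_wave Z \<tau> f \<epsilon> (\<lambda>z. \<nu> \<epsilon> z x))) \<partial>M \<epsilon>) \<longlongrightarrow> (\<integral>y. \<phi> (shifted_source f (V Z y)) \<partial>N)) (at_right 0)"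
    if \<phi>: "continuous_on UNIV \<phi>" "bounded (range \<phi>)" for \<phi> :: "(real \<Rightarrow>\<^sub>C complex) \<Rightarrow> real"
  proof -
    \<comment> \<open>The one-dimensional law at depth \<open>Z\<close> is encoded by sequences
      vanishing from index 1 on, and the test function reads their coordinate 0.\<close>
    have "continuous_on UNIV (\<lambda>u :: nat \<Rightarrow> real. \<phi> (shifted_source f (u 0)))"
      by (intro continuous_on_compose2[OF \<phi>(1)] continuous_on_compose2[OF Jc] continuous_on_product_coordinates) auto
    moreover have "bounded (range (\<lambda>u :: nat \<Rightarrow> real. \<phi> (shifted_source f (u 0))))"
      by (rule bounded_subset[OF \<phi>(2)]) auto
    moreover have "converges_in_distribution M (\<lambda>\<epsilon> x. (\<lambda>i. if i < (1::nat) then LINT z':{0..Z}|lborel. \<nu> \<epsilon> z' x else 0))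
        N (\<lambda>y. (\<lambda>i. if i < 1 then V Z y else 0))"
      using A1 assms(1) unfolding cond_A1_def fdd_converge_def by (elim conjE allE[of _ "1::nat"] allE[of _ "\<lambda>_. Z"]) auto
    ultimately have 1: "((\<lambda>\<epsilon>. \<integral>x. \<phi> (shifted_source f (drift (\<lambda>z. \<nu> \<epsilon> z x) Z)) \<partial>M \<epsilon>) \<longlongrightarrow> (\<integral>y. \<phi> (shifted_source f (V Z y)) \<partial>N)) (at_right 0)"
      unfolding converges_in_distribution_def drift_def by force
    \<comment> \<open>Dominated convergence is available along sequences, so the limit at 0 from the
      right is tested on arbitrary positive null sequences.\<close>
    have "((\<lambda>\<epsilon>. (\<integral>x. \<phi> (Bcontfun (transmitted_wave Z \<tau> f \<epsilon> (\<lambda>z. \<nu> \<epsilon> z x))) \<partial>M \<epsilon>)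
       - (\<integral>x. \<phi> (shifted_source f (drift (\<lambda>z. \<nu> \<epsilon> z x) Z)) \<partial>M \<epsilon>)) \<longlongrightarrow> 0) (at_right 0)"
    proof (rule tendsto_at_right_sequentially[of 0 1])
      fix S :: "nat \<Rightarrow> real" assume S: "\<And>n. 0 < S n" "S \<longlonglongrightarrow> 0"
      show "(\<lambda>n. (\<integral>x. \<phi> (Bcontfun (transmitted_wave Z \<tau> f (S n) (\<lambda>z. \<nu> (S n) z x))) \<partial>M (S n))
       - (\<integral>x. \<phi> (shifted_source f (drift (\<lambda>z. \<nu> (S n) z x) Z)) \<partial>M (S n))) \<longlonglongrightarrow> 0"
        by (rule wave_expectation_difference_tendsto_0[where M="\<lambda>n. M (S n)" and \<nu>="\<lambda>n. \<nu> (S n)" and \<epsilon>=S, OF mb[OF S(1)] lim[OF S] cont S assms(2) f \<phi>])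
    qed simp
    from tendsto_add[OF this 1] show ?thesis by simp
  qed
  show ?thesis
    unfolding converges_in_distribution_uniform_def converges_in_distribution_def
  proof (intro conjI allI impI ballI)
    show "(\<lambda>s. transmitted_wave Z \<tau> f \<epsilon> (\<lambda>z. \<nu> \<epsilon> z x) s) \<in> bcontfun" if "0 < \<epsilon>" "x \<in> space (M \<epsilon>)" for \<epsilon> x
      using Xbc[OF that] .
    show "(\<lambda>s. complex_of_real (f (s - 1 / 2 * V Z y))) \<in> bcontfun" for y
      by (rule shifted_source_bcontfun[OF f])
    show "(\<lambda>x. Bcontfun (\<lambda>s. transmitted_wave Z \<tau> f \<epsilon> (\<lambda>z. \<nu> \<epsilon> z x) s)) \<in> borel_measurable (M \<epsilon>)" if "0 < \<epsilon>" for \<epsilon>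
      using Xm[OF that] ne[OF that] by blast
    show "(\<lambda>y. Bcontfun (\<lambda>s. complex_of_real (f (s - 1 / 2 * V Z y)))) \<in> borel_measurable N"
      using measurable_compose[OF VZ borel_measurable_continuous_onI[OF Jc]] unfolding shifted_source_def .
    show "((\<lambda>\<epsilon>. \<integral>x. \<phi> (Bcontfun (\<lambda>s. transmitted_wave Z \<tau> f \<epsilon> (\<lambda>z. \<nu> \<epsilon> z x) s)) \<partial>M \<epsilon>) \<longlongrightarrow>
        (\<integral>y. \<phi> (Bcontfun (\<lambda>s. complex_of_real (f (s - 1 / 2 * V Z y)))) \<partial>N)) (at_right 0)"
      if "continuous_on UNIV \<phi> \<and> bounded (range \<phi>)" for \<phi> :: "(real \<Rightarrow>\<^sub>C complex) \<Rightarrow> real"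
      using conv[of \<phi>] that unfolding shifted_source_def by blast
  qed
qed

end
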